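(* Over $\mathsf{RCA}_0^\omega$ there is an explicit equivalence $\mathsf{USADS}\leftrightarrow(\mu^2)$, where $\mathsf{USADS}$ is the statement that there is a functional $\Psi^{1\to1}$ such that for every stable linear order $X^1$, either $(\forall n^{0})\,\Psi(X)(n)<_{X} \Psi(X)(n+1)$ or $(\forall m^{0})\,\Psi(X)(m)>_{X} \Psi(X)(m+1)$.
   Context: Types: $0$ is the type of natural numbers, $1=0\to 0$, $2=1\to 0$. Sets of naturals are type-1 objects given by binary characteristic functions. $\mathsf{RCA}_0^\omega$ is Kohlenbach's base theory $\mathsf{E}\text{-}\mathsf{PRA}^\omega+\mathsf{QF}\text{-}\mathsf{AC}^{1,0}$: $\mathsf{E}\text{-}\mathsf{PRA}^\omega$ is classical extensional primitive recursive arithmetic in all finite types (combinators, recursor for type 0 only, quantifier-free induction, and the full extensionality axiom), and $\mathsf{QF}\text{-}\mathsf{AC}^{1,0}$ is $(\forall f^1)(\exists n^0)\varphi_0(f,n)\to(\exists F^2)(\forall f^1)\varphi_0(f,F(f))$ for quantifier-free $\varphi_0$. $(\mu^2)$ is $(\exists\mu^2)(\forall f^1)[(\exists n^0)f(n)=0\to f(\mu(f))=0]$. A linear order $X^1$ is coded as a set of pairs of naturals; $\le_X,<_X$ denote the order and strict order on its field. A linear order is discrete if every element has an immediate predecessor, except for the first element if there is one, and every element has an immediate successor, except for the last element if there is one. A linear order is stable if it is discrete, has more than one element, and every element has either finitely many predecessors or finitely many successors (so a stable order is infinite). An implication $(\exists \Phi)A(\Phi)\to(\exists\Psi)B(\Psi)$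 is explicit if there is a term $t$ of the language such that additionally $(\forall\Phi)[A(\Phi)\to B(t(\Phi))]$ is provable. By convention the implication is still called explicit if $t$ takes as an additional argument an extensionality functional for $\Phi$, i.e. a functional $\Xi$ such that $(\forall k^0,f^1,g^1)[\overline f\,\Xi(f,g,k)=\overline g\,\Xi(f,g,k)\to\overline{\Phi(f)}k=\overline{\Phi(g)}k]$, where $\overline f n$ is the initial segment of $f$ of length $n$. An explicit equivalence is a provable equivalence both of whose implications are explicit. *)

theory Defs
  imports Main
begin

section \<open>Syntax of the language of finite types\<close>

datatype ty = N | Fn ty ty (infixr "\<rightarrow>\<^sub>t" 60)

abbreviation one :: ty where "one \<equiv> N \<rightarrow>\<^sub>t N"
abbreviation two :: ty where "two \<equiv> one \<rightarrow>\<^sub>t N"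

text \<open>
  Every type has its own supply of de Bruijn indices: \<open>Var \<rho> n\<close> is the \<open>n\<close>-th variable of
  type \<open>\<rho>\<close>, and the quantifier \<open>AllF \<rho>\<close> binds \<open>Var \<rho> 0\<close> and leaves variables of all
  other types alone.
\<close>

datatype tm =
    Var ty nat
  | Zero
  | Succ
  | Proj ty ty
  | Comb ty ty ty
  | Rec
  | App tm tm (infixl "\<^bold>\<cdot>" 100)

primrec tyof :: "tm \<Rightarrow> ty" where
  "tyof (Var \<rho> n) = \<rho>"
| "tyof Zero = N"
| "tyof Succ = N \<rightarrow>\<^sub>t N"
| "tyof (Proj \<rho> \<sigma>) = \<rho> \<rightarrow>\<^sub>t \<sigma> \<rightarrow>\<^sub>t \<rho>"
| "tyof (Comb \<delta> \<rho> \<tau>) = (\<delta> \<rightarrow>\<^sub>t \<rho> \<rightarrow>\<^sub>t \<tau>) \<rightarrow>\<^sub>t (\<delta> \<rightarrow>\<^sub>t \<rho>) \<rightarrow>\<^sub>t \<delta> \<rightarrow>\<^sub>t \<tau>"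
| "tyof Rec = N \<rightarrow>\<^sub>t N \<rightarrow>\<^sub>t (N \<rightarrow>\<^sub>t N \<rightarrow>\<^sub>t N) \<rightarrow>\<^sub>t N"
| "tyof (s \<^bold>\<cdot> t) = (case tyof s of N \<Rightarrow> N | \<rho> \<rightarrow>\<^sub>t \<tau> \<Rightarrow> \<tau>)"

primrec wt :: "tm \<Rightarrow> bool" where
  "wt (Var \<rho> n) \<longleftrightarrow> True"
| "wt Zero \<longleftrightarrow> True"
| "wt Succ \<longleftrightarrow> True"
| "wt (Proj \<rho> \<sigma>) \<longleftrightarrow> True"
| "wt (Comb \<delta> \<rho> \<tau>) \<longleftrightarrow> True"
| "wt Rec \<longleftrightarrow> True"
| "wt (s \<^bold>\<cdot> t) \<longleftrightarrow> wt s \<and> wt t \<and> (\<exists>\<tau>. tyof s = tyof t \<rightarrow>\<^sub>t \<tau>)"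

definition has_type :: "tm \<Rightarrow> ty \<Rightarrow> bool" (infix ":\<^sub>t" 50) where
  "t :\<^sub>t \<rho> \<longleftrightarrow> wt t \<and> tyof t = \<rho>"

primrec closed_tm :: "tm \<Rightarrow> bool" where
  "closed_tm (Var \<rho> n) \<longleftrightarrow> False"
| "closed_tm Zero \<longleftrightarrow> True"
| "closed_tm Succ \<longleftrightarrow> True"
| "closed_tm (Proj \<rho> \<sigma>) \<longleftrightarrow> True"
| "closed_tm (Comb \<delta> \<rho> \<tau>) \<longleftrightarrow> True"
| "closed_tm Rec \<longleftrightarrow> True"
| "closed_tm (s \<^bold>\<cdot> t) \<longleftrightarrow> closed_tm s \<and> closed_tm t"

text \<open>The only prime formulas are equations; well-formed ones are between terms of type 0.\<close>

datatype fm =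
    Eq tm tm (infix "\<^bold>=" 50)
  | Falsum
  | Imp fm fm (infixr "\<^bold>\<longrightarrow>" 25)
  | AllF ty fm

abbreviation Neg :: "fm \<Rightarrow> fm" ("\<^bold>\<not> _" [40] 40) where
  "\<^bold>\<not> \<phi> \<equiv> \<phi> \<^bold>\<longrightarrow> Falsum"
abbreviation Disj :: "fm \<Rightarrow> fm \<Rightarrow> fm" (infixr "\<^bold>\<or>" 30) where
  "\<phi> \<^bold>\<or> \<psi> \<equiv> (\<^bold>\<not> \<phi>) \<^bold>\<longrightarrow> \<psi>"
abbreviation Conj :: "fm \<Rightarrow> fm \<Rightarrow> fm" (infixr "\<^bold>\<and>" 35) where
  "\<phi> \<^bold>\<and> \<psi> \<equiv> \<^bold>\<not> (\<phi> \<^bold>\<longrightarrow> \<^bold>\<not> \<psi>)"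
abbreviation Iff :: "fm \<Rightarrow> fm \<Rightarrow> fm" (infixr "\<^bold>\<longleftrightarrow>" 25) where
  "\<phi> \<^bold>\<longleftrightarrow> \<psi> \<equiv> (\<phi> \<^bold>\<longrightarrow> \<psi>) \<^bold>\<and> (\<psi> \<^bold>\<longrightarrow> \<phi>)"
abbreviation ExF :: "ty \<Rightarrow> fm \<Rightarrow> fm" where
  "ExF \<rho> \<phi> \<equiv> \<^bold>\<not> (AllF \<rho> (\<^bold>\<not> \<phi>))"

primrec wf_fm :: "fm \<Rightarrow> bool" where
  "wf_fm (s \<^bold>= t) \<longleftrightarrow> s :\<^sub>t N \<and> t :\<^sub>t N"
| "wf_fm Falsum \<longleftrightarrow> True"
| "wf_fm (\<phi> \<^bold>\<longrightarrow> \<psi>) \<longleftrightarrow> wf_fm \<phi> \<and> wf_fm \<psi>"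
| "wf_fm (AllF \<rho> \<phi>) \<longleftrightarrow> wf_fm \<phi>"

primrec quantifier_free :: "fm \<Rightarrow> bool" where
  "quantifier_free (s \<^bold>= t) \<longleftrightarrow> True"
| "quantifier_free Falsum \<longleftrightarrow> True"
| "quantifier_free (\<phi> \<^bold>\<longrightarrow> \<psi>) \<longleftrightarrow> quantifier_free \<phi> \<and> quantifier_free \<psi>"
| "quantifier_free (AllF \<rho> \<phi>) \<longleftrightarrow> False"

subsection \<open>Substitution\<close>

type_synonym subst = "ty \<Rightarrow> nat \<Rightarrow> tm"

primrec tsubst :: "subst \<Rightarrow> tm \<Rightarrow> tm" where
  "tsubst \<theta> (Var \<rho> n) = \<theta> \<rho> n"
| "tsubst \<theta> Zero = Zero"
| "tsubst \<theta> Succ = Succ"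
| "tsubst \<theta> (Proj \<rho> \<sigma>) = Proj \<rho> \<sigma>"
| "tsubst \<theta> (Comb \<delta> \<rho> \<tau>) = Comb \<delta> \<rho> \<tau>"
| "tsubst \<theta> Rec = Rec"
| "tsubst \<theta> (s \<^bold>\<cdot> t) = tsubst \<theta> s \<^bold>\<cdot> tsubst \<theta> t"

definition shift :: "ty \<Rightarrow> subst" where
  "shift \<rho> = (\<lambda>\<tau> n. Var \<tau> (if \<tau> = \<rho> then Suc n else n))"

definition under :: "ty \<Rightarrow> subst \<Rightarrow> subst" where
  "under \<rho> \<theta> = (\<lambda>\<tau> n. if \<tau> = \<rho>
     then (case n of 0 \<Rightarrow> Var \<rho> 0 | Suc m \<Rightarrow> tsubst (shift \<rho>) (\<theta> \<rho> m))
     else tsubst (shift \<rho>) (\<theta> \<tau> n))"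

primrec fsubst :: "subst \<Rightarrow> fm \<Rightarrow> fm" where
  "fsubst \<theta> (s \<^bold>= t) = (tsubst \<theta> s \<^bold>= tsubst \<theta> t)"
| "fsubst \<theta> Falsum = Falsum"
| "fsubst \<theta> (\<phi> \<^bold>\<longrightarrow> \<psi>) = (fsubst \<theta> \<phi> \<^bold>\<longrightarrow> fsubst \<theta> \<psi>)"
| "fsubst \<theta> (AllF \<rho> \<phi>) = AllF \<rho> (fsubst (under \<rho> \<theta>) \<phi>)"

abbreviation lift_tm :: "ty \<Rightarrow> tm \<Rightarrow> tm" where
  "lift_tm \<rho> \<equiv> tsubst (shift \<rho>)"
abbreviation lift_fm :: "ty \<Rightarrow> fm \<Rightarrow> fm" where
  "lift_fm \<rho> \<equiv> fsubst (shift \<rho>)"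

definition inst :: "ty \<Rightarrow> tm \<Rightarrow> fm \<Rightarrow> fm" where
  "inst \<rho> t = fsubst (\<lambda>\<tau> n. if \<tau> = \<rho> then (case n of 0 \<Rightarrow> t | Suc m \<Rightarrow> Var \<rho> m) else Var \<tau> n)"

section \<open>The theory \<open>RCA\<^sub>0\<^sup>\<omega>\<close>\<close>

text \<open>Equality at higher types is pointwise equality.\<close>

primrec eq_at :: "ty \<Rightarrow> tm \<Rightarrow> tm \<Rightarrow> fm" where
  "eq_at N s t = (s \<^bold>= t)"
| "eq_at (\<rho> \<rightarrow>\<^sub>t \<tau>) s t = AllF \<rho> (eq_at \<tau> (lift_tm \<rho> s \<^bold>\<cdot> Var \<rho> 0) (lift_tm \<rho> t \<^bold>\<cdot> Var \<rho> 0))"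

text \<open>
  Free variables in axioms are implicitly universally quantified. In \<open>QF_IA\<close> the induction
  variable is \<open>Var N 0\<close>. In \<open>QF_AC\<close> the formula \<open>\<phi>(f, n)\<close> has \<open>f = Var one 0\<close> and
  \<open>n = Var N 0\<close>; in the conclusion \<open>\<phi>\<close> is lifted over the binder for \<open>F = Var two 0\<close> and
  \<open>n\<close> is replaced by \<open>F f\<close>. In both schemata \<open>\<phi>\<close> may have further variables of any type.
\<close>

inductive RCA0w_axiom :: "fm \<Rightarrow> bool" where
  eq_refl: "RCA0w_axiom (Var N 0 \<^bold>= Var N 0)"
| eq_sym: "RCA0w_axiom (Var N 0 \<^bold>= Var N 1 \<^bold>\<longrightarrow> Var N 1 \<^bold>= Var N 0)"
| eq_trans: "RCA0w_axiom (Var N 0 \<^bold>= Var N 1 \<^bold>\<longrightarrow> Var N 1 \<^bold>= Var N 2 \<^bold>\<longrightarrow> Var N 0 \<^bold>= Var N 2)"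
| extensionality: "RCA0w_axiom (eq_at \<rho> (Var \<rho> 0) (Var \<rho> 1) \<^bold>\<longrightarrow>
    eq_at \<tau> (Var (\<rho> \<rightarrow>\<^sub>t \<tau>) 0 \<^bold>\<cdot> Var \<rho> 0) (Var (\<rho> \<rightarrow>\<^sub>t \<tau>) 0 \<^bold>\<cdot> Var \<rho> 1))"
| Succ_not_Zero: "RCA0w_axiom (\<^bold>\<not> (Succ \<^bold>\<cdot> Var N 0 \<^bold>= Zero))"
| Succ_inject: "RCA0w_axiom (Succ \<^bold>\<cdot> Var N 0 \<^bold>= Succ \<^bold>\<cdot> Var N 1 \<^bold>\<longrightarrow> Var N 0 \<^bold>= Var N 1)"
| Proj: "s = Var \<rho> 0 \<Longrightarrow> t = Var \<sigma> 1 \<Longrightarrow>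
    RCA0w_axiom (eq_at \<rho> (Proj \<rho> \<sigma> \<^bold>\<cdot> s \<^bold>\<cdot> t) s)"
| Comb: "s = Var (\<delta> \<rightarrow>\<^sub>t \<rho> \<rightarrow>\<^sub>t \<tau>) 0 \<Longrightarrow> t = Var (\<delta> \<rightarrow>\<^sub>t \<rho>) 1 \<Longrightarrow> u = Var \<delta> 2 \<Longrightarrow>
    RCA0w_axiom (eq_at \<tau> (Comb \<delta> \<rho> \<tau> \<^bold>\<cdot> s \<^bold>\<cdot> t \<^bold>\<cdot> u) (s \<^bold>\<cdot> u \<^bold>\<cdot> (t \<^bold>\<cdot> u)))"
| Rec_Zero: "y = Var N 1 \<Longrightarrow> z = Var (N \<rightarrow>\<^sub>t N \<rightarrow>\<^sub>t N) 0 \<Longrightarrow>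
    RCA0w_axiom (Rec \<^bold>\<cdot> Zero \<^bold>\<cdot> y \<^bold>\<cdot> z \<^bold>= y)"
| Rec_Succ: "x = Var N 0 \<Longrightarrow> y = Var N 1 \<Longrightarrow> z = Var (N \<rightarrow>\<^sub>t N \<rightarrow>\<^sub>t N) 0 \<Longrightarrow>
    RCA0w_axiom (Rec \<^bold>\<cdot> (Succ \<^bold>\<cdot> x) \<^bold>\<cdot> y \<^bold>\<cdot> z \<^bold>= z \<^bold>\<cdot> (Rec \<^bold>\<cdot> x \<^bold>\<cdot> y \<^bold>\<cdot> z) \<^bold>\<cdot> x)"
| QF_IA: "wf_fm \<phi> \<Longrightarrow> quantifier_free \<phi> \<Longrightarrow>
    RCA0w_axiom (inst N Zero \<phi> \<^bold>\<longrightarrow>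
      AllF N (\<phi> \<^bold>\<longrightarrow> inst N (Succ \<^bold>\<cdot> Var N 0) (fsubst (under N (shift N)) \<phi>)) \<^bold>\<longrightarrow>
      AllF N \<phi>)"
| QF_AC: "wf_fm \<phi> \<Longrightarrow> quantifier_free \<phi> \<Longrightarrow>
    RCA0w_axiom (AllF one (ExF N \<phi>) \<^bold>\<longrightarrow>
      ExF two (AllF one (inst N (Var two 0 \<^bold>\<cdot> Var one 0) (lift_fm two \<phi>))))"

text \<open>Classical many-sorted natural deduction over these axioms.\<close>

inductive derives :: "fm set \<Rightarrow> fm \<Rightarrow> bool" (infix "\<turnstile>" 20) where
  Assm: "\<phi> \<in> \<Delta> \<Longrightarrow> wf_fm \<phi> \<Longrightarrow> \<Delta> \<turnstile> \<phi>"
| Axiom: "RCA0w_axiom \<phi> \<Longrightarrow> \<Delta> \<turnstile> \<phi>"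
| ImpI: "wf_fm \<phi> \<Longrightarrow> insert \<phi> \<Delta> \<turnstile> \<psi> \<Longrightarrow> \<Delta> \<turnstile> (\<phi> \<^bold>\<longrightarrow> \<psi>)"
| ImpE: "\<Delta> \<turnstile> (\<phi> \<^bold>\<longrightarrow> \<psi>) \<Longrightarrow> \<Delta> \<turnstile> \<phi> \<Longrightarrow> \<Delta> \<turnstile> \<psi>"
| Raa: "wf_fm \<phi> \<Longrightarrow> insert (\<^bold>\<not> \<phi>) \<Delta> \<turnstile> Falsum \<Longrightarrow> \<Delta> \<turnstile> \<phi>"
| AllI: "lift_fm \<rho> ` \<Delta> \<turnstile> \<phi> \<Longrightarrow> \<Delta> \<turnstile> AllF \<rho> \<phi>"
| AllE: "\<Delta> \<turnstile> AllF \<rho> \<phi> \<Longrightarrow> t :\<^sub>t \<rho> \<Longrightarrow> \<Delta> \<turnstile> inst \<rho> t \<phi>"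

abbreviation RCA0w_proves :: "fm \<Rightarrow> bool" where
  "RCA0w_proves \<phi> \<equiv> {} \<turnstile> \<phi>"

section \<open>Named variables and primitive recursive terms\<close>

text \<open>
  \<open>Forall \<rho> n (\<lambda>x. \<phi> x)\<close> is the formula \<open>\<forall>x\<^sup>\<rho>. \<phi>(x)\<close>, where \<open>x\<close> is given the name
  \<open>Var \<rho> n\<close> inside \<open>\<phi>\<close>; \<open>Lam \<rho> n\<close> is the analogous abstraction of terms, defined with the
  combinators. Nested binders of the same type must use distinct \<open>n\<close>.
\<close>

definition bind_name :: "ty \<Rightarrow> nat \<Rightarrow> subst" where
  "bind_name \<rho> n = (\<lambda>\<tau> m. Var \<tau> (if \<tau> = \<rho> then (if m = n then 0 else Suc m) else m))"

definition Forall :: "ty \<Rightarrow> nat \<Rightarrow> (tm \<Rightarrow> fm) \<Rightarrow> fm" where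
  "Forall \<rho> n \<phi> = AllF \<rho> (fsubst (bind_name \<rho> n) (\<phi> (Var \<rho> n)))"

definition Exists :: "ty \<Rightarrow> nat \<Rightarrow> (tm \<Rightarrow> fm) \<Rightarrow> fm" where
  "Exists \<rho> n \<phi> = ExF \<rho> (fsubst (bind_name \<rho> n) (\<phi> (Var \<rho> n)))"

primrec abstract :: "ty \<Rightarrow> nat \<Rightarrow> tm \<Rightarrow> tm" where
  "abstract \<rho> n (Var \<tau> m) = (if \<tau> = \<rho> \<and> m = n
     then Comb \<rho> (\<rho> \<rightarrow>\<^sub>t \<rho>) \<rho> \<^bold>\<cdot> Proj \<rho> (\<rho> \<rightarrow>\<^sub>t \<rho>) \<^bold>\<cdot> Proj \<rho> \<rho>
     else Proj \<tau> \<rho> \<^bold>\<cdot> Var \<tau> m)"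
| "abstract \<rho> n Zero = Proj N \<rho> \<^bold>\<cdot> Zero"
| "abstract \<rho> n Succ = Proj (tyof Succ) \<rho> \<^bold>\<cdot> Succ"
| "abstract \<rho> n (Proj \<sigma> \<tau>) = Proj (tyof (Proj \<sigma> \<tau>)) \<rho> \<^bold>\<cdot> Proj \<sigma> \<tau>"
| "abstract \<rho> n (Comb \<delta> \<sigma> \<tau>) = Proj (tyof (Comb \<delta> \<sigma> \<tau>)) \<rho> \<^bold>\<cdot> Comb \<delta> \<sigma> \<tau>"
| "abstract \<rho> n Rec = Proj (tyof Rec) \<rho> \<^bold>\<cdot> Rec"
| "abstract \<rho> n (s \<^bold>\<cdot> t) =
     Comb \<rho> (tyof t) (tyof (s \<^bold>\<cdot> t)) \<^bold>\<cdot> abstract \<rho> n s \<^bold>\<cdot> abstract \<rho> n t"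

definition Lam :: "ty \<Rightarrow> nat \<Rightarrow> (tm \<Rightarrow> tm) \<Rightarrow> tm" where
  "Lam \<rho> n t = abstract \<rho> n (t (Var \<rho> n))"

definition plus_tm :: "tm \<Rightarrow> tm \<Rightarrow> tm" (infixl "\<^bold>+" 65) where
  "s \<^bold>+ t = Rec \<^bold>\<cdot> t \<^bold>\<cdot> s \<^bold>\<cdot> Lam N 0 (\<lambda>r. Lam N 1 (\<lambda>i. Succ \<^bold>\<cdot> r))"

definition pred_tm :: "tm \<Rightarrow> tm" where
  "pred_tm t = Rec \<^bold>\<cdot> t \<^bold>\<cdot> Zero \<^bold>\<cdot> Lam N 0 (\<lambda>r. Lam N 1 (\<lambda>i. i))"

definition monus_tm :: "tm \<Rightarrow> tm \<Rightarrow> tm" where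
  "monus_tm s t = Rec \<^bold>\<cdot> t \<^bold>\<cdot> s \<^bold>\<cdot> Lam N 0 (\<lambda>r. Lam N 1 (\<lambda>i. pred_tm r))"

definition triangle_tm :: "tm \<Rightarrow> tm" where
  "triangle_tm t = Rec \<^bold>\<cdot> t \<^bold>\<cdot> Zero \<^bold>\<cdot> Lam N 0 (\<lambda>r. Lam N 1 (\<lambda>i. r \<^bold>+ Succ \<^bold>\<cdot> i))"

text \<open>The Cantor pairing; being a bijection, it makes every number code a pair.\<close>

definition pair_tm :: "tm \<Rightarrow> tm \<Rightarrow> tm" where
  "pair_tm s t = triangle_tm (s \<^bold>+ t) \<^bold>+ s"

definition Leq :: "tm \<Rightarrow> tm \<Rightarrow> fm" (infix "\<^bold>\<le>" 50) where
  "s \<^bold>\<le> t = (monus_tm s t \<^bold>= Zero)"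

definition Less :: "tm \<Rightarrow> tm \<Rightarrow> fm" (infix "\<^bold><" 50) where
  "s \<^bold>< t = (Succ \<^bold>\<cdot> s \<^bold>\<le> t)"

section \<open>Stable linear orders\<close>

text \<open>
  The argument \<open>X\<close> below is a variable of type 1, and number arguments \<open>s\<close>, \<open>t\<close> are arbitrary
  terms; the quantified number variables are named \<open>0\<close>, \<open>1\<close>, \<open>2\<close>.
\<close>

definition Is_set :: "tm \<Rightarrow> fm" where
  "Is_set X = Forall N 0 (\<lambda>n. X \<^bold>\<cdot> n \<^bold>= Zero \<^bold>\<or> X \<^bold>\<cdot> n \<^bold>= Succ \<^bold>\<cdot> Zero)"

definition Mem :: "tm \<Rightarrow> tm \<Rightarrow> fm" where
  "Mem s X = (X \<^bold>\<cdot> s \<^bold>= Succ \<^bold>\<cdot> Zero)"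

definition leX :: "tm \<Rightarrow> tm \<Rightarrow> tm \<Rightarrow> fm" where
  "leX X s t = Mem (pair_tm s t) X"

definition ltX :: "tm \<Rightarrow> tm \<Rightarrow> tm \<Rightarrow> fm" where
  "ltX X s t = (leX X s t \<^bold>\<and> \<^bold>\<not> (s \<^bold>= t))"

definition Field_mem :: "tm \<Rightarrow> tm \<Rightarrow> fm" where
  "Field_mem X s = leX X s s"

definition Linear_order :: "tm \<Rightarrow> fm" where
  "Linear_order X =
    (Is_set X
     \<^bold>\<and> Forall N 0 (\<lambda>x. Forall N 1 (\<lambda>y. leX X x y \<^bold>\<longrightarrow> Field_mem X x \<^bold>\<and> Field_mem X y))
     \<^bold>\<and> Forall N 0 (\<lambda>x. Forall N 1 (\<lambda>y. Forall N 2 (\<lambda>z. leX X x y \<^bold>\<and> leX X y z \<^bold>\<longrightarrow> leX X x z)))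
     \<^bold>\<and> Forall N 0 (\<lambda>x. Forall N 1 (\<lambda>y. leX X x y \<^bold>\<and> leX X y x \<^bold>\<longrightarrow> x \<^bold>= y))
     \<^bold>\<and> Forall N 0 (\<lambda>x. Forall N 1 (\<lambda>y.
         Field_mem X x \<^bold>\<and> Field_mem X y \<^bold>\<longrightarrow> leX X x y \<^bold>\<or> leX X y x)))"

definition Discrete :: "tm \<Rightarrow> fm" where
  "Discrete X = Forall N 0 (\<lambda>x. Field_mem X x \<^bold>\<longrightarrow>
     (Forall N 1 (\<lambda>y. Field_mem X y \<^bold>\<longrightarrow> leX X x y) \<^bold>\<or>
      Exists N 1 (\<lambda>y. ltX X y x \<^bold>\<and> \<^bold>\<not> Exists N 2 (\<lambda>z. ltX X y z \<^bold>\<and> ltX X z x))) \<^bold>\<and>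
     (Forall N 1 (\<lambda>y. Field_mem X y \<^bold>\<longrightarrow> leX X y x) \<^bold>\<or>
      Exists N 1 (\<lambda>y. ltX X x y \<^bold>\<and> \<^bold>\<not> Exists N 2 (\<lambda>z. ltX X x z \<^bold>\<and> ltX X z y))))"

text \<open>A set of natural numbers is finite if it is bounded.\<close>

definition Finitely_many :: "(tm \<Rightarrow> fm) \<Rightarrow> fm" where
  "Finitely_many \<phi> = Exists N 1 (\<lambda>b. Forall N 2 (\<lambda>y. \<phi> y \<^bold>\<longrightarrow> y \<^bold>\<le> b))"

text \<open>
  ``Either finitely many predecessors or finitely many successors'' is exclusive: with an
  inclusive disjunction the finite orders with at least two elements would be stable,
  whereas stable orders are meant to be infinite.
\<close>

definition Stable :: "tm \<Rightarrow> fm" where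
  "Stable X =
    (Linear_order X \<^bold>\<and> Discrete X
     \<^bold>\<and> Exists N 0 (\<lambda>x. Exists N 1 (\<lambda>y. Field_mem X x \<^bold>\<and> Field_mem X y \<^bold>\<and> \<^bold>\<not> (x \<^bold>= y)))
     \<^bold>\<and> Forall N 0 (\<lambda>x. Field_mem X x \<^bold>\<longrightarrow>
         (Finitely_many (\<lambda>y. ltX X y x) \<^bold>\<or> Finitely_many (\<lambda>y. ltX X x y)) \<^bold>\<and>
         \<^bold>\<not> (Finitely_many (\<lambda>y. ltX X y x) \<^bold>\<and> Finitely_many (\<lambda>y. ltX X x y))))"

section \<open>Explicit equivalences\<close>

text \<open>
  An existential statement \<open>\<exists>\<Phi>\<^sup>\<rho>. A(\<Phi>)\<close> is given by the type \<open>\<rho>\<close> and the formula \<open>A\<close>, whose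
  only free variable is \<open>\<Phi> = Var \<rho> 0\<close>.
\<close>

abbreviation ext_ty :: ty where
  "ext_ty \<equiv> one \<rightarrow>\<^sub>t one \<rightarrow>\<^sub>t N \<rightarrow>\<^sub>t N"

text \<open>Equality of the initial segments of length \<open>s\<close> of \<open>f\<close> and \<open>g\<close>.\<close>

definition Same_initial_segment :: "tm \<Rightarrow> tm \<Rightarrow> tm \<Rightarrow> fm" where
  "Same_initial_segment s f g = Forall N 1 (\<lambda>i. i \<^bold>< s \<^bold>\<longrightarrow> f \<^bold>\<cdot> i \<^bold>= g \<^bold>\<cdot> i)"

definition Ext_functional :: "tm \<Rightarrow> tm \<Rightarrow> fm" where
  "Ext_functional \<Xi> \<Phi> = Forall N 0 (\<lambda>k. Forall one 0 (\<lambda>f. Forall one 1 (\<lambda>g.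
     Same_initial_segment (\<Xi> \<^bold>\<cdot> f \<^bold>\<cdot> g \<^bold>\<cdot> k) f g \<^bold>\<longrightarrow> Same_initial_segment k (\<Phi> \<^bold>\<cdot> f) (\<Phi> \<^bold>\<cdot> g))))"

text \<open>
  The second disjunct is the convention that \<open>t\<close> may also take an extensionality functional
  for \<open>\<Phi>\<close>; this notion makes sense for \<open>\<Phi>\<close> of type \<open>1 \<rightarrow> 1\<close> only.
\<close>

definition explicit_implication :: "ty \<Rightarrow> fm \<Rightarrow> ty \<Rightarrow> fm \<Rightarrow> bool" where
  "explicit_implication \<rho> A \<sigma> B \<longleftrightarrow>
     RCA0w_proves (ExF \<rho> A \<^bold>\<longrightarrow> ExF \<sigma> B) \<and>
     ((\<exists>t. closed_tm t \<and> t :\<^sub>t \<rho> \<rightarrow>\<^sub>t \<sigma> \<and>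
         RCA0w_proves (AllF \<rho> (A \<^bold>\<longrightarrow> inst \<sigma> (t \<^bold>\<cdot> Var \<rho> 0) B))) \<or>
      \<rho> = one \<rightarrow>\<^sub>t one \<and>
      (\<exists>t. closed_tm t \<and> t :\<^sub>t \<rho> \<rightarrow>\<^sub>t ext_ty \<rightarrow>\<^sub>t \<sigma> \<and>
         RCA0w_proves (AllF \<rho> (AllF ext_ty
           (A \<^bold>\<and> Ext_functional (Var ext_ty 0) (Var \<rho> 0) \<^bold>\<longrightarrow>
             inst \<sigma> (t \<^bold>\<cdot> Var \<rho> 0 \<^bold>\<cdot> Var ext_ty 0) B)))))"

definition explicit_equivalence :: "ty \<Rightarrow> fm \<Rightarrow> ty \<Rightarrow> fm \<Rightarrow> bool" where
  "explicit_equivalence \<rho> A \<sigma> B \<longleftrightarrow>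
     RCA0w_proves (ExF \<rho> A \<^bold>\<longleftrightarrow> ExF \<sigma> B) \<and>
     explicit_implication \<rho> A \<sigma> B \<and> explicit_implication \<sigma> B \<rho> A"

section \<open>\<open>USADS\<close> and \<open>(\<mu>\<^sup>2)\<close>\<close>

text \<open>
  \<open>USADS\<close> is \<open>\<exists>\<Psi>\<^bsup>1\<rightarrow>1\<^esup>. USADS_matrix\<close> with \<open>\<Psi> = Var (one \<rightarrow>\<^sub>t one) 0\<close>, and \<open>(\<mu>\<^sup>2)\<close> is
  \<open>\<exists>\<mu>\<^sup>2. mu_matrix\<close> with \<open>\<mu> = Var two 0\<close>.
\<close>

definition USADS_matrix :: fm where
  "USADS_matrix = (let \<Psi> = Var (one \<rightarrow>\<^sub>t one) 0 in
     Forall one 0 (\<lambda>X. Stable X \<^bold>\<longrightarrow>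
       Forall N 0 (\<lambda>n. ltX X (\<Psi> \<^bold>\<cdot> X \<^bold>\<cdot> n) (\<Psi> \<^bold>\<cdot> X \<^bold>\<cdot> (Succ \<^bold>\<cdot> n))) \<^bold>\<or>
       Forall N 0 (\<lambda>m. ltX X (\<Psi> \<^bold>\<cdot> X \<^bold>\<cdot> (Succ \<^bold>\<cdot> m)) (\<Psi> \<^bold>\<cdot> X \<^bold>\<cdot> m))))"

definition mu_matrix :: fm where
  "mu_matrix = (let \<mu> = Var two 0 in
     Forall one 0 (\<lambda>f. Exists N 0 (\<lambda>n. f \<^bold>\<cdot> n \<^bold>= Zero) \<^bold>\<longrightarrow> f \<^bold>\<cdot> (\<mu> \<^bold>\<cdot> f) \<^bold>= Zero))"

end

theory Submission
  imports Defs "HOL-Library.Countable"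
begin

text \<open>
  The calculus is complete for Henkin models in which the objects of function type are extensional,
  so both explicit implications may be verified inside an arbitrary such model, whose natural
  numbers can be nonstandard and satisfy induction only for quantifier-free formulas.

  For \<open>USADS \<rightarrow> (\<mu>\<^sup>2)\<close>, given \<open>f\<close>, order the numbers \<open>i\<close> with \<open>\<exists>k \<le> i. f k = 0\<close> naturally. If \<open>f\<close> has
  a zero, this is a stable order of type \<open>\<omega>\<close>, so every value \<open>\<Psi>(X)(0)\<close> of a solution lies in its field
  and bounds a zero of \<open>f\<close>, which is found by bounded search. If \<open>f\<close> has no zero, the order is empty
  and nothing is claimed. In particular no extensionality functional is needed.

  For \<open>(\<mu>\<^sup>2) \<rightarrow> USADS\<close>, two applications of \<open>\<mu>\<close> decide whether an element has finitely many
  predecessors. If there are such elements, each has a larger one (its immediate successor), and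
  iterating a choice of one by \<open>\<mu>\<close> gives an ascending sequence. Otherwise every element has
  finitely many successors, and the same construction is applied to the reversed order.
\<close>

section \<open>Substitution\<close>

text \<open>Derivations themselves are awkward to write: terms are built from combinators,
  conjunction is coded by implication, and bound variables are de Bruijn indices. In a model all of
  this becomes ordinary reasoning about elements. What remains is the weakness of the theory.
  Induction in a model reaches only equations between values of objects of type 1 (under a premise
  of the same kind), so every induction must exhibit such objects; \<open>df\<close> and
  \<open>dec\<close> organise this. Both constructions are shaped by it. The order assigned to
  \<open>f\<close> has to be a term, hence the search behind it must be bounded. That an element has
  finitely many predecessors is a Sigma_2 condition, on which no induction is available until
  \<open>\<mu>\<close> has turned it into the zero set of an object; only then can the iteration be
  shown to stay among such elements.\<close>

definition push :: "ty \<Rightarrow> 'a \<Rightarrow> (ty \<Rightarrow> nat \<Rightarrow> 'a) \<Rightarrow> ty \<Rightarrow> nat \<Rightarrow> 'a" where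
  "push \<rho> a v = (\<lambda>\<tau> n. if \<tau> = \<rho> then (case n of 0 \<Rightarrow> a | Suc m \<Rightarrow> v \<rho> m) else v \<tau> n)"

definition typed :: "subst \<Rightarrow> bool" where
  "typed \<theta> \<longleftrightarrow> (\<forall>\<tau> n. \<theta> \<tau> n :\<^sub>t \<tau>)"

lemma tsubst_tsubst: "tsubst \<sigma> (tsubst \<theta> t) = tsubst (\<lambda>\<tau> n. tsubst \<sigma> (\<theta> \<tau> n)) t"
  by (induction t) auto

lemma tsubst_Var [simp]: "tsubst Var t = t"
  by (induction t) auto

lemma tsubst_ext: "(\<And>\<tau> n. \<theta> \<tau> n = \<theta>' \<tau> n) \<Longrightarrow> tsubst \<theta> t = tsubst \<theta>' t"
  by (induction t) auto

lemma fsubst_ext: "(\<And>\<tau> n. \<theta> \<tau> n = \<theta>' \<tau> n) \<Longrightarrow> fsubst \<theta> \<phi> = fsubst \<theta>' \<phi>"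
  by (rule arg_cong[where f = "\<lambda>\<theta>. fsubst \<theta> \<phi>"]) auto

lemma under_simps [simp]:
  "under \<rho> \<theta> \<rho> 0 = Var \<rho> 0"
  "under \<rho> \<theta> \<rho> (Suc n) = tsubst (shift \<rho>) (\<theta> \<rho> n)"
  "\<tau> \<noteq> \<rho> \<Longrightarrow> under \<rho> \<theta> \<tau> n = tsubst (shift \<rho>) (\<theta> \<tau> n)"
  by (simp_all add: under_def)

lemma push_simps [simp]:
  "push \<rho> a v \<rho> 0 = a"
  "push \<rho> a v \<rho> (Suc n) = v \<rho> n"
  "\<tau> \<noteq> \<rho> \<Longrightarrow> push \<rho> a v \<tau> n = v \<tau> n"
  by (simp_all add: push_def)

lemma shift_simps [simp]:
  "shift \<rho> \<rho> n = Var \<rho> (Suc n)"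
  "\<tau> \<noteq> \<rho> \<Longrightarrow> shift \<rho> \<tau> n = Var \<tau> n"
  by (simp_all add: shift_def)

lemma var_cases:
  obtains "\<tau> = \<rho>" "n = 0" | m where "\<tau> = \<rho>" "n = Suc m" | "\<tau> \<noteq> (\<rho>::ty)"
  by (cases n) auto

lemma tsubst_under_shift:
  "tsubst (under \<rho> \<sigma>) (tsubst (shift \<rho>) t) = tsubst (shift \<rho>) (tsubst \<sigma> t)"
proof -
  have "tsubst (under \<rho> \<sigma>) (shift \<rho> \<tau> n) = tsubst (shift \<rho>) (\<sigma> \<tau> n)" for \<tau> n
    by (cases "\<tau> = \<rho>") auto
  then show ?thesis by (simp add: tsubst_tsubst)
qed

lemma under_comp:
  "(\<lambda>\<tau> n. tsubst (under \<rho> \<sigma>) (under \<rho> \<theta> \<tau> n)) = under \<rho> (\<lambda>\<tau> n. tsubst \<sigma> (\<theta> \<tau> n))"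
proof (intro ext)
  fix \<tau> n
  show "tsubst (under \<rho> \<sigma>) (under \<rho> \<theta> \<tau> n) = under \<rho> (\<lambda>\<tau> n. tsubst \<sigma> (\<theta> \<tau> n)) \<tau> n"
    by (cases rule: var_cases[of \<tau> \<rho> n]) (auto simp: tsubst_under_shift)
qed

lemma under_Var [simp]: "under \<rho> Var = Var"
proof (intro ext)
  show "under \<rho> Var \<tau> n = Var \<tau> n" for \<tau> n
    by (cases rule: var_cases[of \<tau> \<rho> n]) auto
qed

lemma fsubst_fsubst: "fsubst \<sigma> (fsubst \<theta> \<phi>) = fsubst (\<lambda>\<tau> n. tsubst \<sigma> (\<theta> \<tau> n)) \<phi>"
  by (induction \<phi> arbitrary: \<sigma> \<theta>) (auto simp: tsubst_tsubst under_comp)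

lemma fsubst_Var [simp]: "fsubst Var \<phi> = \<phi>"
  by (induction \<phi>) auto

text \<open>The same \<open>push\<close> later extends assignments, so that instantiation in syntax
  and quantification in semantics share one operation.\<close>

lemma inst_eq: "inst \<rho> t = fsubst (push \<rho> t Var)"
  unfolding inst_def push_def by (rule arg_cong[where f = fsubst]) (auto intro!: ext)

lemma tsubst_push_shift [simp]: "tsubst (push \<rho> t \<theta>) (tsubst (shift \<rho>) s) = tsubst \<theta> s"
proof -
  have "tsubst (push \<rho> t \<theta>) (shift \<rho> \<tau> n) = \<theta> \<tau> n" for \<tau> n
    by (cases "\<tau> = \<rho>") auto
  then show ?thesis by (simp add: tsubst_tsubst)
qed

text \<open>Opening a binder after substituting below it is a single substitution; the quantifier
  steps of \<open>subst_theorem_push\<close> and \<open>truth\<close> rest on this.\<close>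

lemma inst_under: "inst \<rho> t (fsubst (under \<rho> \<theta>) \<phi>) = fsubst (push \<rho> t \<theta>) \<phi>"
  unfolding inst_eq fsubst_fsubst
proof (rule fsubst_ext)
  show "tsubst (push \<rho> t Var) (under \<rho> \<theta> \<tau> n) = push \<rho> t \<theta> \<tau> n" for \<tau> n
    by (cases rule: var_cases[of \<tau> \<rho> n]) auto
qed

lemma fsubst_inst: "fsubst \<theta> (inst \<rho> t \<phi>) = inst \<rho> (tsubst \<theta> t) (fsubst (under \<rho> \<theta>) \<phi>)"
  unfolding inst_under unfolding inst_eq fsubst_fsubst
proof (rule fsubst_ext)
  show "tsubst \<theta> (push \<rho> t Var \<tau> n) = push \<rho> (tsubst \<theta> t) \<theta> \<tau> n" for \<tau> n
    by (cases rule: var_cases[of \<tau> \<rho> n]) auto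
qed

lemma fsubst_under_lift: "fsubst (under \<rho> \<theta>) (lift_fm \<rho> \<phi>) = lift_fm \<rho> (fsubst \<theta> \<phi>)"
  unfolding fsubst_fsubst
proof (rule fsubst_ext)
  show "tsubst (under \<rho> \<theta>) (shift \<rho> \<tau> n) = lift_tm \<rho> (\<theta> \<tau> n)" for \<tau> n
    by (cases "\<tau> = \<rho>") auto
qed

lemma fsubst_eq_at: "fsubst \<theta> (eq_at \<rho> s t) = eq_at \<rho> (tsubst \<theta> s) (tsubst \<theta> t)"
  by (induction \<rho> arbitrary: s t \<theta>) (auto simp: tsubst_under_shift)

lemma has_type_simps [simp]:
  "Var \<rho> n :\<^sub>t \<sigma> \<longleftrightarrow> \<rho> = \<sigma>"
  "Zero :\<^sub>t \<sigma> \<longleftrightarrow> \<sigma> = N"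
  by (auto simp: has_type_def)

lemma has_type_App: "s :\<^sub>t \<rho> \<rightarrow>\<^sub>t \<tau> \<Longrightarrow> t :\<^sub>t \<rho> \<Longrightarrow> s \<^bold>\<cdot> t :\<^sub>t \<tau>"
  by (auto simp: has_type_def)

lemma typed_tsubst:
  assumes "typed \<theta>"
  shows "tyof (tsubst \<theta> t) = tyof t" "wt t \<Longrightarrow> wt (tsubst \<theta> t)"
proof -
  show *: "tyof (tsubst \<theta> t) = tyof t" for t
    using assms by (induction t) (auto simp: typed_def has_type_def)
  show "wt t \<Longrightarrow> wt (tsubst \<theta> t)"
    using assms by (induction t) (auto simp: typed_def has_type_def *)
qed

lemma has_type_tsubst: "typed \<theta> \<Longrightarrow> t :\<^sub>t \<rho> \<Longrightarrow> tsubst \<theta> t :\<^sub>t \<rho>"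
  by (simp add: has_type_def typed_tsubst)

lemma typed_shift [simp]: "typed (shift \<rho>)"
  and typed_Var [simp]: "typed Var"
  and typed_bind_name [simp]: "typed (bind_name \<rho> n)"
  by (auto simp: typed_def shift_def bind_name_def)

lemma typed_under [simp]: "typed \<theta> \<Longrightarrow> typed (under \<rho> \<theta>)"
  unfolding typed_def under_def
  by (auto split: nat.split intro: has_type_tsubst[OF typed_shift])

lemma typed_push: "typed \<theta> \<Longrightarrow> t :\<^sub>t \<rho> \<Longrightarrow> typed (push \<rho> t \<theta>)"
  unfolding typed_def push_def by (auto split: nat.split)

lemma wf_fsubst: "typed \<theta> \<Longrightarrow> wf_fm \<phi> \<Longrightarrow> wf_fm (fsubst \<theta> \<phi>)"
  by (induction \<phi> arbitrary: \<theta>) (auto intro: has_type_tsubst)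

lemma quantifier_free_fsubst: "quantifier_free \<phi> \<Longrightarrow> quantifier_free (fsubst \<theta> \<phi>)"
  by (induction \<phi>) auto

lemma wf_inst: "wf_fm \<phi> \<Longrightarrow> t :\<^sub>t \<rho> \<Longrightarrow> wf_fm (inst \<rho> t \<phi>)"
  by (simp add: inst_eq wf_fsubst typed_push)

lemma wf_eq_at: "s :\<^sub>t \<rho> \<Longrightarrow> t :\<^sub>t \<rho> \<Longrightarrow> wf_fm (eq_at \<rho> s t)"
proof (induction \<rho> arbitrary: s t)
  case (Fn \<rho> \<tau>)
  then show ?case
    by (auto intro!: Fn.IH(2) has_type_App[where \<rho> = \<rho>] has_type_tsubst[OF typed_shift])
qed auto

section \<open>Derivations\<close>

lemma weaken: "\<Delta> \<turnstile> \<phi> \<Longrightarrow> \<Delta> \<subseteq> \<Delta>' \<Longrightarrow> \<Delta>' \<turnstile> \<phi>"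
proof (induction arbitrary: \<Delta>' rule: derives.induct)
  case (ImpI \<phi> \<Delta> \<psi>) then show ?case by (meson derives.ImpI insert_mono)
next
  case (Raa \<phi> \<Delta>) then show ?case by (meson derives.Raa insert_mono)
next
  case (AllI \<rho> \<Delta> \<phi>) then show ?case by (meson derives.AllI image_mono)
next
  case (Assm \<phi> \<Delta>)
  then show ?case using derives.Assm by blast
next
  case (Axiom \<phi> \<Delta>)
  then show ?case using derives.Axiom by blast
next
  case (ImpE \<Delta> \<phi> \<psi>)
  then show ?case using derives.ImpE by blast
next
  case (AllE \<Delta> \<rho> \<phi> t)
  then show ?case using derives.AllE by blast
qed

text \<open>With no assumptions index 0 may be generalised freely; carrying \<open>\<theta>\<close>
  under the new quantifier and instantiating with \<open>t\<close> yields one more pushed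
  entry.\<close>

lemma subst_theorem_push:
  assumes "\<And>\<phi>. {} \<turnstile> \<phi> \<Longrightarrow> {} \<turnstile> fsubst \<theta> \<phi>" "t :\<^sub>t \<rho>" "{} \<turnstile> \<phi>"
  shows "{} \<turnstile> fsubst (push \<rho> t \<theta>) \<phi>"
proof -
  have "{} \<turnstile> AllF \<rho> \<phi>" using assms(3) by (simp add: AllI)
  from assms(1)[OF this] have "{} \<turnstile> AllF \<rho> (fsubst (under \<rho> \<theta>) \<phi>)" by simp
  from AllE[OF this assms(2)] show ?thesis by (simp add: inst_under)
qed

text \<open>Successive entries of one type replace its indices 0, 1, 2 and so on, so a list that
  reaches an index must also supply all smaller indices of that type.\<close>

definition pushes :: "(ty \<times> tm) list \<Rightarrow> subst" where
  "pushes ps = foldr (\<lambda>(\<rho>, t). push \<rho> t) ps Var"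

lemma subst_theorem_pushes:
  "list_all (\<lambda>(\<rho>, t). t :\<^sub>t \<rho>) ps \<Longrightarrow> {} \<turnstile> \<phi> \<Longrightarrow> {} \<turnstile> fsubst (pushes ps) \<phi>"
proof (induction ps arbitrary: \<phi>)
  case (Cons p ps)
  then show ?case by (cases p) (auto simp: pushes_def intro: subst_theorem_push)
qed (simp add: pushes_def)

text \<open>Only finitely many variables occur in an axiom of fixed shape, so an arbitrary
  substitution can be traded for finitely many generalisations and instantiations.\<close>

lemma subst_axiom_pushes:
  assumes "typed \<theta>" "RCA0w_axiom \<phi>" "fsubst \<theta> \<phi> = fsubst (pushes (map (\<lambda>(\<rho>, n). (\<rho>, \<theta> \<rho> n)) ps)) \<phi>"
  shows "{} \<turnstile> fsubst \<theta> \<phi>"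
  unfolding assms(3) using assms(1,2)
  by (intro subst_theorem_pushes Axiom) (auto simp: list_all_iff typed_def)

lemma Fn_neq: "\<sigma> \<noteq> \<sigma> \<rightarrow>\<^sub>t \<tau>" "\<tau> \<noteq> \<sigma> \<rightarrow>\<^sub>t \<tau>" "\<sigma> \<rightarrow>\<^sub>t \<tau> \<noteq> \<sigma>" "\<sigma> \<rightarrow>\<^sub>t \<tau> \<noteq> \<tau>"
proof -
  have "size \<sigma> < size (\<sigma> \<rightarrow>\<^sub>t \<tau>)" "size \<tau> < size (\<sigma> \<rightarrow>\<^sub>t \<tau>)" by simp_all
  then show "\<sigma> \<noteq> \<sigma> \<rightarrow>\<^sub>t \<tau>" "\<tau> \<noteq> \<sigma> \<rightarrow>\<^sub>t \<tau>" "\<sigma> \<rightarrow>\<^sub>t \<tau> \<noteq> \<sigma>" "\<sigma> \<rightarrow>\<^sub>t \<tau> \<noteq> \<tau>"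
    by (metis less_irrefl)+
qed

text \<open>The induction and choice schemata are mapped to further instances of themselves. The
  other axioms mention particular variables, a shape that is lost under substitution; they go
  through \<open>subst_axiom_pushes\<close>.\<close>

lemma subst_axiom:
  assumes "typed \<theta>" "RCA0w_axiom \<phi>"
  shows "{} \<turnstile> fsubst \<theta> \<phi>"
  using assms(2)
proof cases
  case (QF_IA \<psi>)
  define \<psi>' where "\<psi>' = fsubst (under N \<theta>) \<psi>"
  have "fsubst (under N \<theta>) (inst N (Succ \<^bold>\<cdot> Var N 0) (fsubst (under N (shift N)) \<psi>)) =
      inst N (Succ \<^bold>\<cdot> Var N 0) (fsubst (under N (shift N)) \<psi>')"
    unfolding inst_eq fsubst_fsubst \<psi>'_def
  proof (rule fsubst_ext, goal_cases)
    case (1 \<tau> n)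
    then show ?case
      by (cases rule: var_cases[of \<tau> N n]) (auto simp: tsubst_tsubst shift_def intro!: tsubst_ext)
  qed
  then have "fsubst \<theta> \<phi> = (inst N Zero \<psi>' \<^bold>\<longrightarrow>
      AllF N (\<psi>' \<^bold>\<longrightarrow> inst N (Succ \<^bold>\<cdot> Var N 0) (fsubst (under N (shift N)) \<psi>')) \<^bold>\<longrightarrow>
      AllF N \<psi>')"
    unfolding QF_IA by (simp add: fsubst_inst \<psi>'_def)
  then show ?thesis
    using QF_IA assms(1) by (auto simp: \<psi>'_def intro!: Axiom RCA0w_axiom.QF_IA wf_fsubst quantifier_free_fsubst)
next
  case (QF_AC \<psi>)
  define \<psi>' where "\<psi>' = fsubst (under N (under one \<theta>)) \<psi>"
  have "fsubst (under N (under one (under two \<theta>))) (lift_fm two \<psi>) = lift_fm two \<psi>'"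
    unfolding fsubst_fsubst \<psi>'_def
  proof (rule fsubst_ext)
    fix \<tau> n
    consider "\<tau> = N" "n = 0" | m where "\<tau> = N" "n = Suc m" | "\<tau> = one" "n = 0"
      | m where "\<tau> = one" "n = Suc m" | "\<tau> \<noteq> N" "\<tau> \<noteq> one"
      by (cases n) auto
    then show "tsubst (under N (under one (under two \<theta>))) (shift two \<tau> n) =
      lift_tm two (under N (under one \<theta>) \<tau> n)"
      by cases (auto simp: tsubst_tsubst shift_def split: if_splits intro!: tsubst_ext)
  qed
  then have "fsubst \<theta> \<phi> = (AllF one (ExF N \<psi>') \<^bold>\<longrightarrow>
      ExF two (AllF one (inst N (Var two 0 \<^bold>\<cdot> Var one 0) (lift_fm two \<psi>'))))"
    unfolding QF_AC by (simp add: fsubst_inst \<psi>'_def)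
  then show ?thesis
    using QF_AC assms(1) by (auto simp: \<psi>'_def intro!: Axiom RCA0w_axiom.QF_AC wf_fsubst quantifier_free_fsubst)
next
  case eq_refl
  show ?thesis by (rule subst_axiom_pushes[OF assms, where ps = "[(N,0)]"])
    (simp add: eq_refl pushes_def push_def)
next
  case eq_sym
  show ?thesis by (rule subst_axiom_pushes[OF assms, where ps = "[(N,0),(N,1)]"])
    (simp add: eq_sym pushes_def push_def)
next
  case eq_trans
  show ?thesis by (rule subst_axiom_pushes[OF assms, where ps = "[(N,0),(N,1),(N,2)]"])
    (simp add: eq_trans pushes_def push_def numeral_2_eq_2)
next
  case (extensionality \<rho> \<tau>)
  show ?thesis by (rule subst_axiom_pushes[OF assms, where ps = "[(\<rho>,0),(\<rho>,1),(\<rho>\<rightarrow>\<^sub>t\<tau>,0)]"])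
    (simp add: extensionality fsubst_eq_at pushes_def push_def)
next
  case Succ_not_Zero
  show ?thesis by (rule subst_axiom_pushes[OF assms, where ps = "[(N,0)]"])
    (simp add: Succ_not_Zero pushes_def push_def)
next
  case Succ_inject
  show ?thesis by (rule subst_axiom_pushes[OF assms, where ps = "[(N,0),(N,1)]"])
    (simp add: Succ_inject pushes_def push_def)
next
  case (Proj s \<rho> t \<sigma>)
  show ?thesis
    \<comment> \<open>The second variable has index 1; if its type differs from
      \<open>\<rho>\<close>, a filler for index 0 of that type must come first.\<close>
    by (rule subst_axiom_pushes[OF assms, where ps = "[(\<rho>,0)] @ (if \<sigma> = \<rho> then [] else [(\<sigma>,0)]) @ [(\<sigma>,1)]"])
      (auto simp: Proj fsubst_eq_at pushes_def push_def)
next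
  case (Comb s \<delta> \<rho> \<tau> t u)
  have ne2: "\<delta> \<noteq> \<delta> \<rightarrow>\<^sub>t \<rho> \<rightarrow>\<^sub>t \<tau>" "\<delta> \<rightarrow>\<^sub>t \<rho> \<rightarrow>\<^sub>t \<tau> \<noteq> \<delta>" by (simp_all add: Fn_neq)
  show ?thesis
    by (rule subst_axiom_pushes[OF assms, where
          ps = "(\<delta> \<rightarrow>\<^sub>t \<rho> \<rightarrow>\<^sub>t \<tau>, 0) # (if \<rho> = \<rho> \<rightarrow>\<^sub>t \<tau> then [] else [(\<delta> \<rightarrow>\<^sub>t \<rho>,0)]) @
            [(\<delta> \<rightarrow>\<^sub>t \<rho>, 1), (\<delta>, 0), (\<delta>, 1), (\<delta>, 2)]"])
      (simp add: Comb fsubst_eq_at pushes_def push_def numeral_2_eq_2 Fn_neq ne2)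
next
  case (Rec_Zero y z)
  show ?thesis
    by (rule subst_axiom_pushes[OF assms, where ps = "[(N,0),(N,1),(N \<rightarrow>\<^sub>t N \<rightarrow>\<^sub>t N,0)]"])
      (simp add: Rec_Zero pushes_def push_def)
next
  case (Rec_Succ x y z)
  show ?thesis
    by (rule subst_axiom_pushes[OF assms, where ps = "[(N,0),(N,1),(N \<rightarrow>\<^sub>t N \<rightarrow>\<^sub>t N,0)]"])
      (simp add: Rec_Succ pushes_def push_def)
qed

text \<open>Used to rename a fresh variable in a derivation together with its assumptions, see
  \<open>consistent_witness\<close>.\<close>

lemma subst_derives: "\<Delta> \<turnstile> \<phi> \<Longrightarrow> typed \<theta> \<Longrightarrow> fsubst \<theta> ` \<Delta> \<turnstile> fsubst \<theta> \<phi>"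
proof (induction arbitrary: \<theta> rule: derives.induct)
  case (Assm \<phi> \<Delta>)
  then show ?case by (intro derives.Assm imageI wf_fsubst)
next
  case (Axiom \<phi> \<Delta>)
  then show ?case using weaken[OF subst_axiom empty_subsetI] by blast
next
  case (ImpI \<phi> \<Delta> \<psi>)
  then show ?case by (simp add: derives.ImpI wf_fsubst)
next
  case (ImpE \<Delta> \<phi> \<psi>)
  then show ?case using derives.ImpE[of "fsubst \<theta> ` \<Delta>" "fsubst \<theta> \<phi>"] by simp
next
  case (Raa \<phi> \<Delta>)
  then show ?case by (simp add: derives.Raa wf_fsubst)
next
  case (AllI \<rho> \<Delta> \<phi>)
  then have "fsubst (under \<rho> \<theta>) ` lift_fm \<rho> ` \<Delta> \<turnstile> fsubst (under \<rho> \<theta>) \<phi>" by simp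
  then show ?case by (simp add: derives.AllI image_image fsubst_under_lift)
next
  case (AllE \<Delta> \<rho> \<phi> t)
  then show ?case by (simp add: fsubst_inst derives.AllE has_type_tsubst)
qed

text \<open>Keeps the union of the increasing stages in \<open>henkin_exists\<close>
  consistent.\<close>

lemma derives_finite: "\<Delta> \<turnstile> \<phi> \<Longrightarrow> \<exists>\<Delta>0. finite \<Delta>0 \<and> \<Delta>0 \<subseteq> \<Delta> \<and> (\<Delta>0 \<turnstile> \<phi>)"
proof (induction rule: derives.induct)
  case (Assm \<phi> \<Delta>)
  have "finite {\<phi>}" "{\<phi>} \<subseteq> \<Delta>" using Assm by simp_all
  moreover have "{\<phi>} \<turnstile> \<phi>" by (rule derives.Assm) (simp_all add: Assm)
  ultimately show ?case by blast
next
  case (Axiom \<phi> \<Delta>)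
  have "{} \<turnstile> \<phi>" by (rule derives.Axiom) fact
  then show ?case by blast
next
  case (ImpI \<phi> \<Delta> \<psi>)
  then obtain \<Delta>0 where \<Delta>0: "finite \<Delta>0" "\<Delta>0 \<subseteq> insert \<phi> \<Delta>" "\<Delta>0 \<turnstile> \<psi>" by blast
  have "insert \<phi> (\<Delta>0 - {\<phi>}) \<turnstile> \<psi>" by (rule weaken[OF \<Delta>0(3)]) auto
  from derives.ImpI[OF ImpI.hyps(1) this] have "\<Delta>0 - {\<phi>} \<turnstile> (\<phi> \<^bold>\<longrightarrow> \<psi>)" .
  moreover have "finite (\<Delta>0 - {\<phi>})" "\<Delta>0 - {\<phi>} \<subseteq> \<Delta>" using \<Delta>0 by auto
  ultimately show ?case by blast
next
  case (ImpE \<Delta> \<phi> \<psi>)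
  from ImpE.IH obtain \<Delta>1 \<Delta>2 where \<Delta>: "finite \<Delta>1" "\<Delta>1 \<subseteq> \<Delta>" "\<Delta>1 \<turnstile> (\<phi> \<^bold>\<longrightarrow> \<psi>)"
    "finite \<Delta>2" "\<Delta>2 \<subseteq> \<Delta>" "\<Delta>2 \<turnstile> \<phi>" by blast
  have "\<Delta>1 \<union> \<Delta>2 \<turnstile> (\<phi> \<^bold>\<longrightarrow> \<psi>)" by (rule weaken[OF \<Delta>(3)]) simp
  moreover have "\<Delta>1 \<union> \<Delta>2 \<turnstile> \<phi>" by (rule weaken[OF \<Delta>(6)]) simp
  ultimately have "\<Delta>1 \<union> \<Delta>2 \<turnstile> \<psi>" by (rule derives.ImpE)
  moreover have "finite (\<Delta>1 \<union> \<Delta>2)" "\<Delta>1 \<union> \<Delta>2 \<subseteq> \<Delta>" using \<Delta> by simp_all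
  ultimately show ?case by blast
next
  case (Raa \<phi> \<Delta>)
  then obtain \<Delta>0 where \<Delta>0: "finite \<Delta>0" "\<Delta>0 \<subseteq> insert (\<^bold>\<not> \<phi>) \<Delta>" "\<Delta>0 \<turnstile> Falsum" by blast
  have "insert (\<^bold>\<not> \<phi>) (\<Delta>0 - {\<^bold>\<not> \<phi>}) \<turnstile> Falsum" by (rule weaken[OF \<Delta>0(3)]) auto
  from derives.Raa[OF Raa.hyps(1) this] have "\<Delta>0 - {\<^bold>\<not> \<phi>} \<turnstile> \<phi>" .
  moreover have "finite (\<Delta>0 - {\<^bold>\<not> \<phi>})" "\<Delta>0 - {\<^bold>\<not> \<phi>} \<subseteq> \<Delta>" using \<Delta>0 by auto
  ultimately show ?case by blast
next
  case (AllI \<rho> \<Delta> \<phi>)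
  then obtain \<Delta>0 where \<Delta>0: "finite \<Delta>0" "\<Delta>0 \<subseteq> lift_fm \<rho> ` \<Delta>" "\<Delta>0 \<turnstile> \<phi>" by blast
  from finite_subset_image[OF \<Delta>0(1,2)] obtain \<Delta>1
    where "\<Delta>1 \<subseteq> \<Delta>" "finite \<Delta>1" "\<Delta>0 = lift_fm \<rho> ` \<Delta>1" by blast
  moreover from this(3) \<Delta>0(3) have "\<Delta>1 \<turnstile> AllF \<rho> \<phi>" by (simp add: derives.AllI)
  ultimately show ?case by blast
next
  case (AllE \<Delta> \<rho> \<phi> t)
  from AllE.IH obtain \<Delta>0 where \<Delta>0: "finite \<Delta>0" "\<Delta>0 \<subseteq> \<Delta>" "\<Delta>0 \<turnstile> AllF \<rho> \<phi>" by blast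
  from derives.AllE[OF this(3) AllE.hyps(2)] \<Delta>0(1,2) show ?case by blast
qed

section \<open>Henkin sets\<close>

primrec var_bound :: "tm \<Rightarrow> nat" where
  "var_bound (Var \<rho> n) = Suc n"
| "var_bound Zero = 0"
| "var_bound Succ = 0"
| "var_bound (Proj \<rho> \<sigma>) = 0"
| "var_bound (Comb \<delta> \<rho> \<tau>) = 0"
| "var_bound Rec = 0"
| "var_bound (s \<^bold>\<cdot> t) = max (var_bound s) (var_bound t)"

text \<open>A crude bound, not lowered at binders and shared by all types: its purpose is to supply
  fresh indices.\<close>

primrec fvar_bound :: "fm \<Rightarrow> nat" where
  "fvar_bound (s \<^bold>= t) = max (var_bound s) (var_bound t)"
| "fvar_bound Falsum = 0"
| "fvar_bound (\<phi> \<^bold>\<longrightarrow> \<psi>) = max (fvar_bound \<phi>) (fvar_bound \<psi>)"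
| "fvar_bound (AllF \<rho> \<phi>) = fvar_bound \<phi>"

lemma tsubst_cong: "(\<And>\<tau> n. n < var_bound t \<Longrightarrow> \<theta> \<tau> n = \<theta>' \<tau> n) \<Longrightarrow> tsubst \<theta> t = tsubst \<theta>' t"
proof (induction t)
  case (App s t)
  have "tsubst \<theta> s = tsubst \<theta>' s" "tsubst \<theta> t = tsubst \<theta>' t"
    by (rule App.IH; simp add: App.prems)+
  then show ?case by simp
qed simp_all

lemma fsubst_cong: "(\<And>\<tau> n. n < fvar_bound \<phi> \<Longrightarrow> \<theta> \<tau> n = \<theta>' \<tau> n) \<Longrightarrow> fsubst \<theta> \<phi> = fsubst \<theta>' \<phi>"
proof (induction \<phi> arbitrary: \<theta> \<theta>')
  case (Eq s t)
  have "tsubst \<theta> s = tsubst \<theta>' s" "tsubst \<theta> t = tsubst \<theta>' t"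
    by (rule tsubst_cong; simp add: Eq)+
  then show ?case by simp
next
  case (Imp \<phi> \<psi>)
  have "fsubst \<theta> \<phi> = fsubst \<theta>' \<phi>" "fsubst \<theta> \<psi> = fsubst \<theta>' \<psi>"
    by (rule Imp.IH; simp add: Imp.prems)+
  then show ?case by simp
next
  case (AllF \<rho> \<phi>)
  have "fsubst (under \<rho> \<theta>) \<phi> = fsubst (under \<rho> \<theta>') \<phi>"
  proof (rule AllF.IH)
    show "under \<rho> \<theta> \<tau> n = under \<rho> \<theta>' \<tau> n" if "n < fvar_bound \<phi>" for \<tau> n
      using that AllF.prems by (cases rule: var_cases[of \<tau> \<rho> n]) auto
  qed
  then show ?case by simp
qed simp_all

text \<open>Henkin's argument in de Bruijn form. As index \<open>k\<close> is fresh,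
  \<open>bind_name \<rho> k\<close> acts on \<open>\<Delta>\<close> as the lift by
  \<open>\<rho>\<close> and turns the instance at \<open>Var \<rho> k\<close> back into
  \<open>\<chi>\<close>; so refuting the negated instance would prove
  \<open>AllF \<rho> \<chi>\<close> by \<open>AllI\<close>.\<close>

lemma consistent_witness:
  assumes cons: "\<not> (\<Delta> \<turnstile> Falsum)" and "(\<^bold>\<not> AllF \<rho> \<chi>) \<in> \<Delta>" "wf_fm \<chi>"
    and k: "\<And>\<phi>. \<phi> \<in> \<Delta> \<Longrightarrow> fvar_bound \<phi> \<le> k"
  shows "\<not> (insert (\<^bold>\<not> inst \<rho> (Var \<rho> k) \<chi>) \<Delta> \<turnstile> Falsum)"
proof
  assume "insert (\<^bold>\<not> inst \<rho> (Var \<rho> k) \<chi>) \<Delta> \<turnstile> Falsum"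
  then have "\<Delta> \<turnstile> inst \<rho> (Var \<rho> k) \<chi>" by (rule Raa[rotated]) (simp add: wf_inst assms(3))
  then have "fsubst (bind_name \<rho> k) ` \<Delta> \<turnstile> fsubst (bind_name \<rho> k) (inst \<rho> (Var \<rho> k) \<chi>)"
    by (intro subst_derives) auto
  moreover have "fsubst (bind_name \<rho> k) ` \<Delta> = lift_fm \<rho> ` \<Delta>"
  proof (intro image_cong refl fsubst_cong)
    fix \<phi> \<tau> n assume "\<phi> \<in> \<Delta>" "n < fvar_bound \<phi>"
    with k[of \<phi>] show "bind_name \<rho> k \<tau> n = shift \<rho> \<tau> n"
      by (simp add: bind_name_def shift_def)
  qed
  moreover have "fsubst (bind_name \<rho> k) (inst \<rho> (Var \<rho> k) \<chi>) = fsubst Var \<chi>"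
    unfolding inst_eq fsubst_fsubst
  proof (rule fsubst_cong)
    fix \<tau> n assume "n < fvar_bound \<chi>"
    with k[OF assms(2)] show "tsubst (bind_name \<rho> k) (push \<rho> (Var \<rho> k) Var \<tau> n) = Var \<tau> n"
      by (cases rule: var_cases[of \<tau> \<rho> n]) (simp_all add: bind_name_def)
  qed
  ultimately have "\<Delta> \<turnstile> AllF \<rho> \<chi>" by (simp add: AllI)
  moreover have "\<Delta> \<turnstile> \<^bold>\<not> AllF \<rho> \<chi>" using assms(2,3) by (intro Assm) simp_all
  ultimately show False using cons ImpE by blast
qed

instance ty :: countable by countable_datatype
instance tm :: countable by countable_datatype
instance fm :: countable by countable_datatype

text \<open>The maximum exists and is a fresh index because the set stays finite at every
  stage.\<close>

definition add_witness :: "fm \<Rightarrow> fm set \<Rightarrow> fm set" where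
  "add_witness \<psi> \<Delta> = (case \<psi> of AllF \<rho> \<chi> \<^bold>\<longrightarrow> Falsum \<Rightarrow>
      insert (\<^bold>\<not> inst \<rho> (Var \<rho> (Max (fvar_bound ` \<Delta>))) \<chi>) \<Delta> | _ \<Rightarrow> \<Delta>)"

definition extend :: "fm \<Rightarrow> fm set \<Rightarrow> fm set" where
  "extend \<psi> \<Delta> = (if wf_fm \<psi> \<and> \<not> (insert \<psi> \<Delta> \<turnstile> Falsum) then add_witness \<psi> (insert \<psi> \<Delta>) else \<Delta>)"

lemma subset_add_witness: "\<Delta> \<subseteq> add_witness \<psi> \<Delta>"
  by (auto simp: add_witness_def split: fm.split)

lemma finite_add_witness: "finite \<Delta> \<Longrightarrow> finite (add_witness \<psi> \<Delta>)"
  by (auto simp: add_witness_def split: fm.split)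

lemma consistent_add_witness:
  assumes "\<not> (\<Delta> \<turnstile> Falsum)" "wf_fm \<psi>" "\<psi> \<in> \<Delta>" "finite \<Delta>"
  shows "\<not> (add_witness \<psi> \<Delta> \<turnstile> Falsum)"
proof (cases "\<exists>\<rho> \<chi>. \<psi> = (\<^bold>\<not> AllF \<rho> \<chi>)")
  case True
  then obtain \<rho> \<chi> where \<psi>: "\<psi> = (\<^bold>\<not> AllF \<rho> \<chi>)" by blast
  have "\<not> (insert (\<^bold>\<not> inst \<rho> (Var \<rho> (Max (fvar_bound ` \<Delta>))) \<chi>) \<Delta> \<turnstile> Falsum)"
    by (rule consistent_witness) (use assms \<psi> in simp_all)
  then show ?thesis by (simp add: add_witness_def \<psi>)
next
  case False
  then have "add_witness \<psi> \<Delta> = \<Delta>" by (simp add: add_witness_def split: fm.split)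
  then show ?thesis using assms by simp
qed

primrec stage :: "fm set \<Rightarrow> nat \<Rightarrow> fm set" where
  "stage \<Delta> 0 = \<Delta>"
| "stage \<Delta> (Suc n) = extend (from_nat n) (stage \<Delta> n)"

lemma stage_mono: "m \<le> n \<Longrightarrow> stage \<Delta> m \<subseteq> stage \<Delta> n"
  by (rule lift_Suc_mono_le)
    (auto simp: extend_def intro: subsetD[OF subset_add_witness] insertI2)

lemma stage_consistent:
  assumes "finite \<Delta>" "\<not> (\<Delta> \<turnstile> Falsum)"
  shows "finite (stage \<Delta> n) \<and> \<not> (stage \<Delta> n \<turnstile> Falsum)"
proof (induction n)
  case (Suc n)
  then show ?case by (simp add: extend_def finite_add_witness consistent_add_witness)
qed (simp add: assms)

text \<open>Phrased with derivability instead of membership, so that closure under deduction comes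
  for free. Witnesses can be demanded to be variables.\<close>

locale henkin =
  fixes \<Gamma> :: "fm set"
  assumes consistent: "\<not> (\<Gamma> \<turnstile> Falsum)"
    and complete: "wf_fm \<phi> \<Longrightarrow> (\<Gamma> \<turnstile> \<phi>) \<or> (\<Gamma> \<turnstile> \<^bold>\<not> \<phi>)"
    and witness: "wf_fm \<phi> \<Longrightarrow> \<Gamma> \<turnstile> \<^bold>\<not> AllF \<rho> \<phi> \<Longrightarrow> \<exists>k. \<Gamma> \<turnstile> \<^bold>\<not> inst \<rho> (Var \<rho> k) \<phi>"

text \<open>Each formula is decided at the stage given by its own code. Starting from a finite set
  keeps all stages finite, which leaves fresh variables for the witnesses.\<close>

lemma henkin_exists:
  assumes "finite \<Delta>" "\<not> (\<Delta> \<turnstile> Falsum)"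
  shows "\<exists>\<Gamma>. \<Delta> \<subseteq> \<Gamma> \<and> henkin \<Gamma>"
proof (intro exI conjI)
  define \<Gamma> where "\<Gamma> = (\<Union>n. stage \<Delta> n)"
  show "\<Delta> \<subseteq> \<Gamma>" unfolding \<Gamma>_def by (metis UN_upper UNIV_I stage.simps(1))
  have cons: "\<not> (\<Gamma> \<turnstile> Falsum)"
  proof
    assume "\<Gamma> \<turnstile> Falsum"
    then obtain \<Delta>0 where f: "finite \<Delta>0" "\<Delta>0 \<subseteq> \<Gamma>" "\<Delta>0 \<turnstile> Falsum" using derives_finite by blast
    \<comment> \<open>A finite part of an increasing union lies in a single stage, and each stage is
      consistent.\<close>
    have "\<exists>n. \<Delta>0 \<subseteq> stage \<Delta> n" using f(1,2)
    proof (induction rule: finite_induct)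
      case (insert \<phi> F)
      then obtain n m where "F \<subseteq> stage \<Delta> n" "\<phi> \<in> stage \<Delta> m" by (auto simp: \<Gamma>_def)
      then have "insert \<phi> F \<subseteq> stage \<Delta> (max n m)"
        using stage_mono[of n "max n m" \<Delta>] stage_mono[of m "max n m" \<Delta>] by auto
      then show ?case by blast
    qed auto
    then show False using f(3) stage_consistent[OF assms] weaken by blast
  qed
  have added: "add_witness \<psi> (insert \<psi> (stage \<Delta> (to_nat \<psi>))) \<subseteq> \<Gamma>"
    if "wf_fm \<psi>" "\<not> (insert \<psi> (stage \<Delta> (to_nat \<psi>)) \<turnstile> Falsum)" for \<psi>
  proof -
    have "add_witness \<psi> (insert \<psi> (stage \<Delta> (to_nat \<psi>))) = stage \<Delta> (Suc (to_nat \<psi>))"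
      using that by (simp add: extend_def)
    then show ?thesis unfolding \<Gamma>_def by blast
  qed
  have sub: "stage \<Delta> n \<subseteq> \<Gamma>" for n by (auto simp: \<Gamma>_def)
  show "henkin \<Gamma>"
  proof
    show "\<not> (\<Gamma> \<turnstile> Falsum)" by fact
    fix \<phi> assume wf: "wf_fm \<phi>"
    show "(\<Gamma> \<turnstile> \<phi>) \<or> (\<Gamma> \<turnstile> \<^bold>\<not> \<phi>)"
    proof (cases "insert \<phi> (stage \<Delta> (to_nat \<phi>)) \<turnstile> Falsum")
      case True
      then have "stage \<Delta> (to_nat \<phi>) \<turnstile> \<^bold>\<not> \<phi>" by (simp add: wf ImpI)
      then show ?thesis using sub weaken by blast
    next
      case False
      then have "\<phi> \<in> \<Gamma>" using added[OF wf] subset_add_witness by blast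
      then show ?thesis using wf Assm by blast
    qed
    fix \<rho> assume neg: "\<Gamma> \<turnstile> \<^bold>\<not> AllF \<rho> \<phi>"
    let ?\<psi> = "\<^bold>\<not> AllF \<rho> \<phi>"
    \<comment> \<open>\<open>\<Gamma>\<close> proves \<open>?\<psi>\<close>, so a stage refuting it
      would make \<open>\<Gamma>\<close> inconsistent.\<close>
    have "\<not> (insert ?\<psi> (stage \<Delta> (to_nat ?\<psi>)) \<turnstile> Falsum)"
    proof
      assume "insert ?\<psi> (stage \<Delta> (to_nat ?\<psi>)) \<turnstile> Falsum"
      then have "stage \<Delta> (to_nat ?\<psi>) \<turnstile> \<^bold>\<not> ?\<psi>" by (simp add: wf ImpI)
      then show False using neg cons sub weaken ImpE by metis
    qed
    from added[OF _ this] wf obtain k where "(\<^bold>\<not> inst \<rho> (Var \<rho> k) \<phi>) \<in> \<Gamma>"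
      by (auto simp: add_witness_def)
    then show "\<exists>k. \<Gamma> \<turnstile> \<^bold>\<not> inst \<rho> (Var \<rho> k) \<phi>"
      using wf by (intro exI[of _ k] Assm) (auto intro!: wf_inst)
  qed
qed

section \<open>Models\<close>

text \<open>Free of assumptions, so that formulas can be evaluated in the term structure before it
  is known to be a model.\<close>

locale frame =
  fixes D :: "ty \<Rightarrow> 'a set" and ap :: "'a \<Rightarrow> 'a \<Rightarrow> 'a" and I :: "tm \<Rightarrow> 'a"
begin

primrec ev :: "(ty \<Rightarrow> nat \<Rightarrow> 'a) \<Rightarrow> tm \<Rightarrow> 'a" where
  "ev v (Var \<rho> n) = v \<rho> n"
| "ev v Zero = I Zero"
| "ev v Succ = I Succ"
| "ev v (Proj \<rho> \<sigma>) = I (Proj \<rho> \<sigma>)"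
| "ev v (Comb \<delta> \<rho> \<tau>) = I (Comb \<delta> \<rho> \<tau>)"
| "ev v Rec = I Rec"
| "ev v (s \<^bold>\<cdot> t) = ap (ev v s) (ev v t)"

primrec sem :: "(ty \<Rightarrow> nat \<Rightarrow> 'a) \<Rightarrow> fm \<Rightarrow> bool" where
  "sem v (s \<^bold>= t) \<longleftrightarrow> ev v s = ev v t"
| "sem v Falsum \<longleftrightarrow> False"
| "sem v (\<phi> \<^bold>\<longrightarrow> \<psi>) \<longleftrightarrow> (sem v \<phi> \<longrightarrow> sem v \<psi>)"
| "sem v (AllF \<rho> \<phi>) \<longleftrightarrow> (\<forall>a\<in>D \<rho>. sem (push \<rho> a v) \<phi>)"

definition valid :: "(ty \<Rightarrow> nat \<Rightarrow> 'a) \<Rightarrow> bool" where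
  "valid v \<longleftrightarrow> (\<forall>\<rho> n. v \<rho> n \<in> D \<rho>)"

end

text \<open>The extensionality axiom of the theory is what allows demanding \<open>ap_ext\<close>;
  with it the pointwise equality \<open>eq_at\<close> becomes plain identity of elements
  (\<open>sem_eq_at\<close>).\<close>

locale model = frame D ap I for D :: "ty \<Rightarrow> 'a set" and ap I +
  assumes I_in [simp]: "I Zero \<in> D N" "I Succ \<in> D one" "I (Proj \<rho> \<sigma>) \<in> D (tyof (Proj \<rho> \<sigma>))"
      "I (Comb \<delta> \<rho> \<tau>) \<in> D (tyof (Comb \<delta> \<rho> \<tau>))" "I Rec \<in> D (tyof Rec)"
    and ap_in: "f \<in> D (\<rho> \<rightarrow>\<^sub>t \<tau>) \<Longrightarrow> x \<in> D \<rho> \<Longrightarrow> ap f x \<in> D \<tau>"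
    and ap_ext: "f \<in> D (\<rho> \<rightarrow>\<^sub>t \<tau>) \<Longrightarrow> g \<in> D (\<rho> \<rightarrow>\<^sub>t \<tau>) \<Longrightarrow> (\<And>x. x \<in> D \<rho> \<Longrightarrow> ap f x = ap g x) \<Longrightarrow> f = g"
    and axioms_hold: "RCA0w_axiom \<phi> \<Longrightarrow> wf_fm \<phi> \<Longrightarrow> valid v \<Longrightarrow> sem v \<phi>"

section \<open>The term model of a Henkin set and completeness\<close>

context henkin
begin

lemma imp_iff: "wf_fm \<phi> \<Longrightarrow> wf_fm \<psi> \<Longrightarrow> (\<Gamma> \<turnstile> (\<phi> \<^bold>\<longrightarrow> \<psi>)) \<longleftrightarrow> ((\<Gamma> \<turnstile> \<phi>) \<longrightarrow> (\<Gamma> \<turnstile> \<psi>))"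
proof
  assume "(\<Gamma> \<turnstile> \<phi>) \<longrightarrow> (\<Gamma> \<turnstile> \<psi>)" and wf: "wf_fm \<phi>" "wf_fm \<psi>"
  then consider "\<Gamma> \<turnstile> \<psi>" | "\<Gamma> \<turnstile> \<^bold>\<not> \<phi>" using complete by blast
  then show "\<Gamma> \<turnstile> (\<phi> \<^bold>\<longrightarrow> \<psi>)"
  proof cases
    case 1
    then show ?thesis using wf by (blast intro: ImpI weaken)
  next
    case 2
    let ?\<Delta> = "insert (\<^bold>\<not> \<psi>) (insert \<phi> \<Gamma>)"
    have "?\<Delta> \<turnstile> \<^bold>\<not> \<phi>" by (rule weaken[OF 2]) auto
    moreover have "?\<Delta> \<turnstile> \<phi>" by (rule Assm) (simp_all add: wf)
    ultimately have "?\<Delta> \<turnstile> Falsum" by (rule ImpE)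
    then have "insert \<phi> \<Gamma> \<turnstile> \<psi>" by (rule Raa[OF wf(2)])
    then show ?thesis by (rule ImpI[OF wf(1)])
  qed
qed (blast intro: ImpE)

text \<open>The direction from instances to the universal formula is where witnesses are used: a
  refuted universal formula already fails at a variable.\<close>

lemma all_iff:
  assumes "wf_fm \<phi>"
  shows "(\<Gamma> \<turnstile> AllF \<rho> \<phi>) \<longleftrightarrow> (\<forall>t. t :\<^sub>t \<rho> \<longrightarrow> (\<Gamma> \<turnstile> inst \<rho> t \<phi>))"
proof
  assume all: "\<forall>t. t :\<^sub>t \<rho> \<longrightarrow> (\<Gamma> \<turnstile> inst \<rho> t \<phi>)"
  show "\<Gamma> \<turnstile> AllF \<rho> \<phi>"
  proof (rule ccontr)
    assume "\<not> (\<Gamma> \<turnstile> AllF \<rho> \<phi>)"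
    then have "\<Gamma> \<turnstile> \<^bold>\<not> AllF \<rho> \<phi>" using complete[of "AllF \<rho> \<phi>"] assms by simp
    then obtain k where "\<Gamma> \<turnstile> \<^bold>\<not> inst \<rho> (Var \<rho> k) \<phi>" using witness assms by blast
    moreover have "\<Gamma> \<turnstile> inst \<rho> (Var \<rho> k) \<phi>" using all by simp
    ultimately show False using consistent ImpE by blast
  qed
qed (blast intro: AllE)

lemma axiom_instance: "RCA0w_axiom \<phi> \<Longrightarrow> typed \<theta> \<Longrightarrow> \<Gamma> \<turnstile> fsubst \<theta> \<phi>"
  using weaken[OF subst_axiom] by blast

definition same :: "tm \<Rightarrow> tm \<Rightarrow> bool" where
  "same s t \<longleftrightarrow> (\<Gamma> \<turnstile> eq_at (tyof s) s t)"

text \<open>Chosen representatives stand in for classes of provable equality. This keeps the carrier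
  in type \<open>tm\<close> and makes equality of elements literal, as the truth of equations
  demands.\<close>

definition rep :: "tm \<Rightarrow> tm" where
  "rep t = (SOME s. s :\<^sub>t tyof t \<and> same t s)"

lemma eq_at_Fn:
  assumes "s :\<^sub>t \<rho> \<rightarrow>\<^sub>t \<tau>" "t :\<^sub>t \<rho> \<rightarrow>\<^sub>t \<tau>"
  shows "(\<Gamma> \<turnstile> eq_at (\<rho> \<rightarrow>\<^sub>t \<tau>) s t) \<longleftrightarrow> (\<forall>u. u :\<^sub>t \<rho> \<longrightarrow> (\<Gamma> \<turnstile> eq_at \<tau> (s \<^bold>\<cdot> u) (t \<^bold>\<cdot> u)))"
proof -
  have "wf_fm (eq_at \<tau> (lift_tm \<rho> s \<^bold>\<cdot> Var \<rho> 0) (lift_tm \<rho> t \<^bold>\<cdot> Var \<rho> 0))"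
    using wf_eq_at[OF assms] by simp
  then show ?thesis by (simp add: all_iff inst_eq fsubst_eq_at)
qed

lemma typed_upd: "typed \<theta> \<Longrightarrow> t :\<^sub>t \<rho> \<Longrightarrow> typed (\<theta>(\<rho> := (\<theta> \<rho>)(n := t)))"
  by (auto simp: typed_def)

lemma eq_at_refl: "t :\<^sub>t \<rho> \<Longrightarrow> \<Gamma> \<turnstile> eq_at \<rho> t t"
proof (induction \<rho> arbitrary: t)
  case N
  then show ?case using axiom_instance[OF eq_refl, of "Var(N := (Var N)(0 := t))"]
    by (simp add: typed_upd)
qed (simp add: eq_at_Fn has_type_App del: eq_at.simps)

lemma eq_at_sym: "s :\<^sub>t \<rho> \<Longrightarrow> t :\<^sub>t \<rho> \<Longrightarrow> \<Gamma> \<turnstile> eq_at \<rho> s t \<Longrightarrow> \<Gamma> \<turnstile> eq_at \<rho> t s"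
proof (induction \<rho> arbitrary: s t)
  case N
  have "\<Gamma> \<turnstile> (s \<^bold>= t \<^bold>\<longrightarrow> t \<^bold>= s)"
    using axiom_instance[OF eq_sym, of "Var(N := (Var N)(0 := s, 1 := t))"] N(1,2)
    by (auto simp: typed_def)
  then show ?case using N(3) by (auto intro: ImpE)
next
  case (Fn \<rho> \<tau>)
  then show ?case by (simp add: eq_at_Fn has_type_App del: eq_at.simps)
qed

lemma eq_at_trans:
  "s :\<^sub>t \<rho> \<Longrightarrow> t :\<^sub>t \<rho> \<Longrightarrow> u :\<^sub>t \<rho> \<Longrightarrow> \<Gamma> \<turnstile> eq_at \<rho> s t \<Longrightarrow> \<Gamma> \<turnstile> eq_at \<rho> t u \<Longrightarrow> \<Gamma> \<turnstile> eq_at \<rho> s u"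
proof (induction \<rho> arbitrary: s t u)
  case N
  have "\<Gamma> \<turnstile> (s \<^bold>= t \<^bold>\<longrightarrow> t \<^bold>= u \<^bold>\<longrightarrow> s \<^bold>= u)"
    using axiom_instance[OF eq_trans, of "Var(N := (Var N)(0 := s, 1 := t, 2 := u))"] N(1,2,3)
    by (auto simp: typed_def)
  then show ?case using N(4,5) by (auto intro: ImpE)
next
  case (Fn \<rho> \<tau>)
  then show ?case by (simp add: eq_at_Fn has_type_App del: eq_at.simps) (blast intro: has_type_App)
qed

text \<open>The extensionality axiom at work: it makes application well defined on classes of
  provably equal terms.\<close>

lemma eq_at_cong:
  assumes "f :\<^sub>t \<rho> \<rightarrow>\<^sub>t \<tau>" "s :\<^sub>t \<rho>" "t :\<^sub>t \<rho>" "\<Gamma> \<turnstile> eq_at \<rho> s t"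
  shows "\<Gamma> \<turnstile> eq_at \<tau> (f \<^bold>\<cdot> s) (f \<^bold>\<cdot> t)"
proof -
  define \<theta> where "\<theta> = (\<lambda>\<sigma> n. if \<sigma> = \<rho> \<rightarrow>\<^sub>t \<tau> then f else if \<sigma> = \<rho> then if n = 0 then s else t else Var \<sigma> n)"
  have "typed \<theta>" using assms(1-3) by (auto simp: typed_def \<theta>_def)
  from axiom_instance[OF extensionality[of \<rho> \<tau>] this]
  have "\<Gamma> \<turnstile> (eq_at \<rho> s t \<^bold>\<longrightarrow> eq_at \<tau> (f \<^bold>\<cdot> s) (f \<^bold>\<cdot> t))"
    by (simp add: fsubst_eq_at \<theta>_def Fn_neq)
  then show ?thesis using assms(4) by (rule ImpE)
qed

lemma rep:
  assumes "t :\<^sub>t \<rho>"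
  shows "rep t :\<^sub>t \<rho>" "\<Gamma> \<turnstile> eq_at \<rho> t (rep t)"
proof -
  have "t :\<^sub>t tyof t \<and> same t t" using assms by (auto simp: same_def has_type_def eq_at_refl)
  from someI[of "\<lambda>s. s :\<^sub>t tyof t \<and> same t s", OF this]
  show "rep t :\<^sub>t \<rho>" "\<Gamma> \<turnstile> eq_at \<rho> t (rep t)"
    using assms by (auto simp: rep_def has_type_def same_def)
qed

lemma rep_eq_iff:
  assumes "s :\<^sub>t \<rho>" "t :\<^sub>t \<rho>"
  shows "rep s = rep t \<longleftrightarrow> (\<Gamma> \<turnstile> eq_at \<rho> s t)"
proof
  assume "rep s = rep t"
  then show "\<Gamma> \<turnstile> eq_at \<rho> s t" using rep[OF assms(1)] rep[OF assms(2)] assms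
    by (metis eq_at_sym eq_at_trans)
next
  assume *: "\<Gamma> \<turnstile> eq_at \<rho> s t"
  \<comment> \<open>The choice made by \<open>rep\<close> depends only on the type and on
    \<open>same\<close>, so provably equal terms receive the same representative.\<close>
  have "same s u \<longleftrightarrow> same t u" if "u :\<^sub>t \<rho>" for u
    using assms that * eq_at_trans[of s \<rho> t u] eq_at_trans[of t \<rho> s u] eq_at_sym[of s \<rho> t]
    by (auto simp: same_def has_type_def)
  then show "rep s = rep t" unfolding rep_def
    using assms by (metis (no_types, lifting) has_type_def)
qed

lemma rep_rep [simp]: "t :\<^sub>t \<rho> \<Longrightarrow> rep (rep t) = rep t"
  using rep rep_eq_iff eq_at_sym by metis

lemma rep_App:
  assumes "s :\<^sub>t \<rho> \<rightarrow>\<^sub>t \<tau>" "t :\<^sub>t \<rho>"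
  shows "rep (rep s \<^bold>\<cdot> rep t) = rep (s \<^bold>\<cdot> t)"
proof -
  have "\<Gamma> \<turnstile> eq_at \<tau> (rep s \<^bold>\<cdot> rep t) (s \<^bold>\<cdot> rep t)"
    using eq_at_sym[OF _ _ rep(2)[OF assms(1)]] rep[OF assms(1)] rep[OF assms(2)] assms
    by (simp add: eq_at_Fn del: eq_at.simps)
  moreover have "\<Gamma> \<turnstile> eq_at \<tau> (s \<^bold>\<cdot> rep t) (s \<^bold>\<cdot> t)"
    using eq_at_sym[OF _ _ rep(2)[OF assms(2)]] rep[OF assms(2)] assms
    by (simp add: eq_at_cong)
  ultimately show ?thesis
    using assms rep(1) by (metis eq_at_trans has_type_App rep_eq_iff)
qed

definition D :: "ty \<Rightarrow> tm set" where "D \<rho> = {t. t :\<^sub>t \<rho> \<and> rep t = t}"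

definition ap :: "tm \<Rightarrow> tm \<Rightarrow> tm" where "ap s t = rep (s \<^bold>\<cdot> t)"

lemma ap_rep: "s :\<^sub>t \<rho> \<rightarrow>\<^sub>t \<tau> \<Longrightarrow> t :\<^sub>t \<rho> \<Longrightarrow> ap (rep s) (rep t) = rep (s \<^bold>\<cdot> t)"
  by (simp add: ap_def rep_App)

sublocale frame D ap rep .

lemma D_eq: "D \<rho> = rep ` {t. t :\<^sub>t \<rho>}"
  using rep(1) rep_rep by (auto simp: D_def image_iff) metis

lemma ev_rep: "typed \<theta> \<Longrightarrow> wt t \<Longrightarrow> ev (\<lambda>\<rho> n. rep (\<theta> \<rho> n)) t = rep (tsubst \<theta> t)"
proof (induction t)
  case (App s t)
  then obtain \<tau> where *: "s :\<^sub>t tyof t \<rightarrow>\<^sub>t \<tau>" "t :\<^sub>t tyof t" by (auto simp: has_type_def)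
  from ap_rep[OF has_type_tsubst[OF App.prems(1) *(1)] has_type_tsubst[OF App.prems(1) *(2)]]
  show ?case using App by simp
qed simp_all

text \<open>The substitution is arbitrary so that the quantifier case can push a term onto it: every
  element of \<open>D \<rho>\<close> represents some term, and \<open>all_iff\<close> ranges over
  all terms of the type.\<close>

lemma truth: "typed \<theta> \<Longrightarrow> wf_fm \<phi> \<Longrightarrow> sem (\<lambda>\<rho> n. rep (\<theta> \<rho> n)) \<phi> \<longleftrightarrow> (\<Gamma> \<turnstile> fsubst \<theta> \<phi>)"
proof (induction \<phi> arbitrary: \<theta>)
  case (Eq s t)
  then have "tsubst \<theta> s :\<^sub>t N" "tsubst \<theta> t :\<^sub>t N" by (auto intro: has_type_tsubst)
  then show ?case using Eq rep_eq_iff by (auto simp: ev_rep has_type_def)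
next
  case (AllF \<rho> \<phi>)
  have push: "push \<rho> (rep t) (\<lambda>\<rho> n. rep (\<theta> \<rho> n)) = (\<lambda>\<tau> n. rep (push \<rho> t \<theta> \<tau> n))" for t
    by (auto simp: push_def fun_eq_iff split: nat.split)
  have "sem (\<lambda>\<rho> n. rep (\<theta> \<rho> n)) (AllF \<rho> \<phi>) \<longleftrightarrow>
      (\<forall>t. t :\<^sub>t \<rho> \<longrightarrow> sem (push \<rho> (rep t) (\<lambda>\<rho> n. rep (\<theta> \<rho> n))) \<phi>)"
    by (auto simp: D_eq)
  also have "\<dots> \<longleftrightarrow> (\<forall>t. t :\<^sub>t \<rho> \<longrightarrow> (\<Gamma> \<turnstile> fsubst (push \<rho> t \<theta>) \<phi>))"
    using AllF by (simp add: push typed_push)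
  also have "\<dots> \<longleftrightarrow> (\<Gamma> \<turnstile> fsubst \<theta> (AllF \<rho> \<phi>))"
    using AllF.prems by (simp add: all_iff wf_fsubst inst_under)
  finally show ?case .
qed (auto simp: consistent imp_iff wf_fsubst)

lemma valid_rep:
  assumes "valid v"
  shows "typed v" "(\<lambda>\<rho> n. rep (v \<rho> n)) = v"
  using assms by (auto simp: valid_def typed_def D_def)

sublocale model D ap rep
proof
  show "rep Zero \<in> D N" "rep Succ \<in> D one" "rep (Proj \<rho> \<sigma>) \<in> D (tyof (Proj \<rho> \<sigma>))"
    "rep (Comb \<delta> \<rho> \<tau>) \<in> D (tyof (Comb \<delta> \<rho> \<tau>))" "rep Rec \<in> D (tyof Rec)" for \<delta> \<rho> \<sigma> \<tau>
    by (simp_all add: D_eq has_type_def)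
  fix f g \<rho> \<tau>
  assume f: "f \<in> D (\<rho> \<rightarrow>\<^sub>t \<tau>)"
  show "ap f x \<in> D \<tau>" if "x \<in> D \<rho>" for x
    using f that by (auto simp: D_eq ap_def rep_App has_type_App)
  assume g: "g \<in> D (\<rho> \<rightarrow>\<^sub>t \<tau>)" and eq: "\<And>x. x \<in> D \<rho> \<Longrightarrow> ap f x = ap g x"
  have "\<Gamma> \<turnstile> eq_at (\<rho> \<rightarrow>\<^sub>t \<tau>) f g"
  proof -
    have ty: "f :\<^sub>t \<rho> \<rightarrow>\<^sub>t \<tau>" "g :\<^sub>t \<rho> \<rightarrow>\<^sub>t \<tau>" and rep: "rep f = f" "rep g = g"
      using f g by (auto simp: D_def)
    have "\<Gamma> \<turnstile> eq_at \<tau> (f \<^bold>\<cdot> u) (g \<^bold>\<cdot> u)" if u: "u :\<^sub>t \<rho>" for u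
    proof -
      have "ap f (rep u) = ap g (rep u)" using u eq by (auto simp: D_eq)
      then have "rep (f \<^bold>\<cdot> u) = rep (g \<^bold>\<cdot> u)"
        using rep_App[OF ty(1) u] rep_App[OF ty(2) u] by (simp add: ap_def rep)
      then show ?thesis using ty u has_type_App rep_eq_iff by blast
    qed
    then show ?thesis using ty by (simp add: eq_at_Fn del: eq_at.simps)
  qed
  then show "f = g" using f g rep_eq_iff by (fastforce simp: D_def)
next
  fix \<phi> v assume "RCA0w_axiom \<phi>" "wf_fm \<phi>" "valid v"
  \<comment> \<open>A valid assignment consists of representatives, hence is itself a typed
    substitution, and \<open>truth\<close> applies to it.\<close>
  then show "sem v \<phi>" using truth[of v \<phi>] valid_rep[of v] axiom_instance by simp
qed

end

text \<open>If the negation is consistent, the term model of a Henkin set containing it refutes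
  \<open>\<phi>\<close> when each variable denotes its own representative. Hence models over
  \<open>tm\<close> suffice.\<close>

theorem completeness:
  assumes wf: "wf_fm \<phi>"
    and valid: "\<And>(D :: ty \<Rightarrow> tm set) ap I v. model D ap I \<Longrightarrow> frame.valid D v \<Longrightarrow> frame.sem D ap I v \<phi>"
  shows "RCA0w_proves \<phi>"
proof (rule Raa[OF wf], rule ccontr)
  assume "\<not> ({\<^bold>\<not> \<phi>} \<turnstile> Falsum)"
  with henkin_exists[of "{\<^bold>\<not> \<phi>}"] obtain \<Gamma> where \<Gamma>: "(\<^bold>\<not> \<phi>) \<in> \<Gamma>" "henkin \<Gamma>" by auto
  interpret henkin \<Gamma> by (rule \<Gamma>(2))
  have "\<Gamma> \<turnstile> \<^bold>\<not> \<phi>" by (rule Assm) (simp_all add: \<Gamma> wf)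
  then have "\<not> sem (\<lambda>\<rho> n. rep (Var \<rho> n)) \<phi>"
    using truth[of Var "\<phi>"] wf consistent ImpE by auto
  moreover have "valid (\<lambda>\<rho> n. rep (Var \<rho> n))" by (auto simp: valid_def D_eq)
  ultimately show False using valid[OF model_axioms] by blast
qed

section \<open>Evaluation in models\<close>

primrec vars :: "tm \<Rightarrow> (ty \<times> nat) set" where
  "vars (Var \<rho> n) = {(\<rho>, n)}"
| "vars Zero = {}"
| "vars Succ = {}"
| "vars (Proj \<rho> \<sigma>) = {}"
| "vars (Comb \<delta> \<rho> \<tau>) = {}"
| "vars Rec = {}"
| "vars (s \<^bold>\<cdot> t) = vars s \<union> vars t"

lemma closed_tm_iff: "closed_tm t \<longleftrightarrow> vars t = {}"
  by (induction t) auto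

lemma vars_abstract: "vars (abstract \<rho> n t) = vars t - {(\<rho>, n)}"
  by (induction t) auto

lemma tyof_abstract [simp]: "tyof (abstract \<rho> n t) = \<rho> \<rightarrow>\<^sub>t tyof t"
  by (induction t) auto

lemma wt_abstract [simp]: "wt t \<Longrightarrow> wt (abstract \<rho> n t)"
  by (induction t) auto

lemma Lam_simps [simp]:
  "vars (Lam \<rho> n t) = vars (t (Var \<rho> n)) - {(\<rho>, n)}"
  "tyof (Lam \<rho> n t) = \<rho> \<rightarrow>\<^sub>t tyof (t (Var \<rho> n))"
  "wt (t (Var \<rho> n)) \<Longrightarrow> wt (Lam \<rho> n t)"
  by (simp_all add: Lam_def vars_abstract)

text \<open>For named variables: unlike in \<open>push\<close> nothing is renumbered, because
  \<open>bind_name\<close> compensates for the shift (\<open>sem_bind_name\<close>).\<close>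

definition upd :: "(ty \<Rightarrow> nat \<Rightarrow> 'a) \<Rightarrow> ty \<Rightarrow> nat \<Rightarrow> 'a \<Rightarrow> ty \<Rightarrow> nat \<Rightarrow> 'a" where
  "upd v \<rho> n a = (\<lambda>\<tau> m. if \<tau> = \<rho> \<and> m = n then a else v \<tau> m)"

lemma upd_apply [simp]: "upd v \<rho> n a \<tau> m = (if \<tau> = \<rho> \<and> m = n then a else v \<tau> m)"
  by (simp add: upd_def)

lemma wf_Forall [simp]: "wf_fm (\<phi> (Var \<rho> n)) \<Longrightarrow> wf_fm (Forall \<rho> n \<phi>)"
  and wf_Exists [simp]: "wf_fm (\<phi> (Var \<rho> n)) \<Longrightarrow> wf_fm (Exists \<rho> n \<phi>)"
  by (simp_all add: Forall_def Exists_def wf_fsubst)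

context frame
begin

lemma ev_tsubst: "ev v (tsubst \<theta> t) = ev (\<lambda>\<tau> n. ev v (\<theta> \<tau> n)) t"
  by (induction t) auto

lemma ev_cong: "(\<And>\<tau> n. (\<tau>, n) \<in> vars t \<Longrightarrow> v \<tau> n = v' \<tau> n) \<Longrightarrow> ev v t = ev v' t"
proof (induction t)
  case (App s t)
  have "ev v s = ev v' s" "ev v t = ev v' t"
    by (rule App.IH; simp add: App.prems)+
  then show ?case by simp
qed simp_all

lemma sem_fsubst: "sem v (fsubst \<theta> \<phi>) \<longleftrightarrow> sem (\<lambda>\<tau> n. ev v (\<theta> \<tau> n)) \<phi>"
proof (induction \<phi> arbitrary: v \<theta>)
  case (AllF \<rho> \<phi>)
  have "(\<lambda>\<tau> n. ev (push \<rho> a v) (under \<rho> \<theta> \<tau> n)) = push \<rho> a (\<lambda>\<tau> n. ev v (\<theta> \<tau> n))" for a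
  proof (intro ext)
    fix \<tau> n
    have "(\<lambda>\<tau> n. ev (push \<rho> a v) (shift \<rho> \<tau> n)) = v"
      by (auto simp: shift_def fun_eq_iff)
    then show "ev (push \<rho> a v) (under \<rho> \<theta> \<tau> n) = push \<rho> a (\<lambda>\<tau> n. ev v (\<theta> \<tau> n)) \<tau> n"
      by (cases rule: var_cases[of \<tau> \<rho> n]) (simp_all add: ev_tsubst)
  qed
  then show ?case using AllF by simp
qed (auto simp: ev_tsubst)

lemma sem_inst: "sem v (inst \<rho> t \<phi>) \<longleftrightarrow> sem (push \<rho> (ev v t) v) \<phi>"
proof -
  have "(\<lambda>\<tau> n. ev v (push \<rho> t Var \<tau> n)) = push \<rho> (ev v t) v"
    by (auto simp: push_def fun_eq_iff split: nat.split)
  then show ?thesis by (simp add: inst_eq sem_fsubst)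
qed

lemma sem_bind_name: "sem (push \<rho> a v) (fsubst (bind_name \<rho> n) \<phi>) \<longleftrightarrow> sem (upd v \<rho> n a) \<phi>"
proof -
  have "(\<lambda>\<tau> m. ev (push \<rho> a v) (bind_name \<rho> n \<tau> m)) = upd v \<rho> n a"
    by (auto simp: bind_name_def fun_eq_iff)
  then show ?thesis by (simp add: sem_fsubst)
qed

lemma sem_Forall [simp]: "sem v (Forall \<rho> n \<phi>) \<longleftrightarrow> (\<forall>a\<in>D \<rho>. sem (upd v \<rho> n a) (\<phi> (Var \<rho> n)))"
  and sem_Exists [simp]: "sem v (Exists \<rho> n \<phi>) \<longleftrightarrow> (\<exists>a\<in>D \<rho>. sem (upd v \<rho> n a) (\<phi> (Var \<rho> n)))"
  by (simp_all add: Forall_def Exists_def sem_bind_name)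

lemma valid_push [simp]: "valid v \<Longrightarrow> a \<in> D \<rho> \<Longrightarrow> valid (push \<rho> a v)"
  by (auto simp: valid_def push_def split: nat.split)

lemma valid_upd [simp]: "valid v \<Longrightarrow> a \<in> D \<rho> \<Longrightarrow> valid (upd v \<rho> n a)"
  by (auto simp: valid_def)

end

context model
begin

lemma ev_in: "valid v \<Longrightarrow> t :\<^sub>t \<rho> \<Longrightarrow> ev v t \<in> D \<rho>"
proof (induction t arbitrary: \<rho>)
  case (App s t)
  then obtain \<tau> where "s :\<^sub>t \<tau> \<rightarrow>\<^sub>t \<rho>" "t :\<^sub>t \<tau>" by (auto simp: has_type_def)
  then show ?case using App by (auto intro: ap_in)
next
  case (Proj \<sigma> \<tau>) then show ?case using I_in(3)[of \<sigma> \<tau>] by (simp add: has_type_def del: I_in)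
next
  case (Comb \<sigma> \<tau> \<delta>) then show ?case using I_in(4)[of \<sigma> \<tau> \<delta>] by (simp add: has_type_def del: I_in)
next
  case Rec then show ?case using I_in(5) by (simp add: has_type_def del: I_in)
qed (auto simp: valid_def has_type_def)

lemma D_nonempty: "\<exists>x. x \<in> D \<rho>"
proof (induction \<rho>)
  case (Fn \<rho> \<tau>)
  then obtain x where "x \<in> D \<tau>" by blast
  then have "ap (I (Proj \<tau> \<rho>)) x \<in> D (\<rho> \<rightarrow>\<^sub>t \<tau>)"
    using ap_in I_in(3)[of \<tau> \<rho>] by simp
  then show ?case by blast
qed (use I_in in blast)

definition v0 :: "ty \<Rightarrow> nat \<Rightarrow> 'a" where "v0 \<rho> n = (SOME x. x \<in> D \<rho>)"

lemma valid_v0 [simp]: "valid v0"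
  using D_nonempty by (simp add: valid_def v0_def some_in_eq[symmetric] ex_in_conv)

lemma sem_eq_at: "valid v \<Longrightarrow> s :\<^sub>t \<rho> \<Longrightarrow> t :\<^sub>t \<rho> \<Longrightarrow> sem v (eq_at \<rho> s t) \<longleftrightarrow> ev v s = ev v t"
proof (induction \<rho> arbitrary: v s t)
  case (Fn \<rho> \<tau>)
  have lift: "ev (push \<rho> a v) (lift_tm \<rho> u) = ev v u" for a u
  proof -
    have "(\<lambda>\<tau> n. ev (push \<rho> a v) (shift \<rho> \<tau> n)) = v"
      by (auto simp: shift_def fun_eq_iff)
    then show ?thesis by (simp add: ev_tsubst)
  qed
  have "sem v (eq_at (\<rho> \<rightarrow>\<^sub>t \<tau>) s t) \<longleftrightarrow> (\<forall>a\<in>D \<rho>. ap (ev v s) a = ap (ev v t) a)"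
  proof -
    have "lift_tm \<rho> u \<^bold>\<cdot> Var \<rho> 0 :\<^sub>t \<tau>" if "u :\<^sub>t \<rho> \<rightarrow>\<^sub>t \<tau>" for u
      using that by (intro has_type_App[where \<rho> = \<rho>] has_type_tsubst) auto
    then show ?thesis using Fn by (simp add: lift)
  qed
  also have "\<dots> \<longleftrightarrow> ev v s = ev v t"
    using Fn.prems ev_in ap_ext by metis
  finally show ?case .
qed simp

text \<open>Objects of a model enter terms through variables: axioms and terms are evaluated at an
  assignment that lists the objects in question.\<close>

definition asg :: "((ty \<times> nat) \<times> 'a) list \<Rightarrow> ty \<Rightarrow> nat \<Rightarrow> 'a" where
  "asg xs = foldr (\<lambda>((\<rho>, n), a) v. upd v \<rho> n a) xs v0"

lemma valid_asg: "list_all (\<lambda>((\<rho>, n), a). a \<in> D \<rho>) xs \<Longrightarrow> valid (asg xs)"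
  by (induction xs) (auto simp: asg_def)

lemma ap_Proj [simp]:
  assumes "x \<in> D \<rho>" "y \<in> D \<sigma>"
  shows "ap (ap (I (Proj \<rho> \<sigma>)) x) y = x"
proof -
  let ?v = "asg [((\<rho>, 0), x), ((\<sigma>, 1), y)]"
  have v: "valid ?v" using assms by (intro valid_asg) simp
  let ?t = "Proj \<rho> \<sigma> \<^bold>\<cdot> Var \<rho> 0 \<^bold>\<cdot> Var \<sigma> 1"
  have ty: "?t :\<^sub>t \<rho>" by (simp add: has_type_def)
  have "sem ?v (eq_at \<rho> ?t (Var \<rho> 0))"
    by (intro axioms_hold RCA0w_axiom.Proj wf_eq_at v ty) simp_all
  then have "ev ?v ?t = ev ?v (Var \<rho> 0)"
    using v ty by (subst (asm) sem_eq_at) simp_all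
  then show ?thesis by (simp add: asg_def)
qed

lemma ap_Comb [simp]:
  assumes "x \<in> D (\<delta> \<rightarrow>\<^sub>t \<rho> \<rightarrow>\<^sub>t \<tau>)" "y \<in> D (\<delta> \<rightarrow>\<^sub>t \<rho>)" "u \<in> D \<delta>"
  shows "ap (ap (ap (I (Comb \<delta> \<rho> \<tau>)) x) y) u = ap (ap x u) (ap y u)"
proof -
  let ?v = "asg [((\<delta> \<rightarrow>\<^sub>t \<rho> \<rightarrow>\<^sub>t \<tau>, 0), x), ((\<delta> \<rightarrow>\<^sub>t \<rho>, 1), y), ((\<delta>, 2), u)]"
  have v: "valid ?v" using assms by (intro valid_asg) simp
  let ?x = "Var (\<delta> \<rightarrow>\<^sub>t \<rho> \<rightarrow>\<^sub>t \<tau>) 0" let ?y = "Var (\<delta> \<rightarrow>\<^sub>t \<rho>) 1" let ?u = "Var \<delta> 2"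
  let ?s = "Comb \<delta> \<rho> \<tau> \<^bold>\<cdot> ?x \<^bold>\<cdot> ?y \<^bold>\<cdot> ?u" let ?t = "?x \<^bold>\<cdot> ?u \<^bold>\<cdot> (?y \<^bold>\<cdot> ?u)"
  have ty: "?s :\<^sub>t \<tau>" "?t :\<^sub>t \<tau>" by (simp_all add: has_type_def)
  have "sem ?v (eq_at \<tau> ?s ?t)"
    by (intro axioms_hold RCA0w_axiom.Comb wf_eq_at v ty) simp_all
  then have "ev ?v ?s = ev ?v ?t"
    using v ty by (subst (asm) sem_eq_at) simp_all
  then show ?thesis by (simp add: asg_def)
qed

text \<open>Combinatory completeness: the equations for \<open>Proj\<close> and \<open>Comb\<close>
  make bracket abstraction behave like lambda abstraction.\<close>

lemma ev_abstract:
  assumes "valid v" "a \<in> D \<rho>" "wt t"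
  shows "ap (ev v (abstract \<rho> n t)) a = ev (upd v \<rho> n a) t"
  using assms(3)
proof (induction t)
  case (Var \<tau> m)
  have *: "I (Comb \<rho> (\<rho> \<rightarrow>\<^sub>t \<rho>) \<rho>) \<in> D (tyof (Comb \<rho> (\<rho> \<rightarrow>\<^sub>t \<rho>) \<rho>))"
    "I (Proj \<rho> (\<rho> \<rightarrow>\<^sub>t \<rho>)) \<in> D (tyof (Proj \<rho> (\<rho> \<rightarrow>\<^sub>t \<rho>)))"
    "I (Proj \<rho> \<rho>) \<in> D (tyof (Proj \<rho> \<rho>))" by (rule I_in)+
  have "ap (I (Proj \<rho> \<rho>)) a \<in> D (\<rho> \<rightarrow>\<^sub>t \<rho>)" using *(3) assms(2) ap_in by simp
  then show ?case using * assms by (auto simp: valid_def)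
next
  case (App s t)
  then obtain \<tau> where ty: "tyof s = tyof t \<rightarrow>\<^sub>t \<tau>" "wt s" "wt t" by auto
  have "ev v (abstract \<rho> n s) \<in> D (\<rho> \<rightarrow>\<^sub>t tyof t \<rightarrow>\<^sub>t \<tau>)" "ev v (abstract \<rho> n t) \<in> D (\<rho> \<rightarrow>\<^sub>t tyof t)"
    using ty assms(1) by (auto intro!: ev_in simp: has_type_def)
  then show ?case using App ty assms by simp
qed (use assms I_in I_in(3-5) in \<open>simp_all del: I_in(3-5)\<close>)

lemma ev_Lam [simp]:
  "valid v \<Longrightarrow> a \<in> D \<rho> \<Longrightarrow> wt (t (Var \<rho> n)) \<Longrightarrow>
    ap (ev v (Lam \<rho> n t)) a = ev (upd v \<rho> n a) (t (Var \<rho> n))"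
  by (simp add: Lam_def ev_abstract)

definition cl :: "tm \<Rightarrow> 'a" where "cl t = ev v0 t"

lemma ev_closed: "vars t = {} \<Longrightarrow> ev v t = cl t"
  unfolding cl_def by (rule ev_cong) simp

lemma cl_in: "t :\<^sub>t \<rho> \<Longrightarrow> cl t \<in> D \<rho>"
  unfolding cl_def by (simp add: ev_in)

section \<open>Numbers, recursion and quantifier-free induction in a model\<close>

abbreviation z :: 'a where "z \<equiv> I Zero"
abbreviation S :: "'a \<Rightarrow> 'a" where "S x \<equiv> ap (I Succ) x"

lemma in_simps [simp]:
  "f \<in> D one \<Longrightarrow> x \<in> D N \<Longrightarrow> ap f x \<in> D N"
  "g \<in> D (N \<rightarrow>\<^sub>t one) \<Longrightarrow> x \<in> D N \<Longrightarrow> ap g x \<in> D one"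
  "h \<in> D (N \<rightarrow>\<^sub>t N \<rightarrow>\<^sub>t one) \<Longrightarrow> x \<in> D N \<Longrightarrow> ap h x \<in> D (N \<rightarrow>\<^sub>t one)"
  "\<mu> \<in> D two \<Longrightarrow> f \<in> D one \<Longrightarrow> ap \<mu> f \<in> D N"
  "\<Psi> \<in> D (one \<rightarrow>\<^sub>t one) \<Longrightarrow> f \<in> D one \<Longrightarrow> ap \<Psi> f \<in> D one"
  by (auto intro: ap_in)

lemma S_ne_z [simp]: "x \<in> D N \<Longrightarrow> S x \<noteq> z" "x \<in> D N \<Longrightarrow> z \<noteq> S x"
proof -
  assume x: "x \<in> D N"
  have "sem (asg [((N, 0), x)]) (\<^bold>\<not> (Succ \<^bold>\<cdot> Var N 0 \<^bold>= Zero))"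
    by (intro axioms_hold RCA0w_axiom.Succ_not_Zero valid_asg) (simp_all add: has_type_def x)
  then show "S x \<noteq> z" "z \<noteq> S x" by (auto simp: asg_def)
qed

definition rec :: "'a \<Rightarrow> 'a \<Rightarrow> 'a \<Rightarrow> 'a" where "rec x y f = ap (ap (ap (I Rec) x) y) f"

lemma rec_in [simp]:
  assumes "x \<in> D N" "y \<in> D N" "f \<in> D (N \<rightarrow>\<^sub>t one)"
  shows "rec x y f \<in> D N"
proof -
  have "I Rec \<in> D (N \<rightarrow>\<^sub>t N \<rightarrow>\<^sub>t (N \<rightarrow>\<^sub>t one) \<rightarrow>\<^sub>t N)" using I_in(5) by (simp del: I_in)
  from ap_in[OF ap_in[OF ap_in[OF this assms(1)] assms(2)] assms(3)]
  show ?thesis by (simp add: rec_def)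
qed

lemma rec_simps [simp]:
  assumes "y \<in> D N" "f \<in> D (N \<rightarrow>\<^sub>t one)"
  shows "rec z y f = y" "x \<in> D N \<Longrightarrow> rec (S x) y f = ap (ap f (rec x y f)) x"
proof -
  have "sem (asg [((N, 1), y), ((N \<rightarrow>\<^sub>t one, 0), f)])
      (Rec \<^bold>\<cdot> Zero \<^bold>\<cdot> Var N 1 \<^bold>\<cdot> Var (N \<rightarrow>\<^sub>t one) 0 \<^bold>= Var N 1)"
    by (intro axioms_hold RCA0w_axiom.Rec_Zero valid_asg) (simp_all add: has_type_def assms)
  then show "rec z y f = y" by (simp add: asg_def rec_def)
  assume x: "x \<in> D N"
  have "sem (asg [((N, 0), x), ((N, 1), y), ((N \<rightarrow>\<^sub>t one, 0), f)])
      (Rec \<^bold>\<cdot> (Succ \<^bold>\<cdot> Var N 0) \<^bold>\<cdot> Var N 1 \<^bold>\<cdot> Var (N \<rightarrow>\<^sub>t one) 0 \<^bold>=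
        Var (N \<rightarrow>\<^sub>t one) 0 \<^bold>\<cdot> (Rec \<^bold>\<cdot> Var N 0 \<^bold>\<cdot> Var N 1 \<^bold>\<cdot> Var (N \<rightarrow>\<^sub>t one) 0) \<^bold>\<cdot> Var N 0)"
    by (intro axioms_hold RCA0w_axiom.Rec_Succ valid_asg) (simp_all add: has_type_def assms x)
  then show "rec (S x) y f = ap (ap f (rec x y f)) x" by (simp add: asg_def rec_def)
qed

lemma ev_Rec [simp]: "ap (ap (ap (I Rec) x) y) f = rec x y f"
  by (simp add: rec_def)

text \<open>
  The shape of \<open>P\<close> covers both \<open>p x \<noteq> 0 \<longrightarrow> f x = g x\<close> (for \<open>q = 1\<close>) and \<open>q x = 0 \<longrightarrow> f x = g x\<close>
  (for \<open>p = 0\<close>), which suffice to prove that the decidable predicates below are closed under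
  the connectives.
\<close>

lemma induct_elements:
  assumes D: "p \<in> D one" "q \<in> D one" "f \<in> D one" "g \<in> D one"
  defines "P \<equiv> \<lambda>x. (ap p x = z \<longrightarrow> ap q x = z) \<longrightarrow> ap f x = ap g x"
  assumes "P z" "\<And>x. x \<in> D N \<Longrightarrow> P x \<Longrightarrow> P (S x)" "x \<in> D N"
  shows "P x"
proof -
  define v where "v = asg [((one, 0), p), ((one, 1), q), ((one, 2), f), ((one, 3), g)]"
  have v: "valid v" unfolding v_def by (intro valid_asg) (simp add: D)
  have v_simps: "v one 0 = p" "v one (Suc 0) = q" "v one 2 = f" "v one 3 = g"
    by (simp_all add: v_def asg_def)
  let ?\<phi> = "(Var one 0 \<^bold>\<cdot> Var N 0 \<^bold>= Zero \<^bold>\<longrightarrow> Var one 1 \<^bold>\<cdot> Var N 0 \<^bold>= Zero) \<^bold>\<longrightarrow>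
    Var one 2 \<^bold>\<cdot> Var N 0 \<^bold>= Var one 3 \<^bold>\<cdot> Var N 0"
  let ?ax = "(inst N Zero ?\<phi> \<^bold>\<longrightarrow>
      AllF N (?\<phi> \<^bold>\<longrightarrow> inst N (Succ \<^bold>\<cdot> Var N 0) (fsubst (under N (shift N)) ?\<phi>)) \<^bold>\<longrightarrow> AllF N ?\<phi>)"
  have wf: "wf_fm ?\<phi>" by (simp add: has_type_def)
  have "wf_fm ?ax" by (simp add: inst_eq has_type_def)
  then have "sem v ?ax" by (rule axioms_hold[OF RCA0w_axiom.QF_IA[OF wf] _ v, rotated]) simp
  moreover have *: "sem w ?\<phi> \<longleftrightarrow> P (w N 0)" if "w one = v one" for w
    unfolding P_def by (simp only: sem.simps ev.simps that One_nat_def v_simps)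
  have "sem v (inst N Zero ?\<phi>) \<longleftrightarrow> P z"
    unfolding sem_inst by (subst *) (simp_all add: push_def fun_eq_iff)
  moreover have "sem (push N x v) ?\<phi> \<longleftrightarrow> P x" for x
    by (subst *) (simp_all add: push_def fun_eq_iff)
  moreover have "sem (push N x v) (inst N (Succ \<^bold>\<cdot> Var N 0) (fsubst (under N (shift N)) ?\<phi>)) \<longleftrightarrow> P (S x)" for x
    unfolding sem_inst sem_fsubst by (subst *) (simp_all add: push_def fun_eq_iff)
  ultimately have "P z \<longrightarrow> (\<forall>x\<in>D N. P x \<longrightarrow> P (S x)) \<longrightarrow> (\<forall>x\<in>D N. P x)"
    by (simp only: sem.simps(3,4))
  then show ?thesis using assms(6-8) by metis
qed

text \<open>Not every function on \<open>D N\<close> is an object of the model; induction only applies to those that are.\<close>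

definition df :: "('a \<Rightarrow> 'a) \<Rightarrow> bool" where
  "df f \<longleftrightarrow> (\<exists>c\<in>D one. \<forall>x\<in>D N. ap c x = f x)"

text \<open>The source of the closure properties below: a function given by a term in
  \<open>Var N 0\<close>, with objects as values of the other variables, is represented by the
  abstraction of that term.\<close>

lemma df_term: "valid v \<Longrightarrow> t :\<^sub>t N \<Longrightarrow> df (\<lambda>x. ev (upd v N 0 x) t)"
  unfolding df_def
  by (intro bexI[of _ "ev v (abstract N 0 t)"]) (auto simp: has_type_def ev_abstract intro!: ev_in)

lemma df_cong: "(\<And>x. x \<in> D N \<Longrightarrow> f x = g x) \<Longrightarrow> df f \<longleftrightarrow> df g"
  by (simp add: df_def)

lemma df_in: "df f \<Longrightarrow> x \<in> D N \<Longrightarrow> f x \<in> D N"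
  unfolding df_def by (metis in_simps(1))

lemma df_const: "a \<in> D N \<Longrightarrow> df (\<lambda>x. a)"
  using df_term[of "asg [((N, 1), a)]" "Var N 1"] by (simp add: asg_def)

lemma df_id: "df (\<lambda>x. x)"
  using df_term[of v0 "Var N 0"] by simp

lemma df_ap: "c \<in> D one \<Longrightarrow> df f \<Longrightarrow> df (\<lambda>x. ap c (f x))"
proof -
  assume c: "c \<in> D one" and "df f"
  then obtain d where d: "d \<in> D one" "\<And>x. x \<in> D N \<Longrightarrow> ap d x = f x" by (auto simp: df_def)
  have "valid (asg [((one, 0), c), ((one, 1), d)])" by (intro valid_asg) (simp add: c d)
  from df_term[OF this, of "Var one 0 \<^bold>\<cdot> (Var one 1 \<^bold>\<cdot> Var N 0)"]
  show ?thesis by (simp add: asg_def has_type_def d cong: df_cong)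
qed

lemma df_S: "df f \<Longrightarrow> df (\<lambda>x. S (f x))"
  by (rule df_ap) auto

lemma df_rec: "df f \<Longrightarrow> df g \<Longrightarrow> h \<in> D (N \<rightarrow>\<^sub>t one) \<Longrightarrow> df (\<lambda>x. rec (f x) (g x) h)"
proof -
  assume h: "h \<in> D (N \<rightarrow>\<^sub>t one)" and "df f" "df g"
  then obtain d e where d: "d \<in> D one" "\<And>x. x \<in> D N \<Longrightarrow> ap d x = f x"
    and e: "e \<in> D one" "\<And>x. x \<in> D N \<Longrightarrow> ap e x = g x" by (auto simp: df_def)
  have "valid (asg [((N \<rightarrow>\<^sub>t one, 0), h), ((one, 0), d), ((one, 1), e)])"
    by (intro valid_asg) (simp add: h d e)
  from df_term[OF this, of "Rec \<^bold>\<cdot> (Var one 0 \<^bold>\<cdot> Var N 0) \<^bold>\<cdot> (Var one 1 \<^bold>\<cdot> Var N 0) \<^bold>\<cdot> Var (N \<rightarrow>\<^sub>t one) 0"]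
  show ?thesis by (simp add: asg_def has_type_def d e cong: df_cong)
qed

lemma induct_df:
  assumes "df p" "df q" "df f" "df g"
    and "(p z = z \<longrightarrow> q z = z) \<longrightarrow> f z = g z"
    and "\<And>x. x \<in> D N \<Longrightarrow> (p x = z \<longrightarrow> q x = z) \<longrightarrow> f x = g x \<Longrightarrow>
      (p (S x) = z \<longrightarrow> q (S x) = z) \<longrightarrow> f (S x) = g (S x)"
    and x: "x \<in> D N"
  shows "(p x = z \<longrightarrow> q x = z) \<longrightarrow> f x = g x"
proof -
  obtain cp where cp: "cp \<in> D one" "\<And>x. x \<in> D N \<Longrightarrow> ap cp x = p x" using assms(1) unfolding df_def by blast
  obtain cq where cq: "cq \<in> D one" "\<And>x. x \<in> D N \<Longrightarrow> ap cq x = q x" using assms(2) unfolding df_def by blast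
  obtain cf where cf: "cf \<in> D one" "\<And>x. x \<in> D N \<Longrightarrow> ap cf x = f x" using assms(3) unfolding df_def by blast
  obtain cg where cg: "cg \<in> D one" "\<And>x. x \<in> D N \<Longrightarrow> ap cg x = g x" using assms(4) unfolding df_def by blast
  have eq: "((ap cp x = z \<longrightarrow> ap cq x = z) \<longrightarrow> ap cf x = ap cg x) \<longleftrightarrow>
      ((p x = z \<longrightarrow> q x = z) \<longrightarrow> f x = g x)" if "x \<in> D N" for x
    by (simp only: cp(2)[OF that] cq(2)[OF that] cf(2)[OF that] cg(2)[OF that])
  have Sx: "S x \<in> D N" if "x \<in> D N" for x using that by simp
  have "(ap cp x = z \<longrightarrow> ap cq x = z) \<longrightarrow> ap cf x = ap cg x"
  proof (rule induct_elements[OF cp(1) cq(1) cf(1) cg(1) _ _ x])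
    show "(ap cp z = z \<longrightarrow> ap cq z = z) \<longrightarrow> ap cf z = ap cg z"
      unfolding eq[OF I_in(1)] by (rule assms(5))
    fix x assume x: "x \<in> D N" and "(ap cp x = z \<longrightarrow> ap cq x = z) \<longrightarrow> ap cf x = ap cg x"
    then show "(ap cp (S x) = z \<longrightarrow> ap cq (S x) = z) \<longrightarrow> ap cf (S x) = ap cg (S x)"
      unfolding eq[OF x] eq[OF Sx[OF x]] using assms(6) by blast
  qed
  then show ?thesis unfolding eq[OF x] .
qed

lemma induct_eq:
  assumes "df f" "df g" "f z = g z" "\<And>x. x \<in> D N \<Longrightarrow> f x = g x \<Longrightarrow> f (S x) = g (S x)" "x \<in> D N"
  shows "f x = g x"
  \<comment> \<open>The constant functions make the premise
    \<open>p x = z \<longrightarrow> q x = z\<close> true everywhere.\<close>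
  using induct_df[of "\<lambda>x. z" "\<lambda>x. z" f g x] assms df_const[OF I_in(1)] by blast

end

section \<open>Arithmetic in models\<close>

text \<open>The recursor tests \<open>a\<close>: zero yields the start value, a successor the value
  of a step function constantly \<open>c\<close>. That function is written with \<open>Proj\<close>,
  because a \<open>Lam\<close> could capture variables of \<open>c\<close>.\<close>

definition cond_tm :: "tm \<Rightarrow> tm \<Rightarrow> tm \<Rightarrow> tm" where
  "cond_tm a b c = Rec \<^bold>\<cdot> a \<^bold>\<cdot> b \<^bold>\<cdot> (Proj one N \<^bold>\<cdot> (Proj N N \<^bold>\<cdot> c))"

lemma plus_tm_simps [simp]:
  "tyof (s \<^bold>+ t) = N"
  "wt s \<Longrightarrow> tyof s = N \<Longrightarrow> wt t \<Longrightarrow> tyof t = N \<Longrightarrow> wt (s \<^bold>+ t)"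
  "vars (s \<^bold>+ t) = vars s \<union> vars t"
  by (auto simp: plus_tm_def)

lemma pred_tm_simps [simp]:
  "tyof (pred_tm t) = N"
  "wt t \<Longrightarrow> tyof t = N \<Longrightarrow> wt (pred_tm t)"
  "vars (pred_tm t) = vars t"
  by (auto simp: pred_tm_def)

lemma monus_tm_simps [simp]:
  "tyof (monus_tm s t) = N"
  "wt s \<Longrightarrow> tyof s = N \<Longrightarrow> wt t \<Longrightarrow> tyof t = N \<Longrightarrow> wt (monus_tm s t)"
  "vars (monus_tm s t) = vars s \<union> vars t"
  by (auto simp: monus_tm_def)

lemma triangle_tm_simps [simp]:
  "tyof (triangle_tm t) = N"
  "wt t \<Longrightarrow> tyof t = N \<Longrightarrow> wt (triangle_tm t)"
  "vars (triangle_tm t) = vars t"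
  by (auto simp: triangle_tm_def)

lemma pair_tm_simps [simp]:
  "tyof (pair_tm s t) = N"
  "wt s \<Longrightarrow> tyof s = N \<Longrightarrow> wt t \<Longrightarrow> tyof t = N \<Longrightarrow> wt (pair_tm s t)"
  "vars (pair_tm s t) = vars s \<union> vars t"
  by (auto simp: pair_tm_def)

lemma cond_tm_simps [simp]:
  "tyof (cond_tm a b c) = N"
  "wt a \<Longrightarrow> tyof a = N \<Longrightarrow> wt b \<Longrightarrow> tyof b = N \<Longrightarrow> wt c \<Longrightarrow> tyof c = N \<Longrightarrow> wt (cond_tm a b c)"
  "vars (cond_tm a b c) = vars a \<union> vars b \<union> vars c"
  by (auto simp: cond_tm_def)

context model
begin

definition add :: "'a \<Rightarrow> 'a \<Rightarrow> 'a" where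
  "add a b = rec b a (cl (Lam N 0 (\<lambda>r. Lam N 1 (\<lambda>i. Succ \<^bold>\<cdot> r))))"

definition pd :: "'a \<Rightarrow> 'a" where
  "pd a = rec a z (cl (Lam N 0 (\<lambda>r. Lam N 1 (\<lambda>i. i))))"

definition sub :: "'a \<Rightarrow> 'a \<Rightarrow> 'a" where
  "sub a b = rec b a (cl (Lam N 0 (\<lambda>r. Lam N 1 (\<lambda>i. pred_tm r))))"

definition tri :: "'a \<Rightarrow> 'a" where
  "tri a = rec a z (cl (Lam N 0 (\<lambda>r. Lam N 1 (\<lambda>i. r \<^bold>+ Succ \<^bold>\<cdot> i))))"

definition pr :: "'a \<Rightarrow> 'a \<Rightarrow> 'a" where
  "pr a b = add (tri (add a b)) a"

lemma ev_plus [simp]: "ev v (s \<^bold>+ t) = add (ev v s) (ev v t)"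
  unfolding plus_tm_def add_def ev.simps ev_Rec by (subst (3) ev_closed) simp_all

lemma ev_pred [simp]: "ev v (pred_tm t) = pd (ev v t)"
  unfolding pred_tm_def pd_def ev.simps ev_Rec by (subst (2) ev_closed) simp_all

lemma ev_monus [simp]: "ev v (monus_tm s t) = sub (ev v s) (ev v t)"
  unfolding monus_tm_def sub_def ev.simps ev_Rec by (subst (3) ev_closed) simp_all

lemma ev_triangle [simp]: "ev v (triangle_tm t) = tri (ev v t)"
  unfolding triangle_tm_def tri_def ev.simps ev_Rec by (subst (2) ev_closed) simp_all

lemma ev_pair [simp]: "ev v (pair_tm s t) = pr (ev v s) (ev v t)"
  by (simp add: pair_tm_def pr_def)

lemma add_in [simp]: "a \<in> D N \<Longrightarrow> b \<in> D N \<Longrightarrow> add a b \<in> D N"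
  unfolding add_def by (intro rec_in cl_in) (simp_all add: has_type_def)

lemma pd_in [simp]: "a \<in> D N \<Longrightarrow> pd a \<in> D N"
  unfolding pd_def by (intro rec_in cl_in) (simp_all add: has_type_def)

lemma sub_in [simp]: "a \<in> D N \<Longrightarrow> b \<in> D N \<Longrightarrow> sub a b \<in> D N"
  unfolding sub_def by (intro rec_in cl_in) (simp_all add: has_type_def)

lemma tri_in [simp]: "a \<in> D N \<Longrightarrow> tri a \<in> D N"
  unfolding tri_def by (intro rec_in cl_in) (simp_all add: has_type_def)

lemma pr_in [simp]: "a \<in> D N \<Longrightarrow> b \<in> D N \<Longrightarrow> pr a b \<in> D N"
  by (simp add: pr_def)

lemma cl_Lam_in: "wt (t (Var \<rho> n)) \<Longrightarrow> tyof (t (Var \<rho> n)) = \<tau> \<Longrightarrow> cl (Lam \<rho> n t) \<in> D (\<rho> \<rightarrow>\<^sub>t \<tau>)"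
  by (rule cl_in) (simp add: has_type_def)

lemma rec_Lam:
  fixes t
  defines "u \<equiv> t (Var N 0) (Var N 1)" and "c \<equiv> cl (Lam N 0 (\<lambda>r. Lam N 1 (\<lambda>i. t r i)))"
  assumes "wt u" "tyof u = N" "y \<in> D N"
  shows "rec z y c = y"
    and "x \<in> D N \<Longrightarrow> rec (S x) y c = ev (upd (upd v0 N 0 (rec x y c)) N 1 x) u"
proof -
  have c: "c \<in> D (N \<rightarrow>\<^sub>t one)"
    unfolding c_def using assms by (intro cl_Lam_in) (simp_all add: u_def)
  then show "rec z y c = y" using assms by simp
  assume x: "x \<in> D N"
  have "ap (ap c r) x = ev (upd (upd v0 N 0 r) N 1 x) u" if "r \<in> D N" for r
    using that x assms(3) by (simp add: c_def u_def cl_def)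
  then show "rec (S x) y c = ev (upd (upd v0 N 0 (rec x y c)) N 1 x) u"
    using c x assms by simp
qed

lemma add_simps [simp]:
  "a \<in> D N \<Longrightarrow> add a z = a"
  "a \<in> D N \<Longrightarrow> b \<in> D N \<Longrightarrow> add a (S b) = S (add a b)"
  unfolding add_def by (simp_all add: rec_Lam[unfolded One_nat_def])

lemma pd_simps [simp]:
  "pd z = z"
  "b \<in> D N \<Longrightarrow> pd (S b) = b"
  unfolding pd_def by (simp_all add: rec_Lam[unfolded One_nat_def])

lemma sub_simps [simp]:
  "a \<in> D N \<Longrightarrow> sub a z = a"
  "a \<in> D N \<Longrightarrow> b \<in> D N \<Longrightarrow> sub a (S b) = pd (sub a b)"
  unfolding sub_def by (simp_all add: rec_Lam[unfolded One_nat_def])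

lemma tri_simps [simp]:
  "tri z = z"
  "b \<in> D N \<Longrightarrow> tri (S b) = add (tri b) (S b)"
  unfolding tri_def by (simp_all add: rec_Lam[unfolded One_nat_def] del: add_simps)

lemma df_add: "df f \<Longrightarrow> df g \<Longrightarrow> df (\<lambda>x. add (f x) (g x))"
  unfolding add_def by (rule df_rec) (simp_all add: cl_Lam_in)

lemma df_pd: "df f \<Longrightarrow> df (\<lambda>x. pd (f x))"
  unfolding pd_def by (rule df_rec) (simp_all add: cl_Lam_in df_const)

lemma df_sub: "df f \<Longrightarrow> df g \<Longrightarrow> df (\<lambda>x. sub (f x) (g x))"
  unfolding sub_def by (rule df_rec) (simp_all add: cl_Lam_in)

lemma df_tri: "df f \<Longrightarrow> df (\<lambda>x. tri (f x))"
  unfolding tri_def by (rule df_rec) (simp_all add: cl_Lam_in df_const)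

lemmas df_intros = df_const df_id df_S df_add df_pd df_sub df_tri

lemma nat_cases:
  assumes "x \<in> D N"
  obtains "x = z" | y where "y \<in> D N" "x = S y"
proof -
  \<comment> \<open>As \<open>S z = z\<close> is false, the premise says that \<open>x\<close> is
    not zero; this form fits the shape for which induction is available.\<close>
  have "(x = z \<longrightarrow> S z = z) \<longrightarrow> x = S (pd x)"
    by (rule induct_df[of "\<lambda>x. x" "\<lambda>x. S z" "\<lambda>x. x" "\<lambda>x. S (pd x)"])
      (use assms in \<open>simp_all add: df_intros\<close>)
  then show ?thesis using that assms pd_in by metis
qed

lemma ev_cond [simp]:
  assumes "ev v a \<in> D N" "ev v b \<in> D N" "ev v c \<in> D N"
  shows "ev v (cond_tm a b c) = (if ev v a = z then ev v b else ev v c)"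
proof -
  let ?k = "ap (I (Proj one N)) (ap (I (Proj N N)) (ev v c))"
  have "I (Proj one N) \<in> D (one \<rightarrow>\<^sub>t N \<rightarrow>\<^sub>t one)" "I (Proj N N) \<in> D (N \<rightarrow>\<^sub>t one)"
    using I_in(3)[of one N] I_in(3)[of N N] by simp_all
  then have *: "?k \<in> D (N \<rightarrow>\<^sub>t one)" "ap (I (Proj N N)) (ev v c) \<in> D one"
    using assms by (auto intro: ap_in)
  show ?thesis
    using assms(1) by (cases rule: nat_cases) (simp_all add: cond_tm_def * assms)
qed

lemma df_if:
  assumes "df f" "df g" "df h"
  shows "df (\<lambda>x. if f x = z then g x else h x)"
proof -
  obtain cf where f: "cf \<in> D one" "\<And>x. x \<in> D N \<Longrightarrow> ap cf x = f x" using assms(1) unfolding df_def by blast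
  obtain cg where g: "cg \<in> D one" "\<And>x. x \<in> D N \<Longrightarrow> ap cg x = g x" using assms(2) unfolding df_def by blast
  obtain ch where h: "ch \<in> D one" "\<And>x. x \<in> D N \<Longrightarrow> ap ch x = h x" using assms(3) unfolding df_def by blast
  have "valid (asg [((one, 0), cf), ((one, 1), cg), ((one, 2), ch)])"
    by (intro valid_asg) (simp add: f(1) g(1) h(1))
  note df_term[OF this, of "cond_tm (Var one 0 \<^bold>\<cdot> Var N 0) (Var one 1 \<^bold>\<cdot> Var N 0) (Var one 2 \<^bold>\<cdot> Var N 0)"]
  moreover have "f x \<in> D N" "g x \<in> D N" "h x \<in> D N" if "x \<in> D N" for x
    using df_in assms that by auto
  ultimately show ?thesis by (simp add: asg_def has_type_def f g h cong: df_cong if_cong)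
qed

lemma sub_S_S [simp]:
  assumes "a \<in> D N" "b \<in> D N"
  shows "sub (S a) (S b) = sub a b"
  by (rule induct_eq[of "\<lambda>b. sub (S a) (S b)" "\<lambda>b. sub a b"]) (use assms in \<open>auto intro!: df_intros\<close>)

lemma sub_z [simp]: "b \<in> D N \<Longrightarrow> sub z b = z"
  by (rule induct_eq[of "\<lambda>b. sub z b" "\<lambda>b. z"]) (auto intro!: df_intros)

lemma sub_self [simp]: "a \<in> D N \<Longrightarrow> sub a a = z"
  by (rule induct_eq[of "\<lambda>a. sub a a" "\<lambda>a. z"]) (auto intro!: df_intros simp del: sub_simps(2))

lemma sub_S_self [simp]: "a \<in> D N \<Longrightarrow> sub (S a) a = S z"
  by (rule induct_eq[of "\<lambda>a. sub (S a) a" "\<lambda>a. S z"]) (auto intro!: df_intros simp del: sub_simps(2))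

lemma S_add [simp]: "a \<in> D N \<Longrightarrow> b \<in> D N \<Longrightarrow> add (S a) b = S (add a b)"
  by (rule induct_eq[of "\<lambda>b. add (S a) b" "\<lambda>b. S (add a b)"]) (auto intro!: df_intros)

lemma z_add [simp]: "b \<in> D N \<Longrightarrow> add z b = b"
  by (rule induct_eq[of "\<lambda>b. add z b" "\<lambda>b. b"]) (auto intro!: df_intros)

lemma add_comm: "a \<in> D N \<Longrightarrow> b \<in> D N \<Longrightarrow> add a b = add b a"
  by (rule induct_eq[of "\<lambda>b. add a b" "\<lambda>b. add b a"]) (auto intro!: df_intros)

lemma add_assoc: "a \<in> D N \<Longrightarrow> b \<in> D N \<Longrightarrow> c \<in> D N \<Longrightarrow> add (add a b) c = add a (add b c)"
  by (rule induct_eq[of "\<lambda>c. add (add a b) c" "\<lambda>c. add a (add b c)"]) (auto intro!: df_intros)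

lemma add_sub [simp]: "a \<in> D N \<Longrightarrow> b \<in> D N \<Longrightarrow> sub (add a b) a = b"
  by (rule induct_eq[of "\<lambda>a. sub (add a b) a" "\<lambda>a. b"]) (auto intro!: df_intros simp del: sub_simps(2))

text \<open>Links truncated subtraction to addition, so that an inequality can be used as a
  decomposition (\<open>le_obtain\<close>). In the induction on \<open>a\<close>, having
  \<open>S a\<close> below \<open>b\<close> forces the difference of \<open>b\<close> and
  \<open>a\<close> to be a successor.\<close>

lemma add_sub_inverse:
  assumes "a \<in> D N" "b \<in> D N" "sub a b = z"
  shows "add a (sub b a) = b"
proof -
  \<comment> \<open>\<open>z = z\<close> stands for the constant \<open>p\<close> in the shape of
    \<open>induct_df\<close>; the actual hypothesis takes the place of \<open>q\<close>.\<close>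
  have "(z = z \<longrightarrow> sub a b = z) \<longrightarrow> add a (sub b a) = b"
  proof (rule induct_df[of "\<lambda>a. z" "\<lambda>a. sub a b" "\<lambda>a. add a (sub b a)" "\<lambda>a. b"])
    fix a assume a: "a \<in> D N" and IH: "(z = z \<longrightarrow> sub a b = z) \<longrightarrow> add a (sub b a) = b"
    show "(z = z \<longrightarrow> sub (S a) b = z) \<longrightarrow> add (S a) (sub b (S a)) = b"
    proof (intro impI, drule mp[OF _ refl])
      assume Sa: "sub (S a) b = z"
      from assms(2) have "sub a b = z"
      proof (cases rule: nat_cases)
        case 1
        then show ?thesis using Sa a by simp
      next
        case (2 c)
        then have "sub a c = z" using Sa a sub_S_S[of a c] by metis
        then show ?thesis using 2 a by simp
      qed
      with IH have *: "add a (sub b a) = b" by blast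
      have "sub b a \<in> D N" using a assms(2) by simp
      then show "add (S a) (sub b (S a)) = b"
      proof (cases rule: nat_cases)
        case 1
        then have "b = a" using * a by simp
        then show ?thesis using Sa a by simp
      next
        case (2 d)
        then show ?thesis using * a assms(2) by simp
      qed
    qed
  qed (use assms in \<open>auto intro!: df_intros\<close>)
  then show ?thesis using assms by blast
qed

section \<open>Decidable predicates and the order of the numbers\<close>

definition le :: "'a \<Rightarrow> 'a \<Rightarrow> bool" where "le a b \<longleftrightarrow> sub a b = z"

lemma le_add [simp]: "a \<in> D N \<Longrightarrow> d \<in> D N \<Longrightarrow> le a (add a d)"
  unfolding le_def
  by (rule induct_eq[of "\<lambda>a. sub a (add a d)" "\<lambda>a. z"]) (auto intro!: df_intros simp del: sub_simps(2))

lemma le_obtain: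
  assumes "le a b" "a \<in> D N" "b \<in> D N"
  obtains d where "d \<in> D N" "b = add a d"
  using that[of "sub b a"] assms add_sub_inverse[of a b] by (simp add: le_def)

lemma le_antisym: "le a b \<Longrightarrow> le b a \<Longrightarrow> a \<in> D N \<Longrightarrow> b \<in> D N \<Longrightarrow> a = b"
  using add_sub_inverse[of a b] by (simp add: le_def)

text \<open>Decidable in the sense of the model: the zero set of an object. These predicates admit
  induction (\<open>induct_dec\<close>) and are closed under the connectives; nothing is claimed for
  quantifiers.\<close>

definition dec :: "('a \<Rightarrow> bool) \<Rightarrow> bool" where
  "dec P \<longleftrightarrow> (\<exists>f. df f \<and> (\<forall>x\<in>D N. P x \<longleftrightarrow> f x = z))"

lemma dec_zero: "df f \<Longrightarrow> dec (\<lambda>x. f x = z)"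
  by (auto simp: dec_def)

lemma dec_not: "dec P \<Longrightarrow> dec (\<lambda>x. \<not> P x)"
proof -
  assume "dec P"
  then obtain f where "df f" "\<forall>x\<in>D N. P x \<longleftrightarrow> f x = z" by (auto simp: dec_def)
  then show ?thesis unfolding dec_def
    by (intro exI[of _ "\<lambda>x. if f x = z then S z else z"]) (auto intro!: df_if df_intros)
qed

lemma dec_imp: "dec P \<Longrightarrow> dec Q \<Longrightarrow> dec (\<lambda>x. P x \<longrightarrow> Q x)"
proof -
  assume "dec P" "dec Q"
  then obtain f g where "df f" "\<forall>x\<in>D N. P x \<longleftrightarrow> f x = z" "df g" "\<forall>x\<in>D N. Q x \<longleftrightarrow> g x = z"
    by (auto simp: dec_def)
  then show ?thesis unfolding dec_def
    by (intro exI[of _ "\<lambda>x. if f x = z then g x else z"]) (auto intro!: df_if df_intros)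
qed

lemma dec_conj: "dec P \<Longrightarrow> dec Q \<Longrightarrow> dec (\<lambda>x. P x \<and> Q x)"
  using dec_not[OF dec_imp[OF _ dec_not, of P Q]] by simp

lemma dec_disj: "dec P \<Longrightarrow> dec Q \<Longrightarrow> dec (\<lambda>x. P x \<or> Q x)"
  using dec_imp[OF dec_not, of P Q] by (simp add: disj_imp)

lemma dec_le: "df f \<Longrightarrow> df g \<Longrightarrow> dec (\<lambda>x. le (f x) (g x))"
  unfolding le_def by (intro dec_zero df_sub)

lemmas dec_intros = dec_zero dec_le dec_not dec_imp dec_conj dec_disj

lemma induct_dec:
  assumes "dec P" "P z" and step: "\<And>x. x \<in> D N \<Longrightarrow> P x \<Longrightarrow> P (S x)" and x: "x \<in> D N"
  shows "P x"
proof -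
  obtain f where f: "df f" "\<And>x. x \<in> D N \<Longrightarrow> P x \<longleftrightarrow> f x = z"
    using assms(1) unfolding dec_def by blast
  have Sx: "S x \<in> D N" if "x \<in> D N" for x using that by simp
  have "f x = z"
  proof (rule induct_eq[OF f(1) df_const[OF I_in(1)] _ _ x])
    show "f z = z" using assms(2) unfolding f(2)[OF I_in(1)] .
    show "f (S x) = z" if "x \<in> D N" "f x = z" for x
      using step[OF that(1)] that(2) unfolding f(2)[OF that(1)] f(2)[OF Sx[OF that(1)]] by blast
  qed
  then show ?thesis unfolding f(2)[OF x] .
qed

lemma le_refl [simp]: "a \<in> D N \<Longrightarrow> le a a"
  by (simp add: le_def)

lemma z_le [simp]: "a \<in> D N \<Longrightarrow> le z a"
  by (simp add: le_def)

lemma le_z [simp]: "a \<in> D N \<Longrightarrow> le a z \<longleftrightarrow> a = z"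
  by (simp add: le_def)

lemma S_le_S [simp]: "a \<in> D N \<Longrightarrow> b \<in> D N \<Longrightarrow> le (S a) (S b) \<longleftrightarrow> le a b"
  by (simp add: le_def del: sub_simps)

lemma not_S_le_self [simp]: "a \<in> D N \<Longrightarrow> \<not> le (S a) a"
  by (simp add: le_def)

lemma le_trans:
  assumes "le a b" "le b c" "a \<in> D N" "b \<in> D N" "c \<in> D N"
  shows "le a c"
proof -
  obtain d e where "d \<in> D N" "b = add a d" "e \<in> D N" "c = add b e"
    using assms le_obtain by metis
  then show ?thesis using assms by (simp add: add_assoc)
qed

lemma le_S [simp]: "a \<in> D N \<Longrightarrow> le a (S a)"
  using le_add[of a "S z"] by simp

lemma le_total: "a \<in> D N \<Longrightarrow> b \<in> D N \<Longrightarrow> le a b \<or> le b a"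
proof (rule induct_dec[of "\<lambda>a. le a b \<or> le b a"])
  assume b: "b \<in> D N"
  fix a assume a: "a \<in> D N" "le a b \<or> le b a"
  show "le (S a) b \<or> le b (S a)"
  proof (cases "le b a")
    case True
    then show ?thesis using le_trans[of b a "S a"] a b by simp
  next
    case False
    with a b obtain d where d: "d \<in> D N" "b = add a d" using le_obtain by blast
    from d(1) show ?thesis
    proof (cases rule: nat_cases)
      case 1
      then show ?thesis using d a by simp
    next
      case (2 e)
      then have "b = add (S a) e" using d a by simp
      then show ?thesis using 2 a by (simp del: S_add)
    qed
  qed
qed (auto intro!: dec_intros df_intros)

lemma not_le:
  assumes "a \<in> D N" "b \<in> D N"
  shows "\<not> le a b \<longleftrightarrow> le (S b) a"
proof
  assume "\<not> le a b"
  then obtain d where d: "d \<in> D N" "a = add b d"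
    using le_total[OF assms] le_obtain assms by blast
  from d(1) show "le (S b) a"
  proof (cases rule: nat_cases)
    case 1
    then show ?thesis using d \<open>\<not> le a b\<close> assms by simp
  next
    case (2 e)
    then have "a = add (S b) e" using d assms by simp
    then show ?thesis using 2 assms by (simp del: S_add)
  qed
next
  assume "le (S b) a"
  then show "\<not> le a b" using le_trans[of "S b" a b] assms by auto
qed

lemma le_S_iff: "a \<in> D N \<Longrightarrow> b \<in> D N \<Longrightarrow> le a (S b) \<longleftrightarrow> le a b \<or> a = S b"
  by (metis S_le_S in_simps(1) I_in(2) le_antisym le_refl le_trans not_le le_S)

end

section \<open>From USADS to mu\<close>

text \<open>The diagonal of the Cantor pairing on which \<open>t\<close> lies, that is, the greatest
  \<open>r\<close> whose triangular number is at most \<open>t\<close>. When the argument grows by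
  one, the diagonal advances by at most one.\<close>

definition diag_tm :: "tm \<Rightarrow> tm" where
  "diag_tm t = Rec \<^bold>\<cdot> t \<^bold>\<cdot> Zero \<^bold>\<cdot> Lam N 0 (\<lambda>r. Lam N 1 (\<lambda>i.
     cond_tm (monus_tm (triangle_tm (Succ \<^bold>\<cdot> r)) (Succ \<^bold>\<cdot> i)) (Succ \<^bold>\<cdot> r) r))"

definition fst_tm :: "tm \<Rightarrow> tm" where
  "fst_tm t = monus_tm t (triangle_tm (diag_tm t))"

definition snd_tm :: "tm \<Rightarrow> tm" where
  "snd_tm t = monus_tm (diag_tm t) (fst_tm t)"

text \<open>One step of the search for the least zero of \<open>f\<close>: \<open>r\<close> is kept
  once it is a zero, otherwise the search moves to the successor of \<open>i\<close>. If there is no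
  zero up to \<open>s\<close>, the search ends at \<open>s\<close> itself, so testing
  \<open>f\<close> at the result decides whether there is one.\<close>

definition search_step_tm :: tm where
  "search_step_tm = Lam one 0 (\<lambda>f. Lam N 0 (\<lambda>r. Lam N 1 (\<lambda>i. cond_tm (f \<^bold>\<cdot> r) r (Succ \<^bold>\<cdot> i))))"

definition search_tm :: "tm \<Rightarrow> tm \<Rightarrow> tm" where
  "search_tm f s = Rec \<^bold>\<cdot> s \<^bold>\<cdot> Zero \<^bold>\<cdot> (search_step_tm \<^bold>\<cdot> f)"

text \<open>Membership in a set is the value 1, while the tests report truth by 0; this fixes the
  order of the branches. Testing the smaller component suffices because the field is upward
  closed.\<close>

definition order_tm :: tm where
  "order_tm = Lam one 0 (\<lambda>f. Lam N 2 (\<lambda>p.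
     cond_tm (monus_tm (fst_tm p) (snd_tm p))
       (cond_tm (f \<^bold>\<cdot> search_tm f (fst_tm p)) (Succ \<^bold>\<cdot> Zero) Zero) Zero))"

definition mu_tm :: tm where
  "mu_tm = Lam (one \<rightarrow>\<^sub>t one) 0 (\<lambda>\<Psi>. Lam one 0 (\<lambda>f.
     search_tm f (\<Psi> \<^bold>\<cdot> (order_tm \<^bold>\<cdot> f) \<^bold>\<cdot> Zero)))"

lemma diag_tm_simps [simp]:
  "tyof (diag_tm t) = N" "wt t \<Longrightarrow> tyof t = N \<Longrightarrow> wt (diag_tm t)" "vars (diag_tm t) = vars t"
  by (auto simp: diag_tm_def)

lemma fst_tm_simps [simp]:
  "tyof (fst_tm t) = N" "wt t \<Longrightarrow> tyof t = N \<Longrightarrow> wt (fst_tm t)" "vars (fst_tm t) = vars t"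
  by (auto simp: fst_tm_def)

lemma snd_tm_simps [simp]:
  "tyof (snd_tm t) = N" "wt t \<Longrightarrow> tyof t = N \<Longrightarrow> wt (snd_tm t)" "vars (snd_tm t) = vars t"
  by (auto simp: snd_tm_def)

lemma search_step_tm_simps [simp]:
  "tyof search_step_tm = one \<rightarrow>\<^sub>t N \<rightarrow>\<^sub>t one" "wt search_step_tm" "vars search_step_tm = {}"
  by (auto simp: search_step_tm_def)

lemma search_tm_simps [simp]:
  "tyof (search_tm f s) = N"
  "wt f \<Longrightarrow> tyof f = one \<Longrightarrow> wt s \<Longrightarrow> tyof s = N \<Longrightarrow> wt (search_tm f s)"
  "vars (search_tm f s) = vars f \<union> vars s"
  by (auto simp: search_tm_def)

lemma order_tm_simps [simp]:
  "tyof order_tm = one \<rightarrow>\<^sub>t one" "wt order_tm" "vars order_tm = {}"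
  by (auto simp: order_tm_def)

lemma mu_tm_simps [simp]:
  "tyof mu_tm = (one \<rightarrow>\<^sub>t one) \<rightarrow>\<^sub>t two" "wt mu_tm" "vars mu_tm = {}"
  by (auto simp: mu_tm_def)

context model
begin

lemma ap_in2: "c \<in> D (\<rho> \<rightarrow>\<^sub>t \<sigma> \<rightarrow>\<^sub>t \<tau>) \<Longrightarrow> x \<in> D \<rho> \<Longrightarrow> y \<in> D \<sigma> \<Longrightarrow> ap (ap c x) y \<in> D \<tau>"
  by (blast intro: ap_in)

subsection \<open>Inverting the pairing\<close>

lemma add_le_mono: "le a b \<Longrightarrow> a \<in> D N \<Longrightarrow> b \<in> D N \<Longrightarrow> c \<in> D N \<Longrightarrow> le (add c a) (add c b)"
  by (erule le_obtain) (simp_all add: add_assoc[symmetric])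

lemma tri_mono:
  assumes "le a b" "a \<in> D N" "b \<in> D N"
  shows "le (tri a) (tri b)"
proof -
  have "le (tri a) (tri (add a d))" if "d \<in> D N" for d
  proof (rule induct_dec[OF _ _ _ that, of "\<lambda>d. le (tri a) (tri (add a d))"])
    show "le (tri a) (tri (add a (S d)))" if "d \<in> D N" "le (tri a) (tri (add a d))" for d
      using that assms le_trans[OF that(2) le_add[of "tri (add a d)" "S (add a d)"]] by simp
  qed (use assms in \<open>auto intro!: dec_intros df_intros\<close>)
  then show ?thesis using assms le_obtain by metis
qed

definition diag :: "'a \<Rightarrow> 'a" where
  "diag p = rec p z (cl (Lam N 0 (\<lambda>r. Lam N 1 (\<lambda>i.
     cond_tm (monus_tm (triangle_tm (Succ \<^bold>\<cdot> r)) (Succ \<^bold>\<cdot> i)) (Succ \<^bold>\<cdot> r) r))))"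

definition pfst :: "'a \<Rightarrow> 'a" where "pfst p = sub p (tri (diag p))"

definition psnd :: "'a \<Rightarrow> 'a" where "psnd p = sub (diag p) (pfst p)"

lemma ev_diag [simp]: "ev v (diag_tm t) = diag (ev v t)"
  unfolding diag_tm_def diag_def ev.simps ev_Rec by (subst (2) ev_closed) auto

lemma ev_fst [simp]: "ev v (fst_tm t) = pfst (ev v t)"
  by (simp add: fst_tm_def pfst_def)

lemma ev_snd [simp]: "ev v (snd_tm t) = psnd (ev v t)"
  by (simp add: snd_tm_def psnd_def)

lemma diag_in [simp]: "a \<in> D N \<Longrightarrow> diag a \<in> D N"
  unfolding diag_def by (intro rec_in cl_in) (simp_all add: has_type_def)

lemma pfst_in [simp]: "a \<in> D N \<Longrightarrow> pfst a \<in> D N"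
  by (simp add: pfst_def)

lemma psnd_in [simp]: "a \<in> D N \<Longrightarrow> psnd a \<in> D N"
  by (simp add: psnd_def)

lemma diag_simps [simp]:
  "diag z = z"
  "p \<in> D N \<Longrightarrow> diag (S p) = (if le (tri (S (diag p))) (S p) then S (diag p) else diag p)"
proof -
  show "diag z = z" unfolding diag_def by (simp add: rec_Lam[unfolded One_nat_def])
  assume p: "p \<in> D N"
  then have "diag p \<in> D N" by simp
  then show "diag (S p) = (if le (tri (S (diag p))) (S p) then S (diag p) else diag p)"
    unfolding diag_def using p
    by (simp add: rec_Lam[unfolded One_nat_def] le_def del: sub_simps sub_S_S tri_simps)
qed

lemma df_diag: "df f \<Longrightarrow> df (\<lambda>x. diag (f x))"
  unfolding diag_def by (rule df_rec) (simp_all add: cl_Lam_in df_const)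

text \<open>If the diagonal advances to \<open>w\<close>, then \<open>S p\<close> is at most
  \<open>tri w\<close> by the bound for \<open>p\<close>, and \<open>tri (S w)\<close> exceeds
  \<open>tri w\<close>. If it stays, the failed test is the new upper bound.\<close>

lemma diag_bounds:
  assumes "p \<in> D N"
  shows "le (tri (diag p)) p \<and> le (S p) (tri (S (diag p)))"
proof (rule induct_dec[OF _ _ _ assms, of "\<lambda>p. le (tri (diag p)) p \<and> le (S p) (tri (S (diag p)))"])
  show "le (tri (diag z)) z \<and> le (S z) (tri (S (diag z)))" by simp
  fix p assume p: "p \<in> D N" and IH: "le (tri (diag p)) p \<and> le (S p) (tri (S (diag p)))"
  show "le (tri (diag (S p))) (S p) \<and> le (S (S p)) (tri (S (diag (S p))))"
  proof (cases "le (tri (S (diag p))) (S p)")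
    case True
    define w where "w = S (diag p)"
    have w: "w \<in> D N" using p by (simp add: w_def)
    have "le (S p) (tri w)" using IH by (simp add: w_def)
    moreover have "le (S (tri w)) (tri (S w))"
      using add_le_mono[of "S z" "S w" "tri w"] w by simp
    ultimately have "le (S (S p)) (tri (S w))"
      using le_trans[of "S (S p)" "S (tri w)" "tri (S w)"] p w by (simp del: tri_simps)
    then show ?thesis using True p by (simp add: w_def[symmetric] del: tri_simps)
  next
    case False
    then have "le (S (S p)) (tri (S (diag p)))" using p not_le by (simp del: tri_simps)
    moreover have "le (tri (diag p)) (S p)"
      using IH p le_trans[of "tri (diag p)" p "S p"] by simp
    ultimately show ?thesis using False p by (simp del: tri_simps)
  qed
qed (intro dec_intros df_intros df_diag)

text \<open>The intervals from \<open>tri a\<close> up to but excluding \<open>tri (S a)\<close> are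
  disjoint, by monotonicity of \<open>tri\<close>.\<close>

lemma diag_unique:
  assumes "le (tri a) p" "le (S p) (tri (S a))" "a \<in> D N" "p \<in> D N"
  shows "diag p = a"
proof -
  have *: "le c b" if "le (tri c) p" "le (S p) (tri (S b))" "b \<in> D N" "c \<in> D N" for b c
  proof (rule ccontr)
    assume "\<not> le c b"
    then have "le (tri (S b)) (tri c)" using that by (intro tri_mono) (simp_all add: not_le)
    then have "le (S p) p"
      using that assms(4) le_trans[of "S p" "tri (S b)" "tri c"] le_trans[of "S p" "tri c" p]
      by (simp del: tri_simps)
    then show False using assms(4) by simp
  qed
  show ?thesis
    using diag_bounds[OF assms(4)] assms *[of a "diag p"] *[of "diag p" a]
    by (intro le_antisym) simp_all
qed

lemma diag_pr [simp]:
  assumes "a \<in> D N" "b \<in> D N"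
  shows "diag (pr a b) = add a b"
proof (rule diag_unique)
  show "le (tri (add a b)) (pr a b)" using assms by (simp add: pr_def)
  show "le (S (pr a b)) (tri (S (add a b)))"
    using assms add_le_mono[of "S a" "S (add a b)" "tri (add a b)"] by (simp add: pr_def)
qed (use assms in simp_all)

lemma pfst_pr [simp]: "a \<in> D N \<Longrightarrow> b \<in> D N \<Longrightarrow> pfst (pr a b) = a"
  by (simp add: pfst_def) (simp add: pr_def)

lemma psnd_pr [simp]: "a \<in> D N \<Longrightarrow> b \<in> D N \<Longrightarrow> psnd (pr a b) = b"
  by (simp add: psnd_def)

subsection \<open>Bounded search\<close>

definition search :: "'a \<Rightarrow> 'a \<Rightarrow> 'a" where
  "search f s = rec s z (ap (cl search_step_tm) f)"

lemma ev_search [simp]: "ev v (search_tm f s) = search (ev v f) (ev v s)"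
  by (simp add: search_tm_def search_def ev_closed)

lemma search_step_in: "f \<in> D one \<Longrightarrow> ap (cl search_step_tm) f \<in> D (N \<rightarrow>\<^sub>t one)"
  by (rule ap_in[OF cl_in]) (simp_all add: has_type_def)

lemma search_in [simp]: "f \<in> D one \<Longrightarrow> s \<in> D N \<Longrightarrow> search f s \<in> D N"
  by (simp add: search_def search_step_in)

lemma search_simps [simp]:
  assumes "f \<in> D one"
  shows "search f z = z"
    and "s \<in> D N \<Longrightarrow> search f (S s) = (if ap f (search f s) = z then search f s else S s)"
proof -
  show "search f z = z" using assms by (simp add: search_def search_step_in)
  assume s: "s \<in> D N"
  have "ap (ap (ap (cl search_step_tm) f) r) s = (if ap f r = z then r else S s)" if "r \<in> D N" for r
    using assms s that unfolding cl_def search_step_tm_def by simp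
  then show "search f (S s) = (if ap f (search f s) = z then search f s else S s)"
    using assms s search_in[OF assms s] by (simp add: search_def search_step_in)
qed

lemma df_search: "f \<in> D one \<Longrightarrow> df g \<Longrightarrow> df (\<lambda>x. search f (g x))"
  unfolding search_def by (rule df_rec) (simp_all add: df_const search_step_in)

lemma search_le:
  assumes f: "f \<in> D one" and "s \<in> D N"
  shows "le (search f s) s"
proof (rule induct_dec[OF _ _ _ assms(2), of "\<lambda>s. le (search f s) s"])
  show "le (search f (S s)) (S s)" if "s \<in> D N" "le (search f s) s" for s
    using that f le_trans[of "search f s" s "S s"] by simp
qed (use f in \<open>auto intro!: dec_intros df_intros df_search\<close>)

text \<open>On reaching \<open>k\<close> the search has either stopped at an earlier zero or arrives
  at \<open>k\<close> itself; from there on its value no longer changes.\<close>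

lemma search_zero:
  assumes f: "f \<in> D one" and s: "s \<in> D N" and k: "k \<in> D N" "le k s" "ap f k = z"
  shows "ap f (search f s) = z"
proof -
  have "le k s \<longrightarrow> ap f (search f s) = z"
  proof (rule induct_dec[OF _ _ _ s, of "\<lambda>s. le k s \<longrightarrow> ap f (search f s) = z"])
    show "le k (S s) \<longrightarrow> ap f (search f (S s)) = z"
      if "s \<in> D N" "le k s \<longrightarrow> ap f (search f s) = z" for s
      using that f k by (auto simp: le_S_iff)
  qed (use f k in \<open>auto intro!: dec_intros df_intros df_search df_ap\<close>)
  then show ?thesis using k by blast
qed

subsection \<open>Stable orders\<close>

text \<open>Finite means bounded by an element of \<open>D N\<close>, possibly a nonstandard one.
  This and the following definitions copy the nesting of the formulas, so that
  \<open>sem_Stable\<close> is a plain unfolding.\<close>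

definition fin_below :: "('a \<Rightarrow> 'a \<Rightarrow> bool) \<Rightarrow> 'a \<Rightarrow> bool" where
  "fin_below R x \<longleftrightarrow> (\<exists>b\<in>D N. \<forall>y\<in>D N. R y x \<and> y \<noteq> x \<longrightarrow> le y b)"

definition fin_above :: "('a \<Rightarrow> 'a \<Rightarrow> bool) \<Rightarrow> 'a \<Rightarrow> bool" where
  "fin_above R x \<longleftrightarrow> (\<exists>b\<in>D N. \<forall>y\<in>D N. R x y \<and> x \<noteq> y \<longrightarrow> le y b)"

definition discrete_below :: "('a \<Rightarrow> 'a \<Rightarrow> bool) \<Rightarrow> 'a \<Rightarrow> bool" where
  "discrete_below R x \<longleftrightarrow> (\<forall>y\<in>D N. R y y \<longrightarrow> R x y) \<or>
     (\<exists>y\<in>D N. (R y x \<and> y \<noteq> x) \<and> \<not> (\<exists>w\<in>D N. (R y w \<and> y \<noteq> w) \<and> R w x \<and> w \<noteq> x))"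

definition discrete_above :: "('a \<Rightarrow> 'a \<Rightarrow> bool) \<Rightarrow> 'a \<Rightarrow> bool" where
  "discrete_above R x \<longleftrightarrow> (\<forall>y\<in>D N. R y y \<longrightarrow> R y x) \<or>
     (\<exists>y\<in>D N. (R x y \<and> x \<noteq> y) \<and> \<not> (\<exists>w\<in>D N. (R x w \<and> x \<noteq> w) \<and> R w y \<and> w \<noteq> y))"

definition linear :: "('a \<Rightarrow> 'a \<Rightarrow> bool) \<Rightarrow> bool" where
  "linear R \<longleftrightarrow> (\<forall>x\<in>D N. \<forall>y\<in>D N. R x y \<longrightarrow> R x x \<and> R y y) \<and>
     (\<forall>x\<in>D N. \<forall>y\<in>D N. \<forall>w\<in>D N. R x y \<and> R y w \<longrightarrow> R x w) \<and>
     (\<forall>x\<in>D N. \<forall>y\<in>D N. R x y \<and> R y x \<longrightarrow> x = y) \<and>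
     (\<forall>x\<in>D N. \<forall>y\<in>D N. R x x \<and> R y y \<longrightarrow> R x y \<or> R y x)"

definition stable :: "('a \<Rightarrow> 'a \<Rightarrow> bool) \<Rightarrow> bool" where
  "stable R \<longleftrightarrow> linear R \<and>
     (\<forall>x\<in>D N. R x x \<longrightarrow> discrete_below R x \<and> discrete_above R x) \<and>
     (\<exists>x\<in>D N. \<exists>y\<in>D N. R x x \<and> R y y \<and> x \<noteq> y) \<and>
     (\<forall>x\<in>D N. R x x \<longrightarrow> (fin_below R x \<or> fin_above R x) \<and> \<not> (fin_below R x \<and> fin_above R x))"

lemma linear_converse: "linear R \<Longrightarrow> linear (\<lambda>x y. R y x)"
  unfolding linear_def by blast

lemma discrete_below_converse: "discrete_below (\<lambda>x y. R y x) x \<longleftrightarrow> discrete_above R x"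
proof -
  have "(\<exists>w\<in>D N. (R w y \<and> y \<noteq> w) \<and> R x w \<and> w \<noteq> x) \<longleftrightarrow>
      (\<exists>w\<in>D N. (R x w \<and> x \<noteq> w) \<and> R w y \<and> w \<noteq> y)" for y
    by blast
  note eq1 = this
  have eq2: "y \<noteq> x \<longleftrightarrow> x \<noteq> y" for y by blast
  show ?thesis unfolding discrete_below_def discrete_above_def eq1 unfolding eq2 ..
qed

lemma discrete_above_converse: "discrete_above (\<lambda>x y. R y x) x \<longleftrightarrow> discrete_below R x"
  using discrete_below_converse[of "\<lambda>x y. R y x"] by simp

lemma fin_below_converse: "fin_below (\<lambda>x y. R y x) x \<longleftrightarrow> fin_above R x"
  unfolding fin_below_def fin_above_def by blast

lemma fin_above_converse: "fin_above (\<lambda>x y. R y x) x \<longleftrightarrow> fin_below R x"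
  using fin_below_converse[of "\<lambda>x y. R y x"] by simp

text \<open>Lets the ascending construction serve for descending sequences as well.\<close>

lemma stable_converse: "stable R \<Longrightarrow> stable (\<lambda>x y. R y x)"
  unfolding stable_def discrete_below_converse[of R] discrete_above_converse[of R]
    fin_below_converse[of R] fin_above_converse[of R]
  using linear_converse by blast

definition rel :: "'a \<Rightarrow> 'a \<Rightarrow> 'a \<Rightarrow> bool" where
  "rel X x y \<longleftrightarrow> ap X (pr x y) = S z"

lemma sem_leX [simp]: "sem v (leX X s t) \<longleftrightarrow> rel (ev v X) (ev v s) (ev v t)"
  by (simp add: leX_def Mem_def rel_def)

lemma sem_ltX [simp]: "sem v (ltX X s t) \<longleftrightarrow> rel (ev v X) (ev v s) (ev v t) \<and> ev v s \<noteq> ev v t"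
  by (simp add: ltX_def)

lemma sem_Field_mem [simp]: "sem v (Field_mem X s) \<longleftrightarrow> rel (ev v X) (ev v s) (ev v s)"
  by (simp add: Field_mem_def)

lemma sem_Leq [simp]: "sem v (s \<^bold>\<le> t) \<longleftrightarrow> le (ev v s) (ev v t)"
  by (simp add: Leq_def le_def)

lemmas sem_unfold = sem.simps ev.simps sem_Forall sem_Exists sem_leX sem_ltX sem_Field_mem sem_Leq
  upd_apply ty.distinct ty.inject simp_thms if_True if_False zero_neq_one one_neq_zero zero_neq_numeral
  numeral_neq_zero one_eq_numeral_iff numeral_eq_one_iff num.distinct imp_conv_disj de_Morgan_conj de_Morgan_disj

lemma sem_Linear_order:
  "sem v (Linear_order (Var one n)) \<longleftrightarrow>
    (\<forall>x\<in>D N. ap (v one n) x = z \<or> ap (v one n) x = S z) \<and> linear (rel (v one n))"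
  by (simp only: Linear_order_def linear_def Is_set_def Mem_def sem_unfold)

lemma sem_Discrete:
  "sem v (Discrete (Var one n)) \<longleftrightarrow> (\<forall>x\<in>D N. rel (v one n) x x \<longrightarrow>
    discrete_below (rel (v one n)) x \<and> discrete_above (rel (v one n)) x)"
  by (simp only: Discrete_def discrete_below_def discrete_above_def sem_unfold)

lemma sem_Stable:
  "sem v (Stable (Var one n)) \<longleftrightarrow>
    (\<forall>x\<in>D N. ap (v one n) x = z \<or> ap (v one n) x = S z) \<and> stable (rel (v one n))"
  by (simp only: Stable_def sem_Linear_order sem_Discrete stable_def Finitely_many_def
      fin_below_def fin_above_def sem_unfold conj_assoc)

definition monotone_seq :: "'a \<Rightarrow> 'a \<Rightarrow> bool" where
  "monotone_seq X s \<longleftrightarrow>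
     (\<forall>n\<in>D N. rel X (ap s n) (ap s (S n)) \<and> ap s n \<noteq> ap s (S n)) \<or>
     (\<forall>n\<in>D N. rel X (ap s (S n)) (ap s n) \<and> ap s (S n) \<noteq> ap s n)"

definition solves_usads :: "'a \<Rightarrow> bool" where
  "solves_usads \<Psi> \<longleftrightarrow> (\<forall>X\<in>D one. (\<forall>x\<in>D N. ap X x = z \<or> ap X x = S z) \<and> stable (rel X) \<longrightarrow>
     monotone_seq X (ap \<Psi> X))"

definition solves_mu :: "'a \<Rightarrow> bool" where
  "solves_mu \<mu> \<longleftrightarrow> (\<forall>f\<in>D one. (\<exists>n\<in>D N. ap f n = z) \<longrightarrow> ap f (ap \<mu> f) = z)"

lemma sem_USADS: "sem v USADS_matrix \<longleftrightarrow> solves_usads (v (one \<rightarrow>\<^sub>t one) 0)"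
  by (simp only: USADS_matrix_def Let_def sem_Stable solves_usads_def monotone_seq_def sem_unfold)

lemma sem_mu: "sem v mu_matrix \<longleftrightarrow> solves_mu (v two 0)"
  by (simp only: mu_matrix_def Let_def solves_mu_def sem_unfold)

subsection \<open>The order of the numbers above a zero\<close>

text \<open>Seen from inside the model, a nonempty final segment of the numbers has order type
  omega: \<open>S x\<close> is the immediate successor of \<open>x\<close>, and \<open>x\<close>
  itself bounds its predecessors, while no number bounds its successors.\<close>

lemma stable_final_segment:
  assumes R: "\<And>x y. x \<in> D N \<Longrightarrow> y \<in> D N \<Longrightarrow> R x y \<longleftrightarrow> le x y \<and> M x"
    and M: "\<And>x y. x \<in> D N \<Longrightarrow> y \<in> D N \<Longrightarrow> M x \<Longrightarrow> le x y \<Longrightarrow> M y"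
    and n: "n \<in> D N" "M n"
  shows "stable R"
proof -
  have S: "S x \<in> D N" "le x (S x)" "x \<noteq> S x" if "x \<in> D N" for x
    using that not_S_le_self[OF that] by (auto simp del: not_S_le_self)
  have RI: "R x y" if "x \<in> D N" "y \<in> D N" "le x y" "M x" for x y
    using that by (simp add: R)
  have RD: "le x y \<and> M x \<and> M y" if "R x y" "x \<in> D N" "y \<in> D N" for x y
    using that R M by blast
  have "linear R"
    unfolding linear_def
  proof (intro conjI ballI impI)
    fix x y assume xy: "x \<in> D N" "y \<in> D N"
    show "R x x" "R y y" if "R x y"
      using RD[OF that xy] xy by (auto intro!: RI)
    show "R x w" if "w \<in> D N" "R x y \<and> R y w" for w
      using RD[of x y] RD[of y w] that xy le_trans[of x y w] by (intro RI) simp_all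
    show "x = y" if "R x y \<and> R y x"
      using RD[of x y] RD[of y x] that xy by (intro le_antisym) simp_all
    show "R x y \<or> R y x" if "R x x \<and> R y y"
      using le_total[OF xy] RD[of x x] RD[of y y] RI[of x y] RI[of y x] that xy by blast
  qed
  moreover have between: "w = x \<or> w = S x" if "R x w" "R w (S x)" "x \<in> D N" "w \<in> D N" for x w
    using RD[of x w] RD[of w "S x"] that le_S_iff[of w x] le_antisym[of w x] by auto
  moreover have "discrete_above R x" if x: "x \<in> D N" "R x x" for x
  proof -
    have "R x (S x)" using RD[of x x] x S by (intro RI) auto
    then show ?thesis
      unfolding discrete_above_def using S[OF x(1)] between[of x] x by blast
  qed
  moreover have "discrete_below R x" if x: "x \<in> D N" "R x x" for x
  proof (cases "\<exists>y\<in>D N. x = S y \<and> M y")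
    case True
    then obtain y where y: "y \<in> D N" "x = S y" "M y" by blast
    then have "R y x" using S[of y] by (intro RI) simp_all
    then show ?thesis
      unfolding discrete_below_def using S[OF y(1)] between[of y] y by blast
  next
    case False
    \<comment> \<open>Here \<open>x\<close> is least: if \<open>x = S y\<close>, then
      \<open>y\<close> is outside \<open>M\<close>, and since \<open>M\<close> is upward closed
      nothing of \<open>M\<close> lies at or below \<open>y\<close>.\<close>
    have "le x w" if w: "w \<in> D N" "M w" for w
      using x(1)
    proof (cases rule: nat_cases)
      case 1
      then show ?thesis using w by simp
    next
      case (2 y)
      then have "\<not> M y" using False by blast
      then have "\<not> le w y" using w 2 M by blast
      then show ?thesis using 2 w by (simp add: not_le)
    qed
    then have "R x y" if "R y y" "y \<in> D N" for y
      using that x RD[of y y] RD[of x x] by (intro RI) simp_all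
    then show ?thesis unfolding discrete_below_def by blast
  qed
  moreover have "\<exists>x\<in>D N. \<exists>y\<in>D N. R x x \<and> R y y \<and> x \<noteq> y"
  proof -
    have "R n n" "R (S n) (S n)" using n S[OF n(1)] M[of n "S n"] by (auto intro!: RI)
    then show ?thesis using n(1) S[OF n(1)] by blast
  qed
  moreover have "fin_below R x" if "x \<in> D N" for x
    unfolding fin_below_def using that RD by blast
  moreover have "\<not> fin_above R x" if x: "x \<in> D N" "R x x" for x
  proof
    assume "fin_above R x"
    then obtain b where b: "b \<in> D N" "\<And>y. y \<in> D N \<Longrightarrow> R x y \<Longrightarrow> x \<noteq> y \<Longrightarrow> le y b"
      unfolding fin_above_def by blast
    \<comment> \<open>A number at or above both \<open>x\<close> and the alleged bound
      \<open>b\<close>; its successor lies strictly above \<open>x\<close> and violates the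
      bound.\<close>
    define y where "y = add x b"
    have y: "y \<in> D N" "le x y" "le b y"
      unfolding y_def using x(1) b(1) le_add[OF b(1) x(1)] add_comm[OF b(1) x(1)] by simp_all
    have "le x (S y)" using y x(1) le_trans[of x y "S y"] by simp
    then have "R x (S y)" using x y RD[of x x] by (intro RI) simp_all
    moreover have "x \<noteq> S y" using y not_S_le_self[of y] by auto
    ultimately have "le (S y) b" using b(2)[of "S y"] y(1) by simp
    then have "le (S y) y" using y b(1) le_trans[of "S y" b y] by simp
    then show False using y(1) by simp
  qed
  ultimately show ?thesis unfolding stable_def by blast
qed

lemma order_rel:
  assumes f: "f \<in> D one"
  defines "X \<equiv> ap (cl order_tm) f"
  shows "X \<in> D one" "x \<in> D N \<Longrightarrow> ap X x = z \<or> ap X x = S z"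
    "x \<in> D N \<Longrightarrow> y \<in> D N \<Longrightarrow> rel X x y \<longleftrightarrow> le x y \<and> ap f (search f x) = z"
proof -
  show "X \<in> D one" unfolding X_def
    by (rule ap_in[OF cl_in f]) (simp add: has_type_def)
  have X: "ap X p = (if le (pfst p) (psnd p) \<and> ap f (search f (pfst p)) = z then S z else z)"
    if "p \<in> D N" for p
    unfolding X_def cl_def order_tm_def using that f by (simp add: le_def)
  show "ap X x = z \<or> ap X x = S z" if "x \<in> D N" using X[OF that] by simp
  show "rel X x y \<longleftrightarrow> le x y \<and> ap f (search f x) = z" if "x \<in> D N" "y \<in> D N"
    using that X[of "pr x y"] by (simp add: rel_def)
qed

lemma mu_tm_correct:
  assumes \<Psi>: "\<Psi> \<in> D (one \<rightarrow>\<^sub>t one)" "solves_usads \<Psi>"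
  shows "solves_mu (ap (cl mu_tm) \<Psi>)"
  unfolding solves_mu_def
proof (intro ballI impI)
  fix f assume f: "f \<in> D one" and "\<exists>n\<in>D N. ap f n = z"
  then obtain n where n: "n \<in> D N" "ap f n = z" by blast
  obtain X where X_eq: "X = ap (cl order_tm) f" by blast
  define M where M_eq: "M x \<longleftrightarrow> ap f (search f x) = z" for x
  note X = order_rel[OF f, folded X_eq M_eq]
  have M: "M y" if "x \<in> D N" "y \<in> D N" "M x" "le x y" for x y
  proof -
    have s: "search f x \<in> D N" using f that(1) by simp
    have "le (search f x) y" by (rule le_trans[OF search_le[OF f that(1)] that(4) s that(1,2)])
    then show ?thesis using search_zero[OF f that(2) s] that(3) unfolding M_eq by blast
  qed
  have "M n" unfolding M_eq by (rule search_zero[OF f n(1,1) le_refl[OF n(1)] n(2)])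
  have "stable (rel X)"
    by (rule stable_final_segment[of "rel X" M n, OF X(3) M n(1) \<open>M n\<close>])
  with \<Psi>(2) X(1,2) have "monotone_seq X (ap \<Psi> X)" unfolding solves_usads_def by blast
  then have "rel X (ap (ap \<Psi> X) z) (ap (ap \<Psi> X) (S z)) \<or> rel X (ap (ap \<Psi> X) (S z)) (ap (ap \<Psi> X) z)"
    unfolding monotone_seq_def using I_in(1) by blast
  moreover have in_N: "ap (ap \<Psi> X) z \<in> D N" "ap (ap \<Psi> X) (S z) \<in> D N" using \<Psi>(1) X(1) by simp_all
  \<comment> \<open>Either alternative puts the first value into the field: if the sequence
    descends, \<open>M\<close> holds at the second value and passes up to the first.\<close>
  ultimately have "M (ap (ap \<Psi> X) z)"
    using X(3)[OF in_N] X(3)[OF in_N(2,1)] M[OF in_N(2,1)] by blast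
  moreover have "ap (ap (cl mu_tm) \<Psi>) f = search f (ap (ap \<Psi> X) z)"
    unfolding cl_def[of mu_tm] unfolding mu_tm_def using f \<Psi>(1) by (simp add: ev_closed[of order_tm] X_eq)
  ultimately show "ap f (ap (ap (cl mu_tm) \<Psi>) f) = z" by (simp add: M_eq)
qed

end

section \<open>From mu to USADS\<close>

abbreviation rel_ty :: ty where "rel_ty \<equiv> N \<rightarrow>\<^sub>t one"

definition eq_tm :: "tm \<Rightarrow> tm \<Rightarrow> tm" where
  "eq_tm s t = monus_tm s t \<^bold>+ monus_tm t s"

text \<open>Relations are represented by elements of type \<open>rel_ty\<close>, with value 0 meaning that the relation holds.\<close>

definition rel_tm :: tm where
  "rel_tm = Lam one 0 (\<lambda>X. Lam N 0 (\<lambda>s. Lam N 1 (\<lambda>t.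
     eq_tm (X \<^bold>\<cdot> pair_tm s t) (Succ \<^bold>\<cdot> Zero))))"

definition converse_tm :: tm where
  "converse_tm = Lam rel_ty 0 (\<lambda>r. Lam N 0 (\<lambda>s. Lam N 1 (\<lambda>t. r \<^bold>\<cdot> t \<^bold>\<cdot> s)))"

text \<open>As a function of \<open>y\<close>, its zeros are the counterexamples to \<open>b\<close>
  being a bound for the predecessors of \<open>x\<close>. Below, \<open>bound_tm\<close> eliminates
  the quantifier over \<open>y\<close> and \<open>fin_tm\<close> the one over \<open>b\<close>, each
  by \<open>\<mu>\<close>.\<close>

definition unbounded_tm :: tm where
  "unbounded_tm = Lam rel_ty 0 (\<lambda>r. Lam N 0 (\<lambda>x. Lam N 1 (\<lambda>b. Lam N 2 (\<lambda>y.
     cond_tm (r \<^bold>\<cdot> y \<^bold>\<cdot> x) (cond_tm (eq_tm y x) (Succ \<^bold>\<cdot> Zero)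
       (cond_tm (monus_tm y b) (Succ \<^bold>\<cdot> Zero) Zero)) (Succ \<^bold>\<cdot> Zero)))))"

definition bound_tm :: tm where
  "bound_tm = Lam two 0 (\<lambda>\<mu>. Lam rel_ty 0 (\<lambda>r. Lam N 0 (\<lambda>x. Lam N 1 (\<lambda>b.
     cond_tm (unbounded_tm \<^bold>\<cdot> r \<^bold>\<cdot> x \<^bold>\<cdot> b \<^bold>\<cdot> (\<mu> \<^bold>\<cdot> (unbounded_tm \<^bold>\<cdot> r \<^bold>\<cdot> x \<^bold>\<cdot> b)))
       (Succ \<^bold>\<cdot> Zero) Zero))))"

definition fin_tm :: tm where
  "fin_tm = Lam two 0 (\<lambda>\<mu>. Lam rel_ty 0 (\<lambda>r. Lam N 0 (\<lambda>x.
     cond_tm (r \<^bold>\<cdot> x \<^bold>\<cdot> x) (bound_tm \<^bold>\<cdot> \<mu> \<^bold>\<cdot> r \<^bold>\<cdot> x \<^bold>\<cdot> (\<mu> \<^bold>\<cdot> (bound_tm \<^bold>\<cdot> \<mu> \<^bold>\<cdot> r \<^bold>\<cdot> x)))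
       (Succ \<^bold>\<cdot> Zero))))"

text \<open>The next term must again have finitely many predecessors, so that the iteration never
  gets stuck.\<close>

definition above_tm :: tm where
  "above_tm = Lam two 0 (\<lambda>\<mu>. Lam rel_ty 0 (\<lambda>r. Lam N 0 (\<lambda>x. Lam N 1 (\<lambda>y.
     cond_tm (r \<^bold>\<cdot> x \<^bold>\<cdot> y) (cond_tm (eq_tm x y) (Succ \<^bold>\<cdot> Zero) (fin_tm \<^bold>\<cdot> \<mu> \<^bold>\<cdot> r \<^bold>\<cdot> y))
       (Succ \<^bold>\<cdot> Zero)))))"

text \<open>The argument \<open>i\<close> is the counter that the recursor passes to its step
  function.\<close>

definition next_tm :: tm where
  "next_tm = Lam two 0 (\<lambda>\<mu>. Lam rel_ty 0 (\<lambda>r. Lam N 0 (\<lambda>x. Lam N 1 (\<lambda>i.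
     \<mu> \<^bold>\<cdot> (above_tm \<^bold>\<cdot> \<mu> \<^bold>\<cdot> r \<^bold>\<cdot> x)))))"

definition seq_tm :: "tm \<Rightarrow> tm \<Rightarrow> tm \<Rightarrow> tm" where
  "seq_tm \<mu> r n = Rec \<^bold>\<cdot> n \<^bold>\<cdot> (\<mu> \<^bold>\<cdot> (fin_tm \<^bold>\<cdot> \<mu> \<^bold>\<cdot> r)) \<^bold>\<cdot> (next_tm \<^bold>\<cdot> \<mu> \<^bold>\<cdot> r)"

definition usads_tm :: tm where
  "usads_tm = Lam two 0 (\<lambda>\<mu>. Lam one 0 (\<lambda>X. Lam N 0 (\<lambda>n.
     cond_tm (fin_tm \<^bold>\<cdot> \<mu> \<^bold>\<cdot> (rel_tm \<^bold>\<cdot> X) \<^bold>\<cdot> (\<mu> \<^bold>\<cdot> (fin_tm \<^bold>\<cdot> \<mu> \<^bold>\<cdot> (rel_tm \<^bold>\<cdot> X))))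
       (seq_tm \<mu> (rel_tm \<^bold>\<cdot> X) n) (seq_tm \<mu> (converse_tm \<^bold>\<cdot> (rel_tm \<^bold>\<cdot> X)) n))))"

lemma eq_tm_simps [simp]:
  "tyof (eq_tm s t) = N"
  "wt s \<Longrightarrow> tyof s = N \<Longrightarrow> wt t \<Longrightarrow> tyof t = N \<Longrightarrow> wt (eq_tm s t)"
  "vars (eq_tm s t) = vars s \<union> vars t"
  by (auto simp: eq_tm_def)

lemma rel_tm_simps [simp]:
  "tyof rel_tm = one \<rightarrow>\<^sub>t rel_ty" "wt rel_tm" "vars rel_tm = {}"
  by (auto simp: rel_tm_def)

lemma converse_tm_simps [simp]:
  "tyof converse_tm = rel_ty \<rightarrow>\<^sub>t rel_ty" "wt converse_tm" "vars converse_tm = {}"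
  by (auto simp: converse_tm_def)

lemma unbounded_tm_simps [simp]:
  "tyof unbounded_tm = rel_ty \<rightarrow>\<^sub>t N \<rightarrow>\<^sub>t N \<rightarrow>\<^sub>t one" "wt unbounded_tm" "vars unbounded_tm = {}"
  by (auto simp: unbounded_tm_def)

lemma bound_tm_simps [simp]:
  "tyof bound_tm = two \<rightarrow>\<^sub>t rel_ty \<rightarrow>\<^sub>t N \<rightarrow>\<^sub>t one" "wt bound_tm" "vars bound_tm = {}"
  by (auto simp: bound_tm_def)

lemma fin_tm_simps [simp]:
  "tyof fin_tm = two \<rightarrow>\<^sub>t rel_ty \<rightarrow>\<^sub>t one" "wt fin_tm" "vars fin_tm = {}"
  by (auto simp: fin_tm_def)

lemma above_tm_simps [simp]:
  "tyof above_tm = two \<rightarrow>\<^sub>t rel_ty \<rightarrow>\<^sub>t N \<rightarrow>\<^sub>t one" "wt above_tm" "vars above_tm = {}"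
  by (auto simp: above_tm_def)

lemma next_tm_simps [simp]:
  "tyof next_tm = two \<rightarrow>\<^sub>t rel_ty \<rightarrow>\<^sub>t N \<rightarrow>\<^sub>t one" "wt next_tm" "vars next_tm = {}"
  by (auto simp: next_tm_def)

lemma seq_tm_simps [simp]:
  "tyof (seq_tm \<mu> r n) = N"
  "wt \<mu> \<Longrightarrow> tyof \<mu> = two \<Longrightarrow> wt r \<Longrightarrow> tyof r = rel_ty \<Longrightarrow> wt n \<Longrightarrow> tyof n = N \<Longrightarrow> wt (seq_tm \<mu> r n)"
  "vars (seq_tm \<mu> r n) = vars \<mu> \<union> vars r \<union> vars n"
  by (auto simp: seq_tm_def)

lemma usads_tm_simps [simp]:
  "tyof usads_tm = two \<rightarrow>\<^sub>t one \<rightarrow>\<^sub>t one" "wt usads_tm" "vars usads_tm = {}"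
  by (auto simp: usads_tm_def)

context model
begin

lemma ev_eq_tm: "ev v s \<in> D N \<Longrightarrow> ev v t \<in> D N \<Longrightarrow> ev v (eq_tm s t) = z \<longleftrightarrow> ev v s = ev v t"
proof -
  have *: "a = b" if "a \<in> D N" "b \<in> D N" "add (sub a b) (sub b a) = z" for a b
  proof -
    have "sub b a \<in> D N" using that by simp
    then have "sub b a = z"
    proof (cases rule: nat_cases)
      case (2 y)
      then show ?thesis using that by simp
    qed
    then have "sub a b = z" using that by simp
    with \<open>sub b a = z\<close> show ?thesis using that le_antisym by (simp add: le_def)
  qed
  assume "ev v s \<in> D N" "ev v t \<in> D N"
  then show ?thesis using *[of "ev v s" "ev v t"] by (auto simp: eq_tm_def)
qed

lemma ev_eq_tm_in [simp]: "ev v s \<in> D N \<Longrightarrow> ev v t \<in> D N \<Longrightarrow> ev v (eq_tm s t) \<in> D N"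
  by (simp add: eq_tm_def)

lemma ap_in3: "c \<in> D (\<rho> \<rightarrow>\<^sub>t \<sigma> \<rightarrow>\<^sub>t \<delta> \<rightarrow>\<^sub>t \<tau>) \<Longrightarrow> x \<in> D \<rho> \<Longrightarrow> y \<in> D \<sigma> \<Longrightarrow> u \<in> D \<delta> \<Longrightarrow> ap (ap (ap c x) y) u \<in> D \<tau>"
  by (rule ap_in[OF ap_in2])

lemma cl_tm_in:
  "cl rel_tm \<in> D (one \<rightarrow>\<^sub>t rel_ty)" "cl converse_tm \<in> D (rel_ty \<rightarrow>\<^sub>t rel_ty)"
  "cl unbounded_tm \<in> D (rel_ty \<rightarrow>\<^sub>t N \<rightarrow>\<^sub>t N \<rightarrow>\<^sub>t one)"
  "cl bound_tm \<in> D (two \<rightarrow>\<^sub>t rel_ty \<rightarrow>\<^sub>t N \<rightarrow>\<^sub>t one)"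
  "cl fin_tm \<in> D (two \<rightarrow>\<^sub>t rel_ty \<rightarrow>\<^sub>t one)"
  "cl above_tm \<in> D (two \<rightarrow>\<^sub>t rel_ty \<rightarrow>\<^sub>t N \<rightarrow>\<^sub>t one)"
  "cl next_tm \<in> D (two \<rightarrow>\<^sub>t rel_ty \<rightarrow>\<^sub>t N \<rightarrow>\<^sub>t one)"
  "cl usads_tm \<in> D (two \<rightarrow>\<^sub>t one \<rightarrow>\<^sub>t one)"
  by (rule cl_in, simp add: has_type_def)+

lemmas ap_tm_in [simp] = ap_in[OF cl_tm_in(1)] ap_in[OF cl_tm_in(2)] ap_in3[OF cl_tm_in(3)]
  ap_in3[OF cl_tm_in(4)] ap_in2[OF cl_tm_in(5)] ap_in3[OF cl_tm_in(6)] ap_in2[OF cl_tm_in(7)]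
  ap_in[OF cl_tm_in(8)]

lemmas ev_tms = ev_closed[of rel_tm] ev_closed[of converse_tm] ev_closed[of unbounded_tm]
  ev_closed[of bound_tm] ev_closed[of fin_tm] ev_closed[of above_tm] ev_closed[of next_tm]

definition zrel :: "'a \<Rightarrow> 'a \<Rightarrow> 'a \<Rightarrow> bool" where
  "zrel r x y \<longleftrightarrow> ap (ap r x) y = z"

lemma zrel_rel:
  "X \<in> D one \<Longrightarrow> x \<in> D N \<Longrightarrow> y \<in> D N \<Longrightarrow> zrel (ap (cl rel_tm) X) x y \<longleftrightarrow> rel X x y"
  unfolding cl_def[of rel_tm] unfolding rel_tm_def zrel_def rel_def by (simp add: ev_eq_tm)

lemma zrel_converse:
  "r \<in> D rel_ty \<Longrightarrow> x \<in> D N \<Longrightarrow> y \<in> D N \<Longrightarrow> zrel (ap (cl converse_tm) r) x y \<longleftrightarrow> zrel r y x"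
  unfolding cl_def[of converse_tm] unfolding converse_tm_def zrel_def by simp

lemma ap_unbounded:
  assumes "r \<in> D rel_ty" "x \<in> D N" "b \<in> D N" "y \<in> D N"
  shows "ap (ap (ap (ap (cl unbounded_tm) r) x) b) y = z \<longleftrightarrow> zrel r y x \<and> y \<noteq> x \<and> \<not> le y b"
  unfolding cl_def[of unbounded_tm] unfolding unbounded_tm_def zrel_def
  using assms by (simp add: ev_eq_tm le_def)

section \<open>Deciding finiteness with \<open>\<mu>\<close> and climbing along a relation\<close>

context
  fixes \<mu> r
  assumes \<mu>: "\<mu> \<in> D two" "solves_mu \<mu>" and r: "r \<in> D rel_ty"
begin

text \<open>An existential statement about an object becomes an equation, which may then occur in
  further terms and in inductions.\<close>

lemma mu_iff: "f \<in> D one \<Longrightarrow> ap f (ap \<mu> f) = z \<longleftrightarrow> (\<exists>n\<in>D N. ap f n = z)"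
  using \<mu> in_simps(4) unfolding solves_mu_def by blast

lemma ap_bound:
  assumes "x \<in> D N" "b \<in> D N"
  shows "ap (ap (ap (ap (cl bound_tm) \<mu>) r) x) b = z \<longleftrightarrow> (\<forall>y\<in>D N. zrel r y x \<and> y \<noteq> x \<longrightarrow> le y b)"
proof -
  let ?f = "ap (ap (ap (cl unbounded_tm) r) x) b"
  have f: "?f \<in> D one" using assms r by simp
  have eval: "ap (ap (ap (ap (cl bound_tm) \<mu>) r) x) b = (if ap ?f (ap \<mu> ?f) = z then S z else z)"
    unfolding cl_def[of bound_tm] unfolding bound_tm_def using assms \<mu> r by (simp add: ev_tms)
  have "(\<exists>y\<in>D N. ap ?f y = z) \<longleftrightarrow> \<not> (\<forall>y\<in>D N. zrel r y x \<and> y \<noteq> x \<longrightarrow> le y b)"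
    using ap_unbounded[OF r assms] by blast
  then have not_bound: "ap ?f (ap \<mu> ?f) = z \<longleftrightarrow> \<not> (\<forall>y\<in>D N. zrel r y x \<and> y \<noteq> x \<longrightarrow> le y b)"
    unfolding mu_iff[OF f] .
  have "(if \<not> Q then S z else z) = z \<longleftrightarrow> Q" for Q by simp
  then show ?thesis unfolding eval not_bound .
qed

lemma ap_fin:
  assumes "x \<in> D N"
  shows "ap (ap (ap (cl fin_tm) \<mu>) r) x = z \<longleftrightarrow> zrel r x x \<and> fin_below (zrel r) x"
proof -
  let ?f = "ap (ap (ap (cl bound_tm) \<mu>) r) x"
  have f: "?f \<in> D one" using assms \<mu> r by simp
  have eval: "ap (ap (ap (cl fin_tm) \<mu>) r) x = (if zrel r x x then ap ?f (ap \<mu> ?f) else S z)"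
    unfolding cl_def[of fin_tm] unfolding fin_tm_def zrel_def
    using assms \<mu> r by (simp add: ev_tms)
  have "(\<exists>b\<in>D N. ap ?f b = z) \<longleftrightarrow> fin_below (zrel r) x"
    unfolding fin_below_def by (rule bex_cong[OF refl ap_bound[OF assms]])
  then have "ap ?f (ap \<mu> ?f) = z \<longleftrightarrow> fin_below (zrel r) x" unfolding mu_iff[OF f] .
  then show ?thesis unfolding eval by (cases "zrel r x x") simp_all
qed

lemma ap_above:
  assumes "x \<in> D N" "y \<in> D N"
  shows "ap (ap (ap (ap (cl above_tm) \<mu>) r) x) y = z \<longleftrightarrow>
    zrel r x y \<and> x \<noteq> y \<and> zrel r y y \<and> fin_below (zrel r) y"
  unfolding ap_fin[OF assms(2), symmetric]
  unfolding cl_def[of above_tm] unfolding above_tm_def zrel_def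
  using assms \<mu> r by (simp add: ev_eq_tm ev_tms)

text \<open>The relation \<open>r\<close> is a parameter because the iteration is run on the order
  as well as on its converse.\<close>

definition seq :: "'a \<Rightarrow> 'a" where
  "seq n = rec n (ap \<mu> (ap (ap (cl fin_tm) \<mu>) r)) (ap (ap (cl next_tm) \<mu>) r)"

lemma seq_simps:
  "seq z = ap \<mu> (ap (ap (cl fin_tm) \<mu>) r)"
  "n \<in> D N \<Longrightarrow> seq (S n) = ap \<mu> (ap (ap (ap (cl above_tm) \<mu>) r) (seq n))"
proof -
  show "seq z = ap \<mu> (ap (ap (cl fin_tm) \<mu>) r)" unfolding seq_def using \<mu> r by simp
  assume n: "n \<in> D N"
  have "ap (ap (ap (ap (cl next_tm) \<mu>) r) x) n = ap \<mu> (ap (ap (ap (cl above_tm) \<mu>) r) x)"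
    if "x \<in> D N" for x
    unfolding cl_def[of next_tm] unfolding next_tm_def
    using that n \<mu> r by (simp add: ev_tms)
  then show "seq (S n) = ap \<mu> (ap (ap (ap (cl above_tm) \<mu>) r) (seq n))"
    unfolding seq_def using \<mu> r n by simp
qed

lemma seq_in: "n \<in> D N \<Longrightarrow> seq n \<in> D N"
  unfolding seq_def using \<mu> r by simp

text \<open>
  An element with finitely many predecessors has infinitely many successors; so it is not the last
  element, and its immediate successor has only one predecessor more.
\<close>

lemma fin_below_above:
  assumes st: "stable (zrel r)" and x: "x \<in> D N" "zrel r x x" "fin_below (zrel r) x"
  shows "\<exists>y\<in>D N. zrel r x y \<and> x \<noteq> y \<and> zrel r y y \<and> fin_below (zrel r) y"
proof -
  let ?R = "zrel r"
  have lin: "linear ?R" and disc: "discrete_above ?R x" and inf: "\<not> fin_above ?R x"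
    using st x unfolding stable_def by blast+
  have field: "?R u u \<and> ?R w w" if "?R u w" "u \<in> D N" "w \<in> D N" for u w
    using lin that unfolding linear_def by blast
  have total: "?R u w \<or> ?R w u" if "?R u u" "?R w w" "u \<in> D N" "w \<in> D N" for u w
    using lin that unfolding linear_def by blast
  have antisym: "u = w" if "?R u w" "?R w u" "u \<in> D N" "w \<in> D N" for u w
    using lin that unfolding linear_def by blast
  \<comment> \<open>Not even 0 bounds the successors of \<open>x\<close>, so there is at least
    one.\<close>
  obtain y0 where y0: "y0 \<in> D N" "?R x y0" "x \<noteq> y0"
    using inf I_in(1) unfolding fin_above_def by blast
  have "\<not> (\<forall>y\<in>D N. ?R y y \<longrightarrow> ?R y x)"
  proof
    assume "\<forall>y\<in>D N. ?R y y \<longrightarrow> ?R y x"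
    then have "?R y0 x" using field[OF y0(2) x(1) y0(1)] y0(1) by simp
    then show False using antisym[OF y0(2) _ x(1) y0(1)] y0(3) by simp
  qed
  then have "\<exists>y\<in>D N. (?R x y \<and> x \<noteq> y) \<and> \<not> (\<exists>w\<in>D N. (?R x w \<and> x \<noteq> w) \<and> ?R w y \<and> w \<noteq> y)"
    using disc unfolding discrete_above_def by (simp only: simp_thms)
  then obtain y where y: "y \<in> D N" "?R x y" "x \<noteq> y"
    and btw: "\<And>w. w \<in> D N \<Longrightarrow> ?R x w \<Longrightarrow> x \<noteq> w \<Longrightarrow> ?R w y \<Longrightarrow> w = y"
    by blast
  obtain b where b: "b \<in> D N" "\<And>w. w \<in> D N \<Longrightarrow> ?R w x \<Longrightarrow> w \<noteq> x \<Longrightarrow> le w b"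
    using x(3) unfolding fin_below_def by blast
  \<comment> \<open>The predecessors of \<open>y\<close> are \<open>x\<close> and the predecessors
    of \<open>x\<close>; the sum is at least \<open>x\<close> and at least their bound
    \<open>b\<close>.\<close>
  have "le w (add b x)" if w: "w \<in> D N" "?R w y" "w \<noteq> y" for w
  proof (cases "w = x")
    case True
    then show ?thesis using le_add[OF x(1) b(1)] add_comm[OF b(1) x(1)] by simp
  next
    case False
    have "?R x w \<or> ?R w x" using field[OF w(2,1) y(1)] total[of x w] w(1) x by blast
    then have "?R w x" using btw[of w] w False by blast
    then have "le w b" using b w False by blast
    then show ?thesis using le_trans[of w b "add b x"] w b(1) x(1) by simp
  qed
  then have "fin_below ?R y" unfolding fin_below_def using b(1) x(1) by (intro bexI[of _ "add b x"]) auto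
  moreover have "?R y y" using field[OF y(2) x(1) y(1)] by blast
  ultimately show ?thesis using y by blast
qed

text \<open>That each term has finitely many predecessors is carried through the induction as the
  equation \<open>ap ?A (seq n) = z\<close>, which is decidable; the condition itself quantifies
  over numbers and is out of reach of \<open>induct_dec\<close> as it stands.\<close>

lemma seq_increasing:
  assumes st: "stable (zrel r)" and ex: "\<exists>x\<in>D N. zrel r x x \<and> fin_below (zrel r) x" and n: "n \<in> D N"
  shows "zrel r (seq n) (seq (S n)) \<and> seq n \<noteq> seq (S n)"
proof -
  let ?A = "ap (ap (cl fin_tm) \<mu>) r"
  have A: "?A \<in> D one" using \<mu> r by simp
  have step: "zrel r (seq m) (seq (S m)) \<and> seq m \<noteq> seq (S m) \<and> ap ?A (seq (S m)) = z"
    if m: "m \<in> D N" and z: "ap ?A (seq m) = z" for m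
  proof -
    let ?B = "ap (ap (ap (cl above_tm) \<mu>) r) (seq m)"
    have s: "seq m \<in> D N" "seq (S m) \<in> D N" using m seq_in in_simps(1) I_in(2) by blast+
    then have B: "?B \<in> D one" using \<mu> r by simp
    have "\<exists>y\<in>D N. ap ?B y = z"
      using fin_below_above[OF st s(1)] z unfolding ap_fin[OF s(1)] using ap_above[OF s(1)] by blast
    then have "ap ?B (seq (S m)) = z" unfolding seq_simps(2)[OF m] mu_iff[OF B] .
    then show ?thesis unfolding ap_above[OF s] ap_fin[OF s(2)] by blast
  qed
  have "ap ?A (seq n) = z"
  proof (rule induct_dec[of "\<lambda>n. ap ?A (seq n) = z", OF _ _ _ n])
    show "dec (\<lambda>n. ap ?A (seq n) = z)"
      unfolding seq_def using A \<mu> r by (intro dec_zero df_ap df_rec df_id df_const) simp_all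
    show "ap ?A (seq z) = z"
      unfolding seq_simps(1) mu_iff[OF A] using ex ap_fin by blast
  qed (use step in blast)
  then show ?thesis using step n by blast
qed

end

lemma stable_cong:
  assumes "\<And>x y. x \<in> D N \<Longrightarrow> y \<in> D N \<Longrightarrow> R x y \<longleftrightarrow> Q x y"
  shows "stable R \<longleftrightarrow> stable Q"
  unfolding stable_def linear_def discrete_below_def discrete_above_def fin_below_def fin_above_def
  by (simp only: assms cong: ball_cong bex_cong)

lemma usads_tm_correct:
  assumes \<mu>: "\<mu> \<in> D two" "solves_mu \<mu>"
  shows "solves_usads (ap (cl usads_tm) \<mu>)"
  unfolding solves_usads_def
proof (intro ballI impI, elim conjE)
  fix X assume X: "X \<in> D one" and st: "stable (rel X)"
  define r where "r = ap (cl rel_tm) X"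
  define r' where "r' = ap (cl converse_tm) r"
  have r: "r \<in> D rel_ty" "r' \<in> D rel_ty" unfolding r_def r'_def using X by simp_all
  have zr: "zrel r x y \<longleftrightarrow> rel X x y" if "x \<in> D N" "y \<in> D N" for x y
    unfolding r_def using that X by (simp add: zrel_rel)
  have zr': "zrel r' x y \<longleftrightarrow> rel X y x" if "x \<in> D N" "y \<in> D N" for x y
    unfolding r'_def using that r zr by (simp add: zrel_converse)
  have st1: "stable (zrel r)" using st stable_cong[of "zrel r" "rel X"] zr by blast
  have st2: "stable (zrel r')"
    using stable_converse[OF st] stable_cong[of "zrel r'" "\<lambda>x y. rel X y x"] zr' by blast
  let ?A = "ap (ap (cl fin_tm) \<mu>) r"
  have A: "?A \<in> D one" using \<mu> r by simp
  have ap: "ap (ap (ap (cl usads_tm) \<mu>) X) n =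
      (if ap ?A (ap \<mu> ?A) = z then seq \<mu> r n else seq \<mu> r' n)" if "n \<in> D N" for n
    unfolding seq_def[OF \<mu> r(1)] seq_def[OF \<mu> r(2)] unfolding cl_def[of usads_tm]
    unfolding usads_tm_def r'_def r_def
    using \<mu> X that by (simp add: seq_tm_def ev_tms)
  have Sn: "S n \<in> D N" if "n \<in> D N" for n using that by simp
  show "monotone_seq X (ap (ap (cl usads_tm) \<mu>) X)"
  proof (cases "ap ?A (ap \<mu> ?A) = z")
    case True
    then have ex: "\<exists>x\<in>D N. zrel r x x \<and> fin_below (zrel r) x"
      unfolding mu_iff[OF \<mu> r(1) A] using ap_fin[OF \<mu> r(1)] by blast
    show ?thesis
      unfolding monotone_seq_def
    proof (intro disjI1 ballI)
      fix n assume n: "n \<in> D N"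
      note s = seq_in[OF \<mu> r(1) n] seq_in[OF \<mu> r(1) Sn[OF n]]
      show "rel X (ap (ap (ap (cl usads_tm) \<mu>) X) n) (ap (ap (ap (cl usads_tm) \<mu>) X) (S n)) \<and>
        ap (ap (ap (cl usads_tm) \<mu>) X) n \<noteq> ap (ap (ap (cl usads_tm) \<mu>) X) (S n)"
        unfolding ap[OF n] ap[OF Sn[OF n]] if_P[OF True]
        using seq_increasing[OF \<mu> r(1) st1 ex n] unfolding zr[OF s] by simp
    qed
  next
    case False
    \<comment> \<open>No element has finitely many predecessors, so by stability each has finitely
      many successors; for the converse relation these are its predecessors.\<close>
    then have none: "\<not> fin_below (zrel r) x" if "x \<in> D N" "zrel r x x" for x
      unfolding mu_iff[OF \<mu> r(1) A] using ap_fin[OF \<mu> r(1)] that by blast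
    obtain x where x: "x \<in> D N" "zrel r x x" using st1 unfolding stable_def by blast
    then have "fin_above (zrel r) x" using st1 none unfolding stable_def by blast
    then obtain b where b: "b \<in> D N" "\<And>y. y \<in> D N \<Longrightarrow> zrel r x y \<Longrightarrow> x \<noteq> y \<Longrightarrow> le y b"
      unfolding fin_above_def by blast
    have "fin_below (zrel r') x"
      unfolding fin_below_def
    proof (intro bexI[OF _ b(1)] ballI impI, elim conjE)
      fix y assume y: "y \<in> D N" "zrel r' y x" "y \<noteq> x"
      then show "le y b" using b(2)[OF y(1)] unfolding zr[OF x(1) y(1)] zr'[OF y(1) x(1)] by blast
    qed
    then have ex: "\<exists>x\<in>D N. zrel r' x x \<and> fin_below (zrel r') x"
      using x unfolding zr[OF x(1) x(1)] using zr'[OF x(1) x(1)] by blast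
    show ?thesis
      unfolding monotone_seq_def
    proof (intro disjI2 ballI)
      fix n assume n: "n \<in> D N"
      note s = seq_in[OF \<mu> r(2) n] seq_in[OF \<mu> r(2) Sn[OF n]]
      show "rel X (ap (ap (ap (cl usads_tm) \<mu>) X) (S n)) (ap (ap (ap (cl usads_tm) \<mu>) X) n) \<and>
        ap (ap (ap (cl usads_tm) \<mu>) X) (S n) \<noteq> ap (ap (ap (cl usads_tm) \<mu>) X) n"
        unfolding ap[OF n] ap[OF Sn[OF n]] if_not_P[OF False]
        \<comment> \<open>Ascending for the converse relation means descending for
          \<open>X\<close>.\<close>
        using seq_increasing[OF \<mu> r(2) st2 ex n] unfolding zr'[OF s] by (rule conj_forward) (assumption, erule not_sym)
    qed
  qed
qed

end

section \<open>The explicit equivalence\<close>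

lemma wf_Stable: "wf_fm (Stable (Var one n))"
  by (simp add: Stable_def Linear_order_def Discrete_def Finitely_many_def Is_set_def
      ltX_def leX_def Field_mem_def Mem_def Leq_def has_type_def)

lemma wf_USADS: "wf_fm USADS_matrix"
  by (simp add: USADS_matrix_def wf_Stable ltX_def leX_def Mem_def has_type_def Let_def)

lemma wf_mu: "wf_fm mu_matrix"
  by (simp add: mu_matrix_def has_type_def Let_def)

text \<open>\<open>B\<close> is evaluated at two assignments: the explicit statement has it in the
  scope of the quantifier over \<open>\<rho>\<close>, the implication between existential statements
  outside of that scope.\<close>

lemma explicit_implicationI:
  assumes t: "wt t" "vars t = {}" "tyof t = \<rho> \<rightarrow>\<^sub>t \<sigma>" and wf: "wf_fm A" "wf_fm B"
    and sem: "\<And>(D :: ty \<Rightarrow> tm set) ap I v a. model D ap I \<Longrightarrow> frame.valid D v \<Longrightarrow> a \<in> D \<rho> \<Longrightarrow>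
      frame.sem D ap I (push \<rho> a v) A \<Longrightarrow>
      frame.sem D ap I (push \<sigma> (ap (model.cl D ap I t) a) (push \<rho> a v)) B \<and>
      frame.sem D ap I (push \<sigma> (ap (model.cl D ap I t) a) v) B"
  shows "explicit_implication \<rho> A \<sigma> B"
proof -
  have ty: "t :\<^sub>t \<rho> \<rightarrow>\<^sub>t \<sigma>" using t by (simp add: has_type_def)
  have "RCA0w_proves (AllF \<rho> (A \<^bold>\<longrightarrow> inst \<sigma> (t \<^bold>\<cdot> Var \<rho> 0) B))"
  proof (rule completeness)
    show "wf_fm (AllF \<rho> (A \<^bold>\<longrightarrow> inst \<sigma> (t \<^bold>\<cdot> Var \<rho> 0) B))"
      using wf t by (simp add: wf_inst has_type_def)
    fix D :: "ty \<Rightarrow> tm set" and ap I v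
    assume M: "model D ap I" and v: "frame.valid D v"
    interpret model D ap I by fact
    show "sem v (AllF \<rho> (A \<^bold>\<longrightarrow> inst \<sigma> (t \<^bold>\<cdot> Var \<rho> 0) B))"
      using sem[OF M v] by (simp add: sem_inst ev_closed[OF t(2)])
  qed
  moreover have "RCA0w_proves (ExF \<rho> A \<^bold>\<longrightarrow> ExF \<sigma> B)"
  proof (rule completeness)
    show "wf_fm (ExF \<rho> A \<^bold>\<longrightarrow> ExF \<sigma> B)" using wf by simp
    fix D :: "ty \<Rightarrow> tm set" and ap I v
    assume M: "model D ap I" and v: "frame.valid D v"
    interpret model D ap I by fact
    show "sem v (ExF \<rho> A \<^bold>\<longrightarrow> ExF \<sigma> B)"
      using sem[OF M v] ap_in[OF cl_in[OF ty]] by auto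
  qed
  ultimately show ?thesis
    unfolding explicit_implication_def using t ty by (auto simp: closed_tm_iff)
qed

lemma derives_conj:
  assumes "\<Delta> \<turnstile> \<phi>" "\<Delta> \<turnstile> \<psi>" "wf_fm \<phi>" "wf_fm \<psi>"
  shows "\<Delta> \<turnstile> \<phi> \<^bold>\<and> \<psi>"
proof (rule ImpI)
  show "wf_fm (\<phi> \<^bold>\<longrightarrow> \<^bold>\<not> \<psi>)" using assms by simp
  let ?\<Delta> = "insert (\<phi> \<^bold>\<longrightarrow> \<^bold>\<not> \<psi>) \<Delta>"
  have "?\<Delta> \<turnstile> (\<phi> \<^bold>\<longrightarrow> \<^bold>\<not> \<psi>)" using assms by (intro Assm) simp_all
  moreover have "?\<Delta> \<turnstile> \<phi>" "?\<Delta> \<turnstile> \<psi>" using assms(1,2) weaken[of \<Delta>] by blast+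
  ultimately show "?\<Delta> \<turnstile> Falsum" by (blast intro: ImpE)
qed

theorem corollary4p7:
  "explicit_equivalence (one \<rightarrow>\<^sub>t one) USADS_matrix two mu_matrix"
proof -
  have "explicit_implication (one \<rightarrow>\<^sub>t one) USADS_matrix two mu_matrix"
  proof (rule explicit_implicationI[of mu_tm])
    fix D :: "ty \<Rightarrow> tm set" and ap I v \<Psi>
    assume M: "model D ap I" and \<Psi>: "\<Psi> \<in> D (one \<rightarrow>\<^sub>t one)"
      "frame.sem D ap I (push (one \<rightarrow>\<^sub>t one) \<Psi> v) USADS_matrix"
    interpret model D ap I by fact
    from \<Psi> show "sem (push two (ap (cl mu_tm) \<Psi>) (push (one \<rightarrow>\<^sub>t one) \<Psi> v)) mu_matrix \<and>
        sem (push two (ap (cl mu_tm) \<Psi>) v) mu_matrix"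
      using mu_tm_correct[of \<Psi>] by (simp add: sem_USADS sem_mu)
  qed (simp_all add: wf_USADS wf_mu)
  moreover have "explicit_implication two mu_matrix (one \<rightarrow>\<^sub>t one) USADS_matrix"
  proof (rule explicit_implicationI[of usads_tm])
    fix D :: "ty \<Rightarrow> tm set" and ap I v \<mu>
    assume M: "model D ap I" and \<mu>: "\<mu> \<in> D two"
      "frame.sem D ap I (push two \<mu> v) mu_matrix"
    interpret model D ap I by fact
    from \<mu> show "sem (push (one \<rightarrow>\<^sub>t one) (ap (cl usads_tm) \<mu>) (push two \<mu> v)) USADS_matrix \<and>
        sem (push (one \<rightarrow>\<^sub>t one) (ap (cl usads_tm) \<mu>) v) USADS_matrix"
      using usads_tm_correct[of \<mu>] by (simp add: sem_USADS sem_mu)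
  qed (simp_all add: wf_USADS wf_mu)
  \<comment> \<open>The equivalence of the existential statements is the conjunction of the two
    implications contained in the explicit ones.\<close>
  ultimately show ?thesis
    unfolding explicit_equivalence_def
    by (auto simp: explicit_implication_def wf_USADS wf_mu intro!: derives_conj)
qed

end
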